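(* The 2-monad $\mathrm{T}_q:\mathbf{ED}\to\mathbf{ED}$ of the quotient completion, on the 2-category $\mathbf{ED}$ of elementary doctrines, is lax-idempotent.
   Context: $\mathbf{InfSL}$ is the category of posets with finite meets and functions preserving finite meets. Let $\mathcal C$ be a category with binary products. An elementary doctrine on $\mathcal C$ is a functor $P:\mathcal C^{\mathrm{op}}\to\mathbf{InfSL}$ (write $P_f=P(f)$) such that for every object $A$ there is $\delta_A\in P(A\times A)$ with: (1) $\alpha\mapsto P_{\mathrm{pr}_1}(\alpha)\wedge\delta_A$ is left adjoint to $P_{\langle \mathrm{id}_A,\mathrm{id}_A\rangle}:P(A\times A)\to P(A)$; (2) for every $e=\langle \mathrm{pr}_1,\mathrm{pr}_2,\mathrm{pr}_2\rangle:X\times A\to X\times A\times A$, the assignment $\alpha\mapsto P_{\langle \mathrm{pr}_1,\mathrm{pr}_2\rangle}(\alpha)\wedge P_{\langle \mathrm{pr}_2,\mathrm{pr}_3\rangle}(\delta_A)$ is left adjoint to $P_e:P(X\times A\times A)\to P(X\times A)$. The 2-category $\mathbf{ED}$: 0-cells are elementary doctrines; a 1-cell $(F,b):P\to R$ (with $P$ on $\mathcal C$, $R$ on $\mathcal D$) is a product-preserving functor $F:\mathcal C\to\mathcal D$ with a natural transformation $b:P\Rightarrow R\circ F^{\mathrm{op}}$ such that each $b_A$ preserves finite meets and $b_{A\times A}(\delta_A)=R_{\langle F\mathrm{pr}_1,F\mathrm{pr}_2\rangle}(\delta_{FA})$; a 2-cell $(F,b)\Rightarrow(G,c)$ is a natural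 transformation $\theta:F\Rightarrow G$ with $b_A(\alpha)\le R_{\theta_A}(c_A(\alpha))$ for all $A$ and $\alpha\in P(A)$. A $P$-equivalence relation on $A$ is $\rho\in P(A\times A)$ with $\delta_A\le\rho$, $\rho\le P_{\langle\mathrm{pr}_2,\mathrm{pr}_1\rangle}(\rho)$ and $P_{\langle\mathrm{pr}_1,\mathrm{pr}_2\rangle}(\rho)\wedge P_{\langle\mathrm{pr}_2,\mathrm{pr}_3\rangle}(\rho)\le P_{\langle\mathrm{pr}_1,\mathrm{pr}_3\rangle}(\rho)$. Descent data: $\mathrm{Des}_\rho=\{\alpha\in P(A):P_{\mathrm{pr}_1}(\alpha)\wedge\rho\le P_{\mathrm{pr}_2}(\alpha)\}$. The 2-monad $\mathrm T_q$: for $P$ on $\mathcal C$, $\mathcal R_P$ is the category of pairs $(A,\rho)$ with $\rho$ a $P$-equivalence relation on $A$, an arrow $f:(A,\rho)\to(B,\sigma)$ being an arrow $f:A\to B$ of $\mathcal C$ with $\rho\le P_{f\times f}(\sigma)$. $\mathrm T_q(P)=P_q:\mathcal R_P^{\mathrm{op}}\to\mathbf{InfSL}$ is $P_q(A,\rho)=\mathrm{Des}_\rho$, $P_q(f)=P_f$, an elementary doctrine with $\delta_{(A,\rho)}=\rho$. On a 1-cell, $\mathrm T_q(F,b)=(\overline F,\overline b)$ with $\overline F(A,\rho)=(FA,R_{\langle F\mathrm{pr}_1,F\mathrm{pr}_2\rangle^{-1}}(b_{A\times A}(\rho)))$, $\overline F(f)=F(f)$, $\overline b$ the restriction of $b$;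 on 2-cells $\theta\mapsto\theta$. The unit $\eta_P:P\to P_q$ is $A\mapsto(A,\delta_A)$, identity on arrows and elements. The multiplication $\mu_P:(P_q)_q\to P_q$ is $((A,\rho),\tau)\mapsto(A,\tau)$, identity on arrows and elements. For a 2-monad $(\mathrm T,\mu,\eta)$: a (strict) $\mathrm T$-algebra is $(A,a:\mathrm TA\to A)$ with $a\circ\mathrm Ta=a\circ\mu_A$ and $a\circ\eta_A=1_A$. A lax $\mathrm T$-morphism $(f,\bar f):(A,a)\to(B,b)$ is a 1-cell $f:A\to B$ with a 2-cell $\bar f:b\circ\mathrm Tf\Rightarrow f\circ a$ such that $\bar f\mu_A=(\bar f\,\mathrm Ta)\cdot(b\,\mathrm T\bar f)$ and $\bar f\eta_A=\mathrm{id}_f$. The 2-monad $\mathrm T$ is lax-idempotent if for all $\mathrm T$-algebras $(A,a)$, $(B,b)$ and every 1-cell $f:A\to B$ there is a unique 2-cell $\bar f:b\circ\mathrm Tf\Rightarrow f\circ a$ such that $(f,\bar f)$ is a lax $\mathrm T$-morphism. *)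

theory Defs
  imports "HOL-Algebra.Galois_Connection"
begin

section \<open>Strict 2-categories and 2-monads\<close>

record ('a, 'b, 'c) two_category =
  cell0 :: "'a set"
  cell1 :: "'b set"
  cell2 :: "'c set"
  src1 :: "'b \<Rightarrow> 'a"
  tgt1 :: "'b \<Rightarrow> 'a"
  src2 :: "'c \<Rightarrow> 'b"
  tgt2 :: "'c \<Rightarrow> 'b"
  one1 :: "'a \<Rightarrow> 'b"
  one2 :: "'b \<Rightarrow> 'c"
  comp1 :: "'b \<Rightarrow> 'b \<Rightarrow> 'b" (infixr \<open>\<odot>\<index>\<close> 75)
  vcomp :: "'c \<Rightarrow> 'c \<Rightarrow> 'c" (infixr \<open>\<bullet>\<index>\<close> 70)
  hcomp :: "'c \<Rightarrow> 'c \<Rightarrow> 'c" (infixr \<open>\<star>\<index>\<close> 75)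

definition hom1 :: "('a, 'b, 'c) two_category \<Rightarrow> 'a \<Rightarrow> 'a \<Rightarrow> 'b set" where
  "hom1 K A B = {f \<in> cell1 K. src1 K f = A \<and> tgt1 K f = B}"

definition hom2 :: "('a, 'b, 'c) two_category \<Rightarrow> 'b \<Rightarrow> 'b \<Rightarrow> 'c set" where
  "hom2 K f g = {\<theta> \<in> cell2 K. src2 K \<theta> = f \<and> tgt2 K \<theta> = g}"

locale two_category =
  fixes K :: "('a, 'b, 'c) two_category" (structure)
  assumes cell1_ends: "f \<in> cell1 K \<Longrightarrow> src1 K f \<in> cell0 K \<and> tgt1 K f \<in> cell0 K"
    and cell2_ends: "\<theta> \<in> cell2 K \<Longrightarrow> src2 K \<theta> \<in> cell1 K \<and> tgt2 K \<theta> \<in> cell1 K"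
    and globular: "\<theta> \<in> cell2 K \<Longrightarrow>
      src1 K (src2 K \<theta>) = src1 K (tgt2 K \<theta>) \<and> tgt1 K (src2 K \<theta>) = tgt1 K (tgt2 K \<theta>)"
    and one1_hom: "A \<in> cell0 K \<Longrightarrow> one1 K A \<in> hom1 K A A"
    and comp1_hom: "\<lbrakk>f \<in> hom1 K A B; g \<in> hom1 K B C\<rbrakk> \<Longrightarrow> g \<odot> f \<in> hom1 K A C"
    and comp1_one_left: "f \<in> hom1 K A B \<Longrightarrow> one1 K B \<odot> f = f"
    and comp1_one_right: "f \<in> hom1 K A B \<Longrightarrow> f \<odot> one1 K A = f"
    and comp1_assoc: "\<lbrakk>f \<in> hom1 K A B; g \<in> hom1 K B C; h \<in> hom1 K C D\<rbrakk> \<Longrightarrow>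
      (h \<odot> g) \<odot> f = h \<odot> (g \<odot> f)"
    and one2_hom: "f \<in> cell1 K \<Longrightarrow> one2 K f \<in> hom2 K f f"
    and vcomp_hom: "\<lbrakk>\<theta> \<in> hom2 K f g; \<phi> \<in> hom2 K g h\<rbrakk> \<Longrightarrow> \<phi> \<bullet> \<theta> \<in> hom2 K f h"
    and vcomp_one_left: "\<theta> \<in> hom2 K f g \<Longrightarrow> one2 K g \<bullet> \<theta> = \<theta>"
    and vcomp_one_right: "\<theta> \<in> hom2 K f g \<Longrightarrow> \<theta> \<bullet> one2 K f = \<theta>"
    and vcomp_assoc: "\<lbrakk>\<theta> \<in> hom2 K f g; \<phi> \<in> hom2 K g h; \<psi> \<in> hom2 K h k\<rbrakk> \<Longrightarrow>
      (\<psi> \<bullet> \<phi>) \<bullet> \<theta> = \<psi> \<bullet> (\<phi> \<bullet> \<theta>)"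
    and hcomp_hom: "\<lbrakk>f \<in> hom1 K A B; f' \<in> hom1 K A B; g \<in> hom1 K B C; g' \<in> hom1 K B C;
      \<theta> \<in> hom2 K f f'; \<phi> \<in> hom2 K g g'\<rbrakk> \<Longrightarrow> \<phi> \<star> \<theta> \<in> hom2 K (g \<odot> f) (g' \<odot> f')"
    and hcomp_one_left: "\<lbrakk>f \<in> hom1 K A B; f' \<in> hom1 K A B; \<theta> \<in> hom2 K f f'\<rbrakk> \<Longrightarrow>
      one2 K (one1 K B) \<star> \<theta> = \<theta>"
    and hcomp_one_right: "\<lbrakk>f \<in> hom1 K A B; f' \<in> hom1 K A B; \<theta> \<in> hom2 K f f'\<rbrakk> \<Longrightarrow>
      \<theta> \<star> one2 K (one1 K A) = \<theta>"
    and hcomp_assoc: "\<lbrakk>f \<in> hom1 K A B; f' \<in> hom1 K A B; g \<in> hom1 K B C; g' \<in> hom1 K B C;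
      h \<in> hom1 K C D; h' \<in> hom1 K C D;
      \<theta> \<in> hom2 K f f'; \<phi> \<in> hom2 K g g'; \<psi> \<in> hom2 K h h'\<rbrakk> \<Longrightarrow>
      (\<psi> \<star> \<phi>) \<star> \<theta> = \<psi> \<star> (\<phi> \<star> \<theta>)"
    and hcomp_one2: "\<lbrakk>f \<in> hom1 K A B; g \<in> hom1 K B C\<rbrakk> \<Longrightarrow>
      one2 K g \<star> one2 K f = one2 K (g \<odot> f)"
    and interchange: "\<lbrakk>f \<in> hom1 K A B; f' \<in> hom1 K A B; f'' \<in> hom1 K A B;
      g \<in> hom1 K B C; g' \<in> hom1 K B C; g'' \<in> hom1 K B C;
      \<theta> \<in> hom2 K f f'; \<theta>' \<in> hom2 K f' f''; \<phi> \<in> hom2 K g g'; \<phi>' \<in> hom2 K g' g''\<rbrakk> \<Longrightarrow>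
      (\<phi>' \<bullet> \<phi>) \<star> (\<theta>' \<bullet> \<theta>) = (\<phi>' \<star> \<theta>') \<bullet> (\<phi> \<star> \<theta>)"

record ('a, 'b, 'c) two_monad =
  T0 :: "'a \<Rightarrow> 'a"
  T1 :: "'b \<Rightarrow> 'b"
  T2 :: "'c \<Rightarrow> 'c"
  unit :: "'a \<Rightarrow> 'b"
  mult :: "'a \<Rightarrow> 'b"

locale two_monad = two_category K
  for K :: "('a, 'b, 'c) two_category" (structure) +
  fixes T :: "('a, 'b, 'c) two_monad"
  assumes T0_cell: "A \<in> cell0 K \<Longrightarrow> T0 T A \<in> cell0 K"
    and T1_hom: "f \<in> hom1 K A B \<Longrightarrow> T1 T f \<in> hom1 K (T0 T A) (T0 T B)"
    and T2_hom: "\<theta> \<in> hom2 K f g \<Longrightarrow> T2 T \<theta> \<in> hom2 K (T1 T f) (T1 T g)"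
    and T1_one: "A \<in> cell0 K \<Longrightarrow> T1 T (one1 K A) = one1 K (T0 T A)"
    and T1_comp: "\<lbrakk>f \<in> hom1 K A B; g \<in> hom1 K B C\<rbrakk> \<Longrightarrow> T1 T (g \<odot> f) = T1 T g \<odot> T1 T f"
    and T2_one: "f \<in> cell1 K \<Longrightarrow> T2 T (one2 K f) = one2 K (T1 T f)"
    and T2_vcomp: "\<lbrakk>\<theta> \<in> hom2 K f g; \<phi> \<in> hom2 K g h\<rbrakk> \<Longrightarrow>
      T2 T (\<phi> \<bullet> \<theta>) = T2 T \<phi> \<bullet> T2 T \<theta>"
    and T2_hcomp: "\<lbrakk>f \<in> hom1 K A B; f' \<in> hom1 K A B; g \<in> hom1 K B C; g' \<in> hom1 K B C;
      \<theta> \<in> hom2 K f f'; \<phi> \<in> hom2 K g g'\<rbrakk> \<Longrightarrow> T2 T (\<phi> \<star> \<theta>) = T2 T \<phi> \<star> T2 T \<theta>"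
    and unit_hom: "A \<in> cell0 K \<Longrightarrow> unit T A \<in> hom1 K A (T0 T A)"
    and unit_natural1: "f \<in> hom1 K A B \<Longrightarrow> unit T B \<odot> f = T1 T f \<odot> unit T A"
    and unit_natural2: "\<lbrakk>f \<in> hom1 K A B; g \<in> hom1 K A B; \<theta> \<in> hom2 K f g\<rbrakk> \<Longrightarrow>
      one2 K (unit T B) \<star> \<theta> = T2 T \<theta> \<star> one2 K (unit T A)"
    and mult_hom: "A \<in> cell0 K \<Longrightarrow> mult T A \<in> hom1 K (T0 T (T0 T A)) (T0 T A)"
    and mult_natural1: "f \<in> hom1 K A B \<Longrightarrow> mult T B \<odot> T1 T (T1 T f) = T1 T f \<odot> mult T A"
    and mult_natural2: "\<lbrakk>f \<in> hom1 K A B; g \<in> hom1 K A B; \<theta> \<in> hom2 K f g\<rbrakk> \<Longrightarrow>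
      one2 K (mult T B) \<star> T2 T (T2 T \<theta>) = T2 T \<theta> \<star> one2 K (mult T A)"
    and mult_assoc: "A \<in> cell0 K \<Longrightarrow> mult T A \<odot> T1 T (mult T A) = mult T A \<odot> mult T (T0 T A)"
    and mult_unit_left: "A \<in> cell0 K \<Longrightarrow> mult T A \<odot> unit T (T0 T A) = one1 K (T0 T A)"
    and mult_unit_right: "A \<in> cell0 K \<Longrightarrow> mult T A \<odot> T1 T (unit T A) = one1 K (T0 T A)"

definition T_algebra ::
  "('a, 'b, 'c) two_category \<Rightarrow> ('a, 'b, 'c) two_monad \<Rightarrow> 'a \<Rightarrow> 'b \<Rightarrow> bool" where
  "T_algebra K T A a \<longleftrightarrow> A \<in> cell0 K \<and> a \<in> hom1 K (T0 T A) A \<and>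
     a \<odot>\<^bsub>K\<^esub> T1 T a = a \<odot>\<^bsub>K\<^esub> mult T A \<and> a \<odot>\<^bsub>K\<^esub> unit T A = one1 K A"

definition lax_T_morphism ::
  "('a, 'b, 'c) two_category \<Rightarrow> ('a, 'b, 'c) two_monad \<Rightarrow>
    'a \<Rightarrow> 'b \<Rightarrow> 'a \<Rightarrow> 'b \<Rightarrow> 'b \<Rightarrow> 'c \<Rightarrow> bool" where
  "lax_T_morphism K T A a B b f \<phi> \<longleftrightarrow>
     f \<in> hom1 K A B \<and> \<phi> \<in> hom2 K (b \<odot>\<^bsub>K\<^esub> T1 T f) (f \<odot>\<^bsub>K\<^esub> a) \<and>
     \<phi> \<star>\<^bsub>K\<^esub> one2 K (mult T A) = (\<phi> \<star>\<^bsub>K\<^esub> one2 K (T1 T a)) \<bullet>\<^bsub>K\<^esub> (one2 K b \<star>\<^bsub>K\<^esub> T2 T \<phi>) \<and>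
     \<phi> \<star>\<^bsub>K\<^esub> one2 K (unit T A) = one2 K f"

locale lax_idempotent_two_monad = two_monad +
  assumes lax_idempotent: "\<lbrakk>T_algebra K T A a; T_algebra K T B b; f \<in> hom1 K A B\<rbrakk> \<Longrightarrow>
    \<exists>!\<phi>. \<phi> \<in> hom2 K (b \<odot> T1 T f) (f \<odot> a) \<and> lax_T_morphism K T A a B b f \<phi>"


section \<open>Categories with binary products\<close>

text \<open>
  Hom-sets are indexed by pairs of objects and need not be disjoint: distinct objects
  \<open>(A, \<rho>)\<close>, \<open>(A, \<rho>')\<close> of the category of quotients share the same underlying arrows.
  For this reason composition (\<open>cmp C A B D g f\<close> for \<open>f : A \<rightarrow> B\<close>, \<open>g : B \<rightarrow> D\<close>), reindexing and
  the arrow part of functors take the objects as arguments.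
\<close>

record ('o, 'm) category =
  Ob :: "'o set"
  Hom :: "'o \<Rightarrow> 'o \<Rightarrow> 'm set"
  idn :: "'o \<Rightarrow> 'm"
  cmp :: "'o \<Rightarrow> 'o \<Rightarrow> 'o \<Rightarrow> 'm \<Rightarrow> 'm \<Rightarrow> 'm"

locale category =
  fixes C :: "('o, 'm, 'x) category_scheme"
  assumes idn_Hom: "A \<in> Ob C \<Longrightarrow> idn C A \<in> Hom C A A"
    and cmp_Hom: "\<lbrakk>A \<in> Ob C; B \<in> Ob C; D \<in> Ob C; f \<in> Hom C A B; g \<in> Hom C B D\<rbrakk> \<Longrightarrow>
      cmp C A B D g f \<in> Hom C A D"
    and cmp_idn_left: "\<lbrakk>A \<in> Ob C; B \<in> Ob C; f \<in> Hom C A B\<rbrakk> \<Longrightarrow> cmp C A B B (idn C B) f = f"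
    and cmp_idn_right: "\<lbrakk>A \<in> Ob C; B \<in> Ob C; f \<in> Hom C A B\<rbrakk> \<Longrightarrow> cmp C A A B f (idn C A) = f"
    and cmp_assoc: "\<lbrakk>A \<in> Ob C; B \<in> Ob C; D \<in> Ob C; E \<in> Ob C;
      f \<in> Hom C A B; g \<in> Hom C B D; h \<in> Hom C D E\<rbrakk> \<Longrightarrow>
      cmp C A B E (cmp C B D E h g) f = cmp C A D E h (cmp C A B D g f)"

definition inverse_arrow :: "('o, 'm, 'x) category_scheme \<Rightarrow> 'o \<Rightarrow> 'o \<Rightarrow> 'm \<Rightarrow> 'm" where
  "inverse_arrow C A B f = (THE g. g \<in> Hom C B A \<and>
     cmp C A B A g f = idn C A \<and> cmp C B A B f g = idn C B)"

definition is_product ::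
  "('o, 'm, 'x) category_scheme \<Rightarrow> 'o \<Rightarrow> 'o \<Rightarrow> 'o \<Rightarrow> 'm \<Rightarrow> 'm \<Rightarrow> bool" where
  "is_product C A B W p q \<longleftrightarrow> W \<in> Ob C \<and> p \<in> Hom C W A \<and> q \<in> Hom C W B \<and>
     (\<forall>Y \<in> Ob C. \<forall>f \<in> Hom C Y A. \<forall>g \<in> Hom C Y B.
        \<exists>!h. h \<in> Hom C Y W \<and> cmp C Y W A p h = f \<and> cmp C Y W B q h = g)"

record ('o, 'm) product_category = "('o, 'm) category" +
  prd :: "'o \<Rightarrow> 'o \<Rightarrow> 'o"
  pr1 :: "'o \<Rightarrow> 'o \<Rightarrow> 'm"
  pr2 :: "'o \<Rightarrow> 'o \<Rightarrow> 'm"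

locale product_category = category C
  for C :: "('o, 'm, 'x) product_category_scheme" +
  assumes prd: "\<lbrakk>A \<in> Ob C; B \<in> Ob C\<rbrakk> \<Longrightarrow> is_product C A B (prd C A B) (pr1 C A B) (pr2 C A B)"

definition pairing ::
  "('o, 'm, 'x) product_category_scheme \<Rightarrow> 'o \<Rightarrow> 'o \<Rightarrow> 'o \<Rightarrow> 'm \<Rightarrow> 'm \<Rightarrow> 'm" where
  "pairing C Y A B f g = (THE h. h \<in> Hom C Y (prd C A B) \<and>
     cmp C Y (prd C A B) A (pr1 C A B) h = f \<and> cmp C Y (prd C A B) B (pr2 C A B) h = g)"

definition diagonal :: "('o, 'm, 'x) product_category_scheme \<Rightarrow> 'o \<Rightarrow> 'm" where
  "diagonal C A = pairing C A A A (idn C A) (idn C A)"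

definition swap :: "('o, 'm, 'x) product_category_scheme \<Rightarrow> 'o \<Rightarrow> 'm" where
  "swap C A = pairing C (prd C A A) A A (pr2 C A A) (pr1 C A A)"

definition prod_arrow ::
  "('o, 'm, 'x) product_category_scheme \<Rightarrow> 'o \<Rightarrow> 'o \<Rightarrow> 'o \<Rightarrow> 'o \<Rightarrow> 'm \<Rightarrow> 'm \<Rightarrow> 'm" where
  "prod_arrow C A A' B B' f g = pairing C (prd C A A') B B'
     (cmp C (prd C A A') A B f (pr1 C A A')) (cmp C (prd C A A') A' B' g (pr2 C A A'))"

text \<open>The ternary product \<open>X \<times> A \<times> B\<close> is \<open>(X \<times> A) \<times> B\<close>; \<open>tri1\<close>, \<open>tri2\<close>, \<open>tri3\<close> are its projections.\<close>

definition prd3 :: "('o, 'm, 'x) product_category_scheme \<Rightarrow> 'o \<Rightarrow> 'o \<Rightarrow> 'o \<Rightarrow> 'o" where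
  "prd3 C X A B = prd C (prd C X A) B"

definition tri1 :: "('o, 'm, 'x) product_category_scheme \<Rightarrow> 'o \<Rightarrow> 'o \<Rightarrow> 'o \<Rightarrow> 'm" where
  "tri1 C X A B = cmp C (prd3 C X A B) (prd C X A) X (pr1 C X A) (pr1 C (prd C X A) B)"

definition tri2 :: "('o, 'm, 'x) product_category_scheme \<Rightarrow> 'o \<Rightarrow> 'o \<Rightarrow> 'o \<Rightarrow> 'm" where
  "tri2 C X A B = cmp C (prd3 C X A B) (prd C X A) A (pr2 C X A) (pr1 C (prd C X A) B)"

definition tri3 :: "('o, 'm, 'x) product_category_scheme \<Rightarrow> 'o \<Rightarrow> 'o \<Rightarrow> 'o \<Rightarrow> 'm" where
  "tri3 C X A B = pr2 C (prd C X A) B"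

definition tri12 :: "('o, 'm, 'x) product_category_scheme \<Rightarrow> 'o \<Rightarrow> 'o \<Rightarrow> 'o \<Rightarrow> 'm" where
  "tri12 C X A B = pairing C (prd3 C X A B) X A (tri1 C X A B) (tri2 C X A B)"

definition tri23 :: "('o, 'm, 'x) product_category_scheme \<Rightarrow> 'o \<Rightarrow> 'o \<Rightarrow> 'o \<Rightarrow> 'm" where
  "tri23 C X A B = pairing C (prd3 C X A B) A B (tri2 C X A B) (tri3 C X A B)"

definition tri13 :: "('o, 'm, 'x) product_category_scheme \<Rightarrow> 'o \<Rightarrow> 'o \<Rightarrow> 'o \<Rightarrow> 'm" where
  "tri13 C X A B = pairing C (prd3 C X A B) X B (tri1 C X A B) (tri3 C X A B)"

text \<open>The arrow \<open>\<langle>pr\<^sub>1, pr\<^sub>2, pr\<^sub>2\<rangle> : X \<times> A \<rightarrow> X \<times> A \<times> A\<close>.\<close>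

definition par_diagonal :: "('o, 'm, 'x) product_category_scheme \<Rightarrow> 'o \<Rightarrow> 'o \<Rightarrow> 'm" where
  "par_diagonal C X A = pairing C (prd C X A) (prd C X A) A
     (pairing C (prd C X A) X A (pr1 C X A) (pr2 C X A)) (pr2 C X A)"


section \<open>Elementary doctrines\<close>

text \<open>Finite meets include the empty one, that is, the top element.\<close>

locale inf_semilattice = partial_order L for L (structure) +
  assumes finite_inf: "\<lbrakk>finite S; S \<subseteq> carrier L\<rbrakk> \<Longrightarrow> \<exists>x. greatest L x (Lower L S)"

definition preserves_finite_meets ::
  "('p, 'x) gorder_scheme \<Rightarrow> ('r, 'y) gorder_scheme \<Rightarrow> ('p \<Rightarrow> 'r) \<Rightarrow> bool" where
  "preserves_finite_meets L M h \<longleftrightarrow> h \<in> carrier L \<rightarrow> carrier M \<and>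
     (\<forall>S. finite S \<and> S \<subseteq> carrier L \<longrightarrow> h (\<Sqinter>\<^bsub>L\<^esub>S) = \<Sqinter>\<^bsub>M\<^esub>(h ` S))"

text \<open>\<open>rei P A B f\<close> is the reindexing \<open>P\<^sub>f : P(B) \<rightarrow> P(A)\<close> along \<open>f : A \<rightarrow> B\<close>.\<close>

record ('o, 'm, 'p) doctrine = "('o, 'm) product_category" +
  fib :: "'o \<Rightarrow> 'p gorder"
  rei :: "'o \<Rightarrow> 'o \<Rightarrow> 'm \<Rightarrow> 'p \<Rightarrow> 'p"

locale doctrine = product_category P for P :: "('o, 'm, 'p) doctrine" +
  assumes fib: "A \<in> Ob P \<Longrightarrow> inf_semilattice (fib P A)"
    and rei_meets: "\<lbrakk>A \<in> Ob P; B \<in> Ob P; f \<in> Hom P A B\<rbrakk> \<Longrightarrow>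
      preserves_finite_meets (fib P B) (fib P A) (rei P A B f)"
    and rei_idn: "\<lbrakk>A \<in> Ob P; \<alpha> \<in> carrier (fib P A)\<rbrakk> \<Longrightarrow> rei P A A (idn P A) \<alpha> = \<alpha>"
    and rei_cmp: "\<lbrakk>A \<in> Ob P; B \<in> Ob P; D \<in> Ob P; f \<in> Hom P A B; g \<in> Hom P B D;
      \<alpha> \<in> carrier (fib P D)\<rbrakk> \<Longrightarrow>
      rei P A D (cmp P A B D g f) \<alpha> = rei P A B f (rei P B D g \<alpha>)"

definition is_delta :: "('o, 'm, 'p) doctrine \<Rightarrow> 'o \<Rightarrow> 'p \<Rightarrow> bool" where
  "is_delta P A d \<longleftrightarrow> d \<in> carrier (fib P (prd P A A)) \<and>
     galois_connection
       \<lparr>orderA = fib P A,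
        orderB = fib P (prd P A A),
        lower = (\<lambda>\<alpha>. rei P (prd P A A) A (pr1 P A A) \<alpha> \<sqinter>\<^bsub>fib P (prd P A A)\<^esub> d),
        upper = rei P A (prd P A A) (diagonal P A)\<rparr> \<and>
     (\<forall>X \<in> Ob P. galois_connection
       \<lparr>orderA = fib P (prd P X A),
        orderB = fib P (prd3 P X A A),
        lower = (\<lambda>\<alpha>. rei P (prd3 P X A A) (prd P X A) (tri12 P X A A) \<alpha>
           \<sqinter>\<^bsub>fib P (prd3 P X A A)\<^esub> rei P (prd3 P X A A) (prd P A A) (tri23 P X A A) d),
        upper = rei P (prd P X A) (prd3 P X A A) (par_diagonal P X A)\<rparr>)"

locale elementary_doctrine = doctrine +
  assumes delta_exists: "A \<in> Ob P \<Longrightarrow> \<exists>d. is_delta P A d"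

text \<open>
  The element \<open>\<delta>\<^sub>A\<close> is unique: by the first adjunction it is the image of the top element
  under the left adjoint of \<open>P\<^bsub>\<langle>id, id\<rangle>\<^esub>\<close>.
\<close>

definition delta :: "('o, 'm, 'p) doctrine \<Rightarrow> 'o \<Rightarrow> 'p" where
  "delta P A = (THE d. is_delta P A d)"


section \<open>The 2-category of elementary doctrines\<close>

text \<open>
  Cells carry their source and target. All functions they consist of are extensional, so that
  equality of cells is equality of the functors and natural transformations they represent.
\<close>

record ('o, 'm, 'p) doctrine_map =
  dom_d :: "('o, 'm, 'p) doctrine"
  cod_d :: "('o, 'm, 'p) doctrine"
  omap :: "'o \<Rightarrow> 'o"
  amap :: "'o \<Rightarrow> 'o \<Rightarrow> 'm \<Rightarrow> 'm"
  fmap :: "'o \<Rightarrow> 'p \<Rightarrow> 'p"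

record ('o, 'm, 'p) doctrine_trans =
  dom_m :: "('o, 'm, 'p) doctrine_map"
  cod_m :: "('o, 'm, 'p) doctrine_map"
  component :: "'o \<Rightarrow> 'm"

text \<open>The arrow \<open>\<langle>F pr\<^sub>1, F pr\<^sub>2\<rangle> : F(A \<times> B) \<rightarrow> FA \<times> FB\<close>.\<close>

definition comparison :: "('o, 'm, 'p) doctrine_map \<Rightarrow> 'o \<Rightarrow> 'o \<Rightarrow> 'm" where
  "comparison F A B = (let P = dom_d F; AB = prd P A B in
     pairing (cod_d F) (omap F AB) (omap F A) (omap F B)
       (amap F AB A (pr1 P A B)) (amap F AB B (pr2 P A B)))"

locale elementary_map =
  P: elementary_doctrine "dom_d F" + R: elementary_doctrine "cod_d F"
  for F :: "('o, 'm, 'p) doctrine_map" +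
  assumes omap: "omap F \<in> Ob (dom_d F) \<rightarrow>\<^sub>E Ob (cod_d F)"
    and amap: "amap F \<in> (\<Pi>\<^sub>E A \<in> Ob (dom_d F). \<Pi>\<^sub>E B \<in> Ob (dom_d F).
      Hom (dom_d F) A B \<rightarrow>\<^sub>E Hom (cod_d F) (omap F A) (omap F B))"
    and amap_idn: "A \<in> Ob (dom_d F) \<Longrightarrow>
      amap F A A (idn (dom_d F) A) = idn (cod_d F) (omap F A)"
    and amap_cmp: "\<lbrakk>A \<in> Ob (dom_d F); B \<in> Ob (dom_d F); D \<in> Ob (dom_d F);
      f \<in> Hom (dom_d F) A B; g \<in> Hom (dom_d F) B D\<rbrakk> \<Longrightarrow>
      amap F A D (cmp (dom_d F) A B D g f) =
        cmp (cod_d F) (omap F A) (omap F B) (omap F D) (amap F B D g) (amap F A B f)"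
    and preserves_products: "\<lbrakk>A \<in> Ob (dom_d F); B \<in> Ob (dom_d F); is_product (dom_d F) A B W p q\<rbrakk> \<Longrightarrow>
      is_product (cod_d F) (omap F A) (omap F B) (omap F W) (amap F W A p) (amap F W B q)"
    and fmap: "fmap F \<in> (\<Pi>\<^sub>E A \<in> Ob (dom_d F).
      carrier (fib (dom_d F) A) \<rightarrow>\<^sub>E carrier (fib (cod_d F) (omap F A)))"
    and fmap_natural: "\<lbrakk>A \<in> Ob (dom_d F); B \<in> Ob (dom_d F); f \<in> Hom (dom_d F) A B;
      \<alpha> \<in> carrier (fib (dom_d F) B)\<rbrakk> \<Longrightarrow>
      fmap F A (rei (dom_d F) A B f \<alpha>) =
        rei (cod_d F) (omap F A) (omap F B) (amap F A B f) (fmap F B \<alpha>)"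
    and fmap_meets: "A \<in> Ob (dom_d F) \<Longrightarrow>
      preserves_finite_meets (fib (dom_d F) A) (fib (cod_d F) (omap F A)) (fmap F A)"
    and fmap_delta: "A \<in> Ob (dom_d F) \<Longrightarrow>
      fmap F (prd (dom_d F) A A) (delta (dom_d F) A) =
        rei (cod_d F) (omap F (prd (dom_d F) A A)) (prd (cod_d F) (omap F A) (omap F A))
          (comparison F A A) (delta (cod_d F) (omap F A))"

locale elementary_trans =
  F: elementary_map "dom_m \<theta>" + G: elementary_map "cod_m \<theta>"
  for \<theta> :: "('o, 'm, 'p) doctrine_trans" +
  assumes same_dom: "dom_d (dom_m \<theta>) = dom_d (cod_m \<theta>)"
    and same_cod: "cod_d (dom_m \<theta>) = cod_d (cod_m \<theta>)"
    and component: "component \<theta> \<in> (\<Pi>\<^sub>E A \<in> Ob (dom_d (dom_m \<theta>)).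
      Hom (cod_d (dom_m \<theta>)) (omap (dom_m \<theta>) A) (omap (cod_m \<theta>) A))"
    and natural: "\<lbrakk>A \<in> Ob (dom_d (dom_m \<theta>)); B \<in> Ob (dom_d (dom_m \<theta>));
      f \<in> Hom (dom_d (dom_m \<theta>)) A B\<rbrakk> \<Longrightarrow>
      cmp (cod_d (dom_m \<theta>)) (omap (dom_m \<theta>) A) (omap (dom_m \<theta>) B) (omap (cod_m \<theta>) B)
          (component \<theta> B) (amap (dom_m \<theta>) A B f) =
        cmp (cod_d (dom_m \<theta>)) (omap (dom_m \<theta>) A) (omap (cod_m \<theta>) A) (omap (cod_m \<theta>) B)
          (amap (cod_m \<theta>) A B f) (component \<theta> A)"
    and fmap_le: "\<lbrakk>A \<in> Ob (dom_d (dom_m \<theta>)); \<alpha> \<in> carrier (fib (dom_d (dom_m \<theta>)) A)\<rbrakk> \<Longrightarrow>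
      fmap (dom_m \<theta>) A \<alpha> \<sqsubseteq>\<^bsub>fib (cod_d (dom_m \<theta>)) (omap (dom_m \<theta>) A)\<^esub>
        rei (cod_d (dom_m \<theta>)) (omap (dom_m \<theta>) A) (omap (cod_m \<theta>) A) (component \<theta> A)
          (fmap (cod_m \<theta>) A \<alpha>)"

definition id_map :: "('o, 'm, 'p) doctrine \<Rightarrow> ('o, 'm, 'p) doctrine_map" where
  "id_map P = \<lparr>dom_d = P, cod_d = P,
     omap = (\<lambda>A \<in> Ob P. A),
     amap = (\<lambda>A \<in> Ob P. \<lambda>B \<in> Ob P. \<lambda>f \<in> Hom P A B. f),
     fmap = (\<lambda>A \<in> Ob P. \<lambda>\<alpha> \<in> carrier (fib P A). \<alpha>)\<rparr>"

definition comp_map ::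
  "('o, 'm, 'p) doctrine_map \<Rightarrow> ('o, 'm, 'p) doctrine_map \<Rightarrow> ('o, 'm, 'p) doctrine_map" where
  "comp_map G F = (let P = dom_d F in \<lparr>dom_d = P, cod_d = cod_d G,
     omap = (\<lambda>A \<in> Ob P. omap G (omap F A)),
     amap = (\<lambda>A \<in> Ob P. \<lambda>B \<in> Ob P. \<lambda>f \<in> Hom P A B. amap G (omap F A) (omap F B) (amap F A B f)),
     fmap = (\<lambda>A \<in> Ob P. \<lambda>\<alpha> \<in> carrier (fib P A). fmap G (omap F A) (fmap F A \<alpha>))\<rparr>)"

definition id_trans :: "('o, 'm, 'p) doctrine_map \<Rightarrow> ('o, 'm, 'p) doctrine_trans" where
  "id_trans F = \<lparr>dom_m = F, cod_m = F,
     component = (\<lambda>A \<in> Ob (dom_d F). idn (cod_d F) (omap F A))\<rparr>"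

definition vcomp_trans ::
  "('o, 'm, 'p) doctrine_trans \<Rightarrow> ('o, 'm, 'p) doctrine_trans \<Rightarrow> ('o, 'm, 'p) doctrine_trans" where
  "vcomp_trans \<phi> \<theta> = (let F = dom_m \<theta>; G = cod_m \<theta>; H = cod_m \<phi> in
     \<lparr>dom_m = F, cod_m = H,
      component = (\<lambda>A \<in> Ob (dom_d F). cmp (cod_d F) (omap F A) (omap G A) (omap H A)
        (component \<phi> A) (component \<theta> A))\<rparr>)"

text \<open>For \<open>\<theta> : F \<Rightarrow> F'\<close> and \<open>\<phi> : G \<Rightarrow> G'\<close>, the component of \<open>\<phi> \<star> \<theta>\<close> at \<open>A\<close> is \<open>\<phi>\<^bsub>F'A\<^esub> \<circ> G(\<theta>\<^sub>A)\<close>.\<close>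

definition hcomp_trans ::
  "('o, 'm, 'p) doctrine_trans \<Rightarrow> ('o, 'm, 'p) doctrine_trans \<Rightarrow> ('o, 'm, 'p) doctrine_trans" where
  "hcomp_trans \<phi> \<theta> = (let F = dom_m \<theta>; F' = cod_m \<theta>; G = dom_m \<phi>; G' = cod_m \<phi> in
     \<lparr>dom_m = comp_map G F, cod_m = comp_map G' F',
      component = (\<lambda>A \<in> Ob (dom_d F).
        cmp (cod_d G) (omap G (omap F A)) (omap G (omap F' A)) (omap G' (omap F' A))
          (component \<phi> (omap F' A)) (amap G (omap F A) (omap F' A) (component \<theta> A)))\<rparr>)"

definition ED ::
  "(('o, 'm, 'p) doctrine, ('o, 'm, 'p) doctrine_map, ('o, 'm, 'p) doctrine_trans) two_category" where
  "ED = \<lparr>cell0 = {P. elementary_doctrine P},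
     cell1 = {F. elementary_map F},
     cell2 = {\<theta>. elementary_trans \<theta>},
     src1 = dom_d, tgt1 = cod_d, src2 = dom_m, tgt2 = cod_m,
     one1 = id_map, one2 = id_trans,
     comp1 = comp_map, vcomp = vcomp_trans, hcomp = hcomp_trans\<rparr>"


section \<open>The quotient completion\<close>

definition equiv_rel :: "('o, 'm, 'p) doctrine \<Rightarrow> 'o \<Rightarrow> 'p \<Rightarrow> bool" where
  "equiv_rel P A \<rho> \<longleftrightarrow> (let AA = prd P A A; AAA = prd3 P A A A in
     \<rho> \<in> carrier (fib P AA) \<and>
     delta P A \<sqsubseteq>\<^bsub>fib P AA\<^esub> \<rho> \<and>
     \<rho> \<sqsubseteq>\<^bsub>fib P AA\<^esub> rei P AA AA (swap P A) \<rho> \<and>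
     rei P AAA AA (tri12 P A A A) \<rho> \<sqinter>\<^bsub>fib P AAA\<^esub> rei P AAA AA (tri23 P A A A) \<rho>
       \<sqsubseteq>\<^bsub>fib P AAA\<^esub> rei P AAA AA (tri13 P A A A) \<rho>)"

definition descent :: "('o, 'm, 'p) doctrine \<Rightarrow> 'o \<Rightarrow> 'p \<Rightarrow> 'p set" where
  "descent P A \<rho> = (let AA = prd P A A in
     {\<alpha> \<in> carrier (fib P A).
        rei P AA A (pr1 P A A) \<alpha> \<sqinter>\<^bsub>fib P AA\<^esub> \<rho> \<sqsubseteq>\<^bsub>fib P AA\<^esub> rei P AA A (pr2 P A A) \<alpha>})"

text \<open>
  The 0-cells of \<open>ED\<close> have their objects in one fixed type \<open>'o\<close>, which plays the role of the
  universe. Since an object of the category of quotients is a pair \<open>(A, \<rho>)\<close>, this universe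
  has to be closed under pairing with elements of fibres: the pair \<open>(A, \<rho>)\<close> is represented
  by its image under an injection \<open>e : 'o \<times> 'p \<Rightarrow> 'o\<close>, with projections \<open>under\<close> and \<open>rel\<close>.
  Every type of objects embeds into one with such an injection, for instance
  \<open>'o\<close> into \<open>'o \<times> 'p list\<close>.
\<close>

definition under :: "('o \<times> 'p \<Rightarrow> 'o) \<Rightarrow> 'o \<Rightarrow> 'o" where
  "under e X = fst (inv e X)"

definition rel :: "('o \<times> 'p \<Rightarrow> 'o) \<Rightarrow> 'o \<Rightarrow> 'p" where
  "rel e X = snd (inv e X)"

text \<open>
  The product of \<open>(A, \<rho>)\<close> and \<open>(B, \<sigma>)\<close> is \<open>A \<times> B\<close> with the relation
  \<open>P\<^bsub>pr\<^sub>1 \<times> pr\<^sub>1\<^esub>(\<rho>) \<and> P\<^bsub>pr\<^sub>2 \<times> pr\<^sub>2\<^esub>(\<sigma>)\<close>.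
\<close>

definition prod_rel :: "('o, 'm, 'p) doctrine \<Rightarrow> 'o \<Rightarrow> 'p \<Rightarrow> 'o \<Rightarrow> 'p \<Rightarrow> 'p" where
  "prod_rel P A \<rho> B \<sigma> = (let AB = prd P A B; W = prd P AB AB in
     rei P W (prd P A A) (prod_arrow P AB AB A A (pr1 P A B) (pr1 P A B)) \<rho> \<sqinter>\<^bsub>fib P W\<^esub>
     rei P W (prd P B B) (prod_arrow P AB AB B B (pr2 P A B) (pr2 P A B)) \<sigma>)"

definition quotient_doctrine ::
  "('o \<times> 'p \<Rightarrow> 'o) \<Rightarrow> ('o, 'm, 'p) doctrine \<Rightarrow> ('o, 'm, 'p) doctrine" where
  "quotient_doctrine e P =
     \<lparr>Ob = {e (A, \<rho>) | A \<rho>. A \<in> Ob P \<and> equiv_rel P A \<rho>},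
      Hom = (\<lambda>X Y. let A = under e X; B = under e Y in
        {f \<in> Hom P A B. rel e X \<sqsubseteq>\<^bsub>fib P (prd P A A)\<^esub>
           rei P (prd P A A) (prd P B B) (prod_arrow P A A B B f f) (rel e Y)}),
      idn = (\<lambda>X. idn P (under e X)),
      cmp = (\<lambda>X Y Z. cmp P (under e X) (under e Y) (under e Z)),
      prd = (\<lambda>X Y. e (prd P (under e X) (under e Y),
        prod_rel P (under e X) (rel e X) (under e Y) (rel e Y))),
      pr1 = (\<lambda>X Y. pr1 P (under e X) (under e Y)),
      pr2 = (\<lambda>X Y. pr2 P (under e X) (under e Y)),
      fib = (\<lambda>X. (fib P (under e X))\<lparr>carrier := descent P (under e X) (rel e X)\<rparr>),
      rei = (\<lambda>X Y. rei P (under e X) (under e Y))\<rparr>"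

definition quotient_map ::
  "('o \<times> 'p \<Rightarrow> 'o) \<Rightarrow> ('o, 'm, 'p) doctrine_map \<Rightarrow> ('o, 'm, 'p) doctrine_map" where
  "quotient_map e F = (let Q = quotient_doctrine e (dom_d F); R = cod_d F in
     \<lparr>dom_d = Q, cod_d = quotient_doctrine e R,
      omap = (\<lambda>X \<in> Ob Q. let A = under e X; AA = prd (dom_d F) A A;
          FA = omap F A; FAA = omap F AA; W = prd R FA FA in
        e (FA, rei R W FAA (inverse_arrow R FAA W (comparison F A A)) (fmap F AA (rel e X)))),
      amap = (\<lambda>X \<in> Ob Q. \<lambda>Y \<in> Ob Q. \<lambda>f \<in> Hom Q X Y. amap F (under e X) (under e Y) f),
      fmap = (\<lambda>X \<in> Ob Q. \<lambda>\<alpha> \<in> carrier (fib Q X). fmap F (under e X) \<alpha>)\<rparr>)"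

definition quotient_trans ::
  "('o \<times> 'p \<Rightarrow> 'o) \<Rightarrow> ('o, 'm, 'p) doctrine_trans \<Rightarrow> ('o, 'm, 'p) doctrine_trans" where
  "quotient_trans e \<theta> =
     \<lparr>dom_m = quotient_map e (dom_m \<theta>), cod_m = quotient_map e (cod_m \<theta>),
      component = (\<lambda>X \<in> Ob (quotient_doctrine e (dom_d (dom_m \<theta>))). component \<theta> (under e X))\<rparr>"

definition quotient_unit ::
  "('o \<times> 'p \<Rightarrow> 'o) \<Rightarrow> ('o, 'm, 'p) doctrine \<Rightarrow> ('o, 'm, 'p) doctrine_map" where
  "quotient_unit e P = \<lparr>dom_d = P, cod_d = quotient_doctrine e P,
     omap = (\<lambda>A \<in> Ob P. e (A, delta P A)),
     amap = (\<lambda>A \<in> Ob P. \<lambda>B \<in> Ob P. \<lambda>f \<in> Hom P A B. f),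
     fmap = (\<lambda>A \<in> Ob P. \<lambda>\<alpha> \<in> carrier (fib P A). \<alpha>)\<rparr>"

definition quotient_mult ::
  "('o \<times> 'p \<Rightarrow> 'o) \<Rightarrow> ('o, 'm, 'p) doctrine \<Rightarrow> ('o, 'm, 'p) doctrine_map" where
  "quotient_mult e P = (let Q = quotient_doctrine e P; QQ = quotient_doctrine e Q in
     \<lparr>dom_d = QQ, cod_d = Q,
      omap = (\<lambda>X \<in> Ob QQ. e (under e (under e X), rel e X)),
      amap = (\<lambda>X \<in> Ob QQ. \<lambda>Y \<in> Ob QQ. \<lambda>f \<in> Hom QQ X Y. f),
      fmap = (\<lambda>X \<in> Ob QQ. \<lambda>\<alpha> \<in> carrier (fib QQ X). \<alpha>)\<rparr>)"

definition Tq ::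
  "('o \<times> 'p \<Rightarrow> 'o) \<Rightarrow>
    (('o, 'm, 'p) doctrine, ('o, 'm, 'p) doctrine_map, ('o, 'm, 'p) doctrine_trans) two_monad" where
  "Tq e = \<lparr>T0 = quotient_doctrine e, T1 = quotient_map e, T2 = quotient_trans e,
     unit = quotient_unit e, mult = quotient_mult e\<rparr>"

end

theory Submission
  imports Defs
begin

text \<open>
  The quotient completion \<open>P\<^sub>q\<close> adds to \<open>P\<close> a quotient of \<open>A\<close> for every equivalence relation \<open>\<rho>\<close>
  on \<open>A\<close>, and the identity of \<open>A\<close> is the quotient map \<open>(A, \<delta>) \<rightarrow> (A, \<rho>)\<close>. This family of arrows is
  what makes the 2-monad \<open>T\<close> lax-idempotent. There are two ways to embed \<open>T P\<close> into \<open>T (T P)\<close>: the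
  1-cell \<open>T \<eta>\<close> sends \<open>(A, \<rho>)\<close> to \<open>((A, \<delta>), \<rho>)\<close>, and \<open>\<eta> T\<close> sends it to \<open>((A, \<rho>), \<rho>)\<close>. The
  identities of the objects \<open>A\<close> form a 2-cell \<open>\<Lambda> : T \<eta> \<Rightarrow> \<eta> T\<close>, which becomes an identity when it
  is composed with \<open>\<mu>\<close> on one side or restricted along \<open>\<eta>\<close> on the other.

  Any 2-monad with such a \<open>\<Lambda>\<close> is lax-idempotent; this is the locale \<open>unit_comparison\<close>. For an
  algebra \<open>a : T A \<rightarrow> A\<close> the 2-cell \<open>\<kappa> = T a \<star> \<Lambda> : 1 \<Rightarrow> \<eta> \<odot> a\<close> exhibits \<open>a\<close> as left adjoint to \<open>\<eta>\<close>,
  with the identity \<open>a \<odot> \<eta> = 1\<close> as counit. Hence a 2-cell into a composite \<open>h \<odot> a\<close> is determined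
  by its restriction along \<open>\<eta>\<close>. The unit law fixes that restriction for the structure 2-cell of a
  lax morphism, which gives uniqueness; the 2-cell \<open>(b \<odot> T f) \<star> \<kappa>\<close> has the right source, target
  and restriction; and it satisfies the multiplication law because both sides of that law have the
  same restriction. For the quotient completion, the component of this 2-cell at \<open>(A, \<rho>)\<close> is \<open>b\<close>
  applied to \<open>f q\<close>, where \<open>q = a (id : (A, \<delta>) \<rightarrow> (A, \<rho>))\<close>.

  Most of the work is to see that elementary doctrines form a 2-category and that \<open>T\<close> is a 2-monad
  on it. Two devices keep this manageable. The first is to argue with generalised elements: a
  predicate \<open>\<rho>\<close> over \<open>A \<times> B\<close> is known through its values \<open>inst P Y A B \<rho> f g\<close> at arrows
  \<open>f : Y \<rightarrow> A\<close>, \<open>g : Y \<rightarrow> B\<close>, and such a value is known through the \<open>\<gamma>\<close> below it. In these terms the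
  adjunctions that define \<open>\<delta>\<close> say that equality is reflexive and allows substitution (\<open>is_deltaI\<close>,
  \<open>is_delta_subst\<close>), and equivalence relations and descent data obey their familiar first-order
  rules. The second concerns a 1-cell \<open>F\<close>: it preserves products, so every pair of generalised
  elements of \<open>F A\<close> factors through \<open>F (A \<times> A)\<close> (\<open>product_element\<close>). Consequently a rule that
  holds for \<open>\<rho>\<close> at the generic pair of elements of \<open>A\<close> holds for the transported relation
  \<open>image_rel F A \<rho>\<close> at every pair, and \<open>image_rel F A \<rho>\<close> is the only relation with the value \<open>F \<rho>\<close>
  at the generic pair (\<open>image_rel_eqI\<close>). On objects, the laws of the 2-monad are instances of this
  uniqueness.
\<close>

section \<open>Lax idempotence from a comparison of the two units\<close>

context two_category
begin

lemma hom1_cells: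
  assumes "f \<in> hom1 K A B" shows "f \<in> cell1 K" "A \<in> cell0 K" "B \<in> cell0 K"
  using assms cell1_ends unfolding hom1_def by auto

lemma one2_hom1: "f \<in> hom1 K A B \<Longrightarrow> one2 K f \<in> hom2 K f f"
  using hom1_cells one2_hom by blast

text \<open>
  The horizontal composite of \<open>\<psi> : g \<Rightarrow> h \<odot> a\<close> with \<open>\<kappa>\<close> can be computed in two orders. In one of
  them \<open>\<kappa>\<close> is absorbed, because \<open>a \<star> \<kappa>\<close> is an identity, and what remains is \<open>\<psi>\<close>; in the other \<open>\<psi>\<close>
  occurs only through its restriction along \<open>s\<close>. This is how a left adjoint \<open>a\<close> of \<open>s\<close> transposes
  2-cells.
\<close>

lemma cell_into_retraction_determined:
  assumes a: "a \<in> hom1 K X A" and s: "s \<in> hom1 K A X"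
    and k: "\<kappa> \<in> hom2 K (one1 K X) (s \<odot> a)"
    and as: "a \<odot> s = one1 K A" and ak: "one2 K a \<star> \<kappa> = one2 K a"
    and g: "g \<in> hom1 K X B" and h: "h \<in> hom1 K A B" and \<psi>: "\<psi> \<in> hom2 K g (h \<odot> a)"
  shows "\<psi> = ((\<psi> \<star> one2 K s) \<star> one2 K a) \<bullet> (one2 K g \<star> \<kappa>)"
proof -
  note X = hom1_cells(2)[OF a]
  have i: "one1 K X \<in> hom1 K X X" by (rule one1_hom[OF X])
  have sa: "s \<odot> a \<in> hom1 K X X" by (rule comp1_hom[OF a s])
  have ha: "h \<odot> a \<in> hom1 K X B" by (rule comp1_hom[OF a h])
  note ones = one2_hom1[OF a] one2_hom1[OF s] one2_hom1[OF g] one2_hom1[OF h] one2_hom1[OF i]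
    one2_hom1[OF sa] one2_hom1[OF ha]
  have "(\<psi> \<bullet> one2 K g) \<star> (one2 K (s \<odot> a) \<bullet> \<kappa>) = (\<psi> \<star> one2 K (s \<odot> a)) \<bullet> (one2 K g \<star> \<kappa>)"
    by (rule interchange[OF i sa sa g g ha k ones(6) ones(3) \<psi>])
  moreover have "\<psi> \<star> one2 K (s \<odot> a) = (\<psi> \<star> one2 K s) \<star> one2 K a"
    using hcomp_assoc[OF a a s s g ha ones(1,2) \<psi>] hcomp_one2[OF a s] by simp
  moreover have "(one2 K (h \<odot> a) \<bullet> \<psi>) \<star> (\<kappa> \<bullet> one2 K (one1 K X)) =
      (one2 K (h \<odot> a) \<star> \<kappa>) \<bullet> (\<psi> \<star> one2 K (one1 K X))"
    by (rule interchange[OF i i sa g ha ha ones(5) k \<psi> ones(7)])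
  moreover have "one2 K (h \<odot> a) \<star> \<kappa> = one2 K (h \<odot> a)"
    using hcomp_assoc[OF i sa a a h h k ones(1) ones(4)] hcomp_one2[OF a h] ak by simp
  moreover have "\<psi> \<star> one2 K (one1 K X) = \<psi>" by (rule hcomp_one_right[OF g ha \<psi>])
  ultimately show ?thesis
    using vcomp_one_left[OF \<psi>] vcomp_one_right[OF \<psi>] vcomp_one_left[OF k] vcomp_one_right[OF k]
    by simp
qed

lemma cell_into_retraction_eqI:
  assumes "a \<in> hom1 K X A" "s \<in> hom1 K A X"
    and "\<kappa> \<in> hom2 K (one1 K X) (s \<odot> a)"
    and "a \<odot> s = one1 K A" "one2 K a \<star> \<kappa> = one2 K a"
    and "g \<in> hom1 K X B" "h \<in> hom1 K A B" "\<psi> \<in> hom2 K g (h \<odot> a)" "\<psi>' \<in> hom2 K g (h \<odot> a)"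
    and "\<psi> \<star> one2 K s = \<psi>' \<star> one2 K s"
  shows "\<psi> = \<psi>'"
  using cell_into_retraction_determined[OF assms(1-7) assms(8)]
    cell_into_retraction_determined[OF assms(1-7) assms(9)] assms(10) by simp

end

text \<open>
  The comparison 2-cells \<open>T \<eta> \<Rightarrow> \<eta> T\<close> of a Kock-Zoeberlein 2-monad.
\<close>

locale unit_comparison = two_monad +
  fixes \<Lambda>
  assumes cmpr_hom: "A \<in> cell0 K \<Longrightarrow> \<Lambda> A \<in> hom2 K (T1 T (unit T A)) (unit T (T0 T A))"
    and mult_cmpr: "A \<in> cell0 K \<Longrightarrow> one2 K (mult T A) \<star> \<Lambda> A = one2 K (one1 K (T0 T A))"
    and cmpr_unit: "A \<in> cell0 K \<Longrightarrow>
      \<Lambda> A \<star> one2 K (unit T A) = one2 K (unit T (T0 T A) \<odot> unit T A)"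
begin

text \<open>
  The algebra laws turn \<open>\<Lambda>\<close> into the unit of an adjunction between \<open>a\<close> and \<open>\<eta>\<close> whose counit is the
  identity \<open>a \<odot> \<eta> = 1\<close>: the first equation is a triangle identity and follows from
  \<open>a \<odot> T a = a \<odot> \<mu>\<close>, the second is the other triangle identity.
\<close>

lemma algebra_unit:
  assumes alg: "T_algebra K T A a"
  defines "\<kappa> \<equiv> one2 K (T1 T a) \<star> \<Lambda> A"
  shows "\<kappa> \<in> hom2 K (one1 K (T0 T A)) (unit T A \<odot> a)"
    and "one2 K a \<star> \<kappa> = one2 K a"
    and "\<kappa> \<star> one2 K (unit T A) = one2 K (unit T A)"
proof -
  have A: "A \<in> cell0 K" and a: "a \<in> hom1 K (T0 T A) A" 
    and aTa: "a \<odot> T1 T a = a \<odot> mult T A" and au: "a \<odot> unit T A = one1 K A"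
    using alg unfolding T_algebra_def by auto
  note TA = T0_cell[OF A] and u = unit_hom[OF A] and m = mult_hom[OF A] and Ta = T1_hom[OF a]
  note Tu = T1_hom[OF u] and uT = unit_hom[OF TA] and L = cmpr_hom[OF A]
  have "\<kappa> \<in> hom2 K (T1 T a \<odot> T1 T (unit T A)) (T1 T a \<odot> unit T (T0 T A))"
    unfolding \<kappa>_def by (rule hcomp_hom[OF Tu uT Ta Ta L one2_hom1[OF Ta]])
  moreover have "T1 T a \<odot> T1 T (unit T A) = one1 K (T0 T A)"
    using T1_comp[OF u a] au T1_one[OF A] by simp
  ultimately show "\<kappa> \<in> hom2 K (one1 K (T0 T A)) (unit T A \<odot> a)"
    using unit_natural1[OF a] by simp
  have "one2 K a \<star> \<kappa> = one2 K (a \<odot> mult T A) \<star> \<Lambda> A"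
    unfolding \<kappa>_def
    using hcomp_assoc[OF Tu uT Ta Ta a a L one2_hom1[OF Ta] one2_hom1[OF a]]
      hcomp_one2[OF Ta a] aTa by simp
  also have "\<dots> = one2 K a \<star> one2 K (one1 K (T0 T A))"
    using hcomp_assoc[OF Tu uT m m a a L one2_hom1[OF m] one2_hom1[OF a]]
      hcomp_one2[OF m a] mult_cmpr[OF A] by simp
  also have "\<dots> = one2 K a" by (rule hcomp_one_right[OF a a one2_hom1[OF a]])
  finally show "one2 K a \<star> \<kappa> = one2 K a" .
  have "\<kappa> \<star> one2 K (unit T A) = one2 K (T1 T a) \<star> (\<Lambda> A \<star> one2 K (unit T A))"
    unfolding \<kappa>_def by (rule hcomp_assoc[OF u u Tu uT Ta Ta one2_hom1[OF u] L one2_hom1[OF Ta]])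
  also have "\<dots> = one2 K (T1 T a \<odot> (unit T (T0 T A) \<odot> unit T A))"
    using cmpr_unit[OF A] hcomp_one2[OF comp1_hom[OF u uT] Ta] by simp
  also have "T1 T a \<odot> (unit T (T0 T A) \<odot> unit T A) = unit T A \<odot> (a \<odot> unit T A)"
    using comp1_assoc[OF u uT Ta] comp1_assoc[OF u a u] unit_natural1[OF a] by simp
  finally show "\<kappa> \<star> one2 K (unit T A) = one2 K (unit T A)"
    using au comp1_one_right[OF u] by simp
qed

theorem lax_idempotent_two_monad: "lax_idempotent_two_monad K T"
proof unfold_locales
  fix A B a b f
  assume alg: "T_algebra K T A a" and blg: "T_algebra K T B b" and f: "f \<in> hom1 K A B"
  have A: "A \<in> cell0 K" and a: "a \<in> hom1 K (T0 T A) A" 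
    and aTa: "a \<odot> T1 T a = a \<odot> mult T A" and au: "a \<odot> unit T A = one1 K A"
    using alg unfolding T_algebra_def by auto
  have B: "B \<in> cell0 K" and b: "b \<in> hom1 K (T0 T B) B" 
    and bTb: "b \<odot> T1 T b = b \<odot> mult T B" and bu: "b \<odot> unit T B = one1 K B"
    using blg unfolding T_algebra_def by auto
  note TA = T0_cell[OF A] and u = unit_hom[OF A] and m = mult_hom[OF A] and Ta = T1_hom[OF a]
  note Tu = T1_hom[OF u] and uT = unit_hom[OF TA] and Tf = T1_hom[OF f] and uB = unit_hom[OF B]
  note fa = comp1_hom[OF a f] and bTf = comp1_hom[OF Tf b] and ua = comp1_hom[OF a u]
  define \<kappa> where "\<kappa> = one2 K (T1 T a) \<star> \<Lambda> A"
  note \<kappa> = algebra_unit[OF alg, folded \<kappa>_def]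
  note i = one1_hom[OF TA]
  \<comment> \<open>The transpose of the identity of \<open>f = (b \<odot> T f) \<odot> \<eta>\<close> under the adjunction.\<close>
  define \<phi> where "\<phi> = one2 K (b \<odot> T1 T f) \<star> \<kappa>"
  have bTfu: "(b \<odot> T1 T f) \<odot> unit T A = f"
    using comp1_assoc[OF u Tf b] unit_natural1[OF f] comp1_assoc[OF f uB b] bu comp1_one_left[OF f]
    by simp
  have "\<phi> \<in> hom2 K ((b \<odot> T1 T f) \<odot> one1 K (T0 T A)) ((b \<odot> T1 T f) \<odot> (unit T A \<odot> a))"
    unfolding \<phi>_def by (rule hcomp_hom[OF i ua bTf bTf \<kappa>(1) one2_hom1[OF bTf]])
  then have \<phi>: "\<phi> \<in> hom2 K (b \<odot> T1 T f) (f \<odot> a)"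
    using comp1_one_right[OF bTf] comp1_assoc[OF a u bTf] bTfu by simp
  have \<phi>u: "\<phi> \<star> one2 K (unit T A) = one2 K f"
    using hcomp_assoc[OF u u i ua bTf bTf one2_hom1[OF u] \<kappa>(1) one2_hom1[OF bTf]] \<kappa>(3)
      hcomp_one2[OF u bTf] bTfu unfolding \<phi>_def by simp
  \<comment> \<open>The two sides of the multiplication law, with the right-hand side split into its factors.\<close>
  define L where "L = \<phi> \<star> one2 K (mult T A)"
  define R1 where "R1 = \<phi> \<star> one2 K (T1 T a)"
  define R2 where "R2 = one2 K b \<star> T2 T \<phi>"
  define R where "R = R1 \<bullet> R2"
  note bTfm = comp1_hom[OF m bTf] and fam = comp1_hom[OF m fa]
  note TTf = T1_hom[OF Tf] and Tb = T1_hom[OF b] and bTfTa = comp1_hom[OF Ta bTf]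
    and faTa = comp1_hom[OF Ta fa]
  note TbTf = T1_hom[OF bTf] and Tfa = T1_hom[OF fa] and mB = mult_hom[OF B]
  note bTbTf = comp1_hom[OF TbTf b] and bTfa = comp1_hom[OF Tfa b]
  have L: "L \<in> hom2 K ((b \<odot> T1 T f) \<odot> mult T A) ((f \<odot> a) \<odot> mult T A)"
    unfolding L_def by (rule hcomp_hom[OF m m bTf fa one2_hom1[OF m] \<phi>])
  have R1: "R1 \<in> hom2 K ((b \<odot> T1 T f) \<odot> T1 T a) ((f \<odot> a) \<odot> T1 T a)"
    unfolding R1_def by (rule hcomp_hom[OF Ta Ta bTf fa one2_hom1[OF Ta] \<phi>])
  have R2: "R2 \<in> hom2 K (b \<odot> T1 T (b \<odot> T1 T f)) (b \<odot> T1 T (f \<odot> a))"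
    unfolding R2_def by (rule hcomp_hom[OF TbTf Tfa b b T2_hom[OF \<phi>] one2_hom1[OF b]])
  have e1: "b \<odot> T1 T (f \<odot> a) = (b \<odot> T1 T f) \<odot> T1 T a"
    using T1_comp[OF a f] comp1_assoc[OF Ta Tf b] by simp
  have e2: "b \<odot> T1 T (b \<odot> T1 T f) = (b \<odot> T1 T f) \<odot> mult T A"
    using T1_comp[OF Tf b] comp1_assoc[OF TTf Tb b] bTb comp1_assoc[OF TTf mB b]
      mult_natural1[OF f] comp1_assoc[OF m Tf b] by simp
  have e3: "(f \<odot> a) \<odot> T1 T a = (f \<odot> a) \<odot> mult T A"
    using comp1_assoc[OF Ta a f] comp1_assoc[OF m a f] aTa by simp
  have R: "R \<in> hom2 K ((b \<odot> T1 T f) \<odot> mult T A) ((f \<odot> a) \<odot> mult T A)"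
    unfolding R_def using vcomp_hom[OF R2 R1[folded e1]] e2 e3 by simp
  have Lu: "L \<star> one2 K (unit T (T0 T A)) = \<phi>"
    unfolding L_def
    using hcomp_assoc[OF uT uT m m bTf fa one2_hom1[OF uT] one2_hom1[OF m] \<phi>]
      hcomp_one2[OF uT m] mult_unit_left[OF A] hcomp_one_right[OF bTf fa \<phi>] by simp
  have R1u: "R1 \<star> one2 K (unit T (T0 T A)) = one2 K (f \<odot> a)"
    unfolding R1_def
    using hcomp_assoc[OF uT uT Ta Ta bTf fa one2_hom1[OF uT] one2_hom1[OF Ta] \<phi>]
      hcomp_assoc[OF a a u u bTf fa one2_hom1[OF a] one2_hom1[OF u] \<phi>]
      hcomp_one2[OF uT Ta] hcomp_one2[OF a u] unit_natural1[OF a] \<phi>u hcomp_one2[OF a f] by simp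
  have R2u: "R2 \<star> one2 K (unit T (T0 T A)) = \<phi>"
    unfolding R2_def
    using hcomp_assoc[OF uT uT TbTf Tfa b b one2_hom1[OF uT] T2_hom[OF \<phi>] one2_hom1[OF b]]
      unit_natural2[OF bTf fa \<phi>]
      hcomp_assoc[OF bTf fa uB uB b b \<phi> one2_hom1[OF uB] one2_hom1[OF b]]
      hcomp_one2[OF uB b] bu hcomp_one_left[OF bTf fa \<phi>] by simp
  have "(R1 \<bullet> R2) \<star> (one2 K (unit T (T0 T A)) \<bullet> one2 K (unit T (T0 T A))) =
      (R1 \<star> one2 K (unit T (T0 T A))) \<bullet> (R2 \<star> one2 K (unit T (T0 T A)))"
    by (rule interchange[OF uT uT uT bTbTf bTfTa faTa one2_hom1[OF uT] one2_hom1[OF uT]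
      R2[unfolded e1] R1])
  then have Ru: "R \<star> one2 K (unit T (T0 T A)) = \<phi>"
    using vcomp_one_left[OF one2_hom1[OF uT]] R1u R2u vcomp_one_left[OF \<phi>] unfolding R_def by simp
  \<comment> \<open>Both sides restrict to \<open>\<phi>\<close> along the unit of the free algebra \<open>T A\<close>, so they are equal.\<close>
  have free: "T_algebra K T (T0 T A) (mult T A)"
    unfolding T_algebra_def using TA m mult_assoc[OF A] mult_unit_left[OF A] by auto
  have "L = R"
    by (rule cell_into_retraction_eqI[OF m uT algebra_unit(1)[OF free] mult_unit_left[OF A]
          algebra_unit(2)[OF free] bTfm fa L R]) (simp add: Lu Ru)
  then have "lax_T_morphism K T A a B b f \<phi>"
    unfolding lax_T_morphism_def using f \<phi> \<phi>u unfolding L_def R_def R1_def R2_def by simp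
  moreover have "\<psi> = \<phi>" if "lax_T_morphism K T A a B b f \<psi>" for \<psi>
    by (rule cell_into_retraction_eqI[OF a u \<kappa>(1) au \<kappa>(2) bTf f _ \<phi>])
      (use that \<phi>u in \<open>auto simp: lax_T_morphism_def\<close>)
  ultimately show "\<exists>!\<phi>. \<phi> \<in> hom2 K (b \<odot> T1 T f) (f \<odot> a) \<and> lax_T_morphism K T A a B b f \<phi>"
    using \<phi> by blast
qed

end

section \<open>Product categories\<close>

context category
begin
declare idn_Hom [simp] cmp_Hom [simp] cmp_idn_left [simp] cmp_idn_right [simp] cmp_assoc [simp]
end

lemma is_productD:
  assumes "is_product C A B W p q"
  shows "W \<in> Ob C" "p \<in> Hom C W A" "q \<in> Hom C W B"
  using assms unfolding is_product_def by blast+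

lemma is_product_mediate:
  assumes "is_product C A B W p q" "Y \<in> Ob C" "f \<in> Hom C Y A" "g \<in> Hom C Y B"
  obtains h where "h \<in> Hom C Y W" "cmp C Y W A p h = f" "cmp C Y W B q h = g"
proof -
  have "\<exists>!h. h \<in> Hom C Y W \<and> cmp C Y W A p h = f \<and> cmp C Y W B q h = g"
    using assms(1-4) unfolding is_product_def by blast
  then show thesis using that by blast
qed

lemma is_product_unique:
  assumes "is_product C A B W p q" "Y \<in> Ob C" "h \<in> Hom C Y W" "h' \<in> Hom C Y W"
    and "cmp C Y W A p h \<in> Hom C Y A" "cmp C Y W B q h \<in> Hom C Y B"
    and "cmp C Y W A p h = cmp C Y W A p h'" "cmp C Y W B q h = cmp C Y W B q h'"
  shows "h = h'"
proof -
  have "\<exists>!k. k \<in> Hom C Y W \<and> cmp C Y W A p k = cmp C Y W A p h \<and> cmp C Y W B q k = cmp C Y W B q h"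
    using assms(1,2,5,6) unfolding is_product_def by blast
  then show ?thesis using assms(3,4,7,8) by (metis (no_types))
qed

lemma (in category) is_product_iso:
  assumes pr: "is_product C A B W p q" and ob: "A \<in> Ob C" "B \<in> Ob C" "V \<in> Ob C"
    and i: "i \<in> Hom C V W" and j: "j \<in> Hom C W V"
    and ij: "cmp C W V W i j = idn C W" and ji: "cmp C V W V j i = idn C V"
  shows "is_product C A B V (cmp C V W A p i) (cmp C V W B q i)"
  unfolding is_product_def
proof (intro conjI ballI)
  note W = is_productD[OF pr] ob i j
  note [simp] = W
  show "V \<in> Ob C" "cmp C V W A p i \<in> Hom C V A" "cmp C V W B q i \<in> Hom C V B" by simp_all
  fix Y f g
  assume Y: "Y \<in> Ob C" "f \<in> Hom C Y A" "g \<in> Hom C Y B"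
  note [simp] = Y
  obtain h where h [simp]: "h \<in> Hom C Y W" and ph: "cmp C Y W A p h = f" "cmp C Y W B q h = g"
    by (rule is_product_mediate[OF pr Y])
  have ijh: "cmp C Y V W i (cmp C Y W V j h) = h"
    using cmp_assoc[of Y W V W h j i] ij by simp
  show "\<exists>!h. h \<in> Hom C Y V \<and> cmp C Y V A (cmp C V W A p i) h = f \<and>
      cmp C Y V B (cmp C V W B q i) h = g"
  proof (rule ex1I[of _ "cmp C Y W V j h"])
    show "cmp C Y W V j h \<in> Hom C Y V \<and> cmp C Y V A (cmp C V W A p i) (cmp C Y W V j h) = f \<and>
      cmp C Y V B (cmp C V W B q i) (cmp C Y W V j h) = g"
      using ph by (simp add: ijh)
    fix k
    assume k: "k \<in> Hom C Y V \<and> cmp C Y V A (cmp C V W A p i) k = f \<and>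
      cmp C Y V B (cmp C V W B q i) k = g"
    then have [simp]: "k \<in> Hom C Y V" by simp
    have "cmp C Y V W i k = h"
      by (rule is_product_unique[OF pr Y(1)]) (use k ph in simp_all)
    then have "cmp C Y W V j h = cmp C Y V V (cmp C V W V j i) k" by simp
    then show "k = cmp C Y W V j h" using ji by simp
  qed
qed

lemma (in category) inverse_arrow_eq:
  assumes ob: "A \<in> Ob C" "B \<in> Ob C" and f: "f \<in> Hom C A B" and g: "g \<in> Hom C B A"
    and gf: "cmp C A B A g f = idn C A" and fg: "cmp C B A B f g = idn C B"
  shows "inverse_arrow C A B f = g"
  unfolding inverse_arrow_def
proof (rule the_equality)
  show "g \<in> Hom C B A \<and> cmp C A B A g f = idn C A \<and> cmp C B A B f g = idn C B"
    using assms by simp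
  fix k assume k: "k \<in> Hom C B A \<and> cmp C A B A k f = idn C A \<and> cmp C B A B f k = idn C B"
  have "cmp C B A A (cmp C A B A k f) g = cmp C B B A k (cmp C B A B f g)"
    using ob f g k by (intro cmp_assoc) simp_all
  then show "k = g" using k ob f g fg by simp
qed

context product_category
begin

lemma prd_Ob [simp]: "\<lbrakk>A \<in> Ob C; B \<in> Ob C\<rbrakk> \<Longrightarrow> prd C A B \<in> Ob C"
  and pr1_Hom [simp]: "\<lbrakk>A \<in> Ob C; B \<in> Ob C\<rbrakk> \<Longrightarrow> pr1 C A B \<in> Hom C (prd C A B) A"
  and pr2_Hom [simp]: "\<lbrakk>A \<in> Ob C; B \<in> Ob C\<rbrakk> \<Longrightarrow> pr2 C A B \<in> Hom C (prd C A B) B"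
  using is_productD[OF prd] by simp_all

lemma pairing_ex1:
  assumes "Y \<in> Ob C" "A \<in> Ob C" "B \<in> Ob C" "f \<in> Hom C Y A" "g \<in> Hom C Y B"
  shows "\<exists>!h. h \<in> Hom C Y (prd C A B) \<and>
    cmp C Y (prd C A B) A (pr1 C A B) h = f \<and> cmp C Y (prd C A B) B (pr2 C A B) h = g"
  using prd[OF assms(2,3)] assms(1,4,5) unfolding is_product_def by blast

lemma
  assumes "Y \<in> Ob C" "A \<in> Ob C" "B \<in> Ob C" "f \<in> Hom C Y A" "g \<in> Hom C Y B"
  shows pairing_Hom [simp]: "pairing C Y A B f g \<in> Hom C Y (prd C A B)"
    and pr1_pairing [simp]: "cmp C Y (prd C A B) A (pr1 C A B) (pairing C Y A B f g) = f"
    and pr2_pairing [simp]: "cmp C Y (prd C A B) B (pr2 C A B) (pairing C Y A B f g) = g"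
  using theI'[OF pairing_ex1[OF assms]] unfolding pairing_def by blast+

lemma pairing_unique:
  assumes "Y \<in> Ob C" "A \<in> Ob C" "B \<in> Ob C" "h \<in> Hom C Y (prd C A B)"
    and "cmp C Y (prd C A B) A (pr1 C A B) h = f" "cmp C Y (prd C A B) B (pr2 C A B) h = g"
  shows "pairing C Y A B f g = h"
proof -
  have "f \<in> Hom C Y A" "g \<in> Hom C Y B" using assms by auto
  then show ?thesis
    using pairing_ex1[of Y A B f g] pairing_Hom[of Y A B f g] pr1_pairing[of Y A B f g]
      pr2_pairing[of Y A B f g] assms by blast
qed

lemma pairing_cmp [simp]:
  assumes "Z \<in> Ob C" "Y \<in> Ob C" "A \<in> Ob C" "B \<in> Ob C" "f \<in> Hom C Y A" "g \<in> Hom C Y B"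
    "h \<in> Hom C Z Y"
  shows "cmp C Z Y (prd C A B) (pairing C Y A B f g) h =
    pairing C Z A B (cmp C Z Y A f h) (cmp C Z Y B g h)"
proof -
  have "cmp C Z (prd C A B) A (pr1 C A B) (cmp C Z Y (prd C A B) (pairing C Y A B f g) h) =
      cmp C Z Y A f h"
    using assms cmp_assoc[of Z Y "prd C A B" A h "pairing C Y A B f g" "pr1 C A B"]
    by (simp del: cmp_assoc)
  moreover have "cmp C Z (prd C A B) B (pr2 C A B) (cmp C Z Y (prd C A B) (pairing C Y A B f g) h) =
      cmp C Z Y B g h"
    using assms cmp_assoc[of Z Y "prd C A B" B h "pairing C Y A B f g" "pr2 C A B"]
    by (simp del: cmp_assoc)
  ultimately show ?thesis using assms by (intro pairing_unique[symmetric]) simp_all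
qed

lemma pairing_pr [simp]:
  "\<lbrakk>A \<in> Ob C; B \<in> Ob C\<rbrakk> \<Longrightarrow> pairing C (prd C A B) A B (pr1 C A B) (pr2 C A B) = idn C (prd C A B)"
  by (rule pairing_unique) simp_all

lemma pairing_eta [simp]:
  "\<lbrakk>Y \<in> Ob C; A \<in> Ob C; B \<in> Ob C; h \<in> Hom C Y (prd C A B)\<rbrakk> \<Longrightarrow>
    pairing C Y A B (cmp C Y (prd C A B) A (pr1 C A B) h) (cmp C Y (prd C A B) B (pr2 C A B) h) = h"
  by (rule pairing_unique) simp_all

lemma product_comparison_iso:
  assumes pr: "is_product C A B W p q" and ob: "A \<in> Ob C" "B \<in> Ob C"
  obtains j where "j \<in> Hom C (prd C A B) W"
    "cmp C W (prd C A B) W j (pairing C W A B p q) = idn C W"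
    "cmp C (prd C A B) W (prd C A B) (pairing C W A B p q) j = idn C (prd C A B)"
proof -
  note [simp] = ob is_productD[OF pr]
  obtain j where j [simp]: "j \<in> Hom C (prd C A B) W"
    and pj: "cmp C (prd C A B) W A p j = pr1 C A B" "cmp C (prd C A B) W B q j = pr2 C A B"
    by (rule is_product_mediate[OF pr, of "prd C A B" "pr1 C A B" "pr2 C A B"]) auto
  have "cmp C W (prd C A B) W j (pairing C W A B p q) = idn C W"
  proof (rule is_product_unique[OF pr])
    show "cmp C W W A p (cmp C W (prd C A B) W j (pairing C W A B p q)) = cmp C W W A p (idn C W)"
      using pj(1) by (simp flip: cmp_assoc)
    show "cmp C W W B q (cmp C W (prd C A B) W j (pairing C W A B p q)) = cmp C W W B q (idn C W)"
      using pj(2) by (simp flip: cmp_assoc)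
  qed simp_all
  moreover have "cmp C (prd C A B) W (prd C A B) (pairing C W A B p q) j = idn C (prd C A B)"
    by (simp add: pj)
  ultimately show thesis using that j by blast
qed

end

section \<open>Finite meets\<close>

context inf_semilattice
begin

lemma
  assumes "finite S" "S \<subseteq> carrier L"
  shows Inf_closed: "\<Sqinter>S \<in> carrier L"
    and le_Inf_iff: "x \<in> carrier L \<Longrightarrow> x \<sqsubseteq> \<Sqinter>S \<longleftrightarrow> (\<forall>s\<in>S. x \<sqsubseteq> s)"
proof -
  have g: "greatest L (\<Sqinter>S) (Lower L S)"
    unfolding inf_def by (rule someI_ex) (rule finite_inf[OF assms])
  then show c: "\<Sqinter>S \<in> carrier L" by simp
  have lb: "\<Sqinter>S \<sqsubseteq> s" if "s \<in> S" for s
    using g that assms(2) unfolding greatest_def Lower_def by blast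
  show "x \<sqsubseteq> \<Sqinter>S \<longleftrightarrow> (\<forall>s\<in>S. x \<sqsubseteq> s)" if x: "x \<in> carrier L"
  proof
    assume "x \<sqsubseteq> \<Sqinter>S"
    then show "\<forall>s\<in>S. x \<sqsubseteq> s" using le_trans[OF _ lb x c] assms(2) by auto
  next
    assume "\<forall>s\<in>S. x \<sqsubseteq> s"
    then have "x \<in> Lower L S" using x unfolding Lower_def by auto
    then show "x \<sqsubseteq> \<Sqinter>S" using g unfolding greatest_def by blast
  qed
qed

lemma Inf_eqI:
  assumes "finite S" "S \<subseteq> carrier L" "m \<in> carrier L"
    and "\<And>x. x \<in> carrier L \<Longrightarrow> x \<sqsubseteq> m \<longleftrightarrow> (\<forall>s\<in>S. x \<sqsubseteq> s)"
  shows "\<Sqinter>S = m"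
proof (rule le_antisym)
  note i = Inf_closed[OF assms(1,2)] le_Inf_iff[OF assms(1,2)]
  show "\<Sqinter>S \<sqsubseteq> m" using i(2)[OF i(1)] assms(4)[OF i(1)] i(1) by simp
  show "m \<sqsubseteq> \<Sqinter>S" using i(2)[OF assms(3)] assms(4)[OF assms(3)] assms(3) by simp
qed (use assms Inf_closed in auto)

lemma
  assumes "x \<in> carrier L" "y \<in> carrier L"
  shows meet_closed: "x \<sqinter> y \<in> carrier L"
    and le_meet_iff: "z \<in> carrier L \<Longrightarrow> z \<sqsubseteq> x \<sqinter> y \<longleftrightarrow> z \<sqsubseteq> x \<and> z \<sqsubseteq> y"
  using Inf_closed[of "{x, y}"] le_Inf_iff[of "{x, y}" z] assms unfolding meet_def by simp_all

lemma subset_finite_meets: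
  assumes D: "D \<subseteq> carrier L" and cl: "\<And>S. \<lbrakk>finite S; S \<subseteq> D\<rbrakk> \<Longrightarrow> \<Sqinter>S \<in> D"
  shows "inf_semilattice (L\<lparr>carrier := D\<rparr>)"
    and "\<lbrakk>finite S; S \<subseteq> D\<rbrakk> \<Longrightarrow> \<Sqinter>\<^bsub>L\<lparr>carrier := D\<rparr>\<^esub>S = \<Sqinter>S"
proof -
  have g: "greatest (L\<lparr>carrier := D\<rparr>) (\<Sqinter>S) (Lower (L\<lparr>carrier := D\<rparr>) S)" 
    if S: "finite S" "S \<subseteq> D" for S
  proof -
    have "S \<subseteq> carrier L" using S D by auto
    note i = Inf_closed[OF S(1) this] le_Inf_iff[OF S(1) this]
    have "\<forall>s\<in>S. \<Sqinter>S \<sqsubseteq> s" using i(2)[OF i(1)] i(1) by simp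
    then show ?thesis using i(2) cl[OF S] D S(2) unfolding greatest_def Lower_def
      by (simp add: subset_iff)
  qed
  have "partial_order (L\<lparr>carrier := D\<rparr>)"
  proof (rule partial_order.intro)
    show "weak_partial_order (L\<lparr>carrier := D\<rparr>)"
      by (rule weak_partial_order_subset[OF weak_partial_order_axioms D])
    show "partial_order_axioms (L\<lparr>carrier := D\<rparr>)"
      by standard (simp add: eq_is_equal)
  qed
  then show L': "inf_semilattice (L\<lparr>carrier := D\<rparr>)"
  proof (rule inf_semilattice.intro)
    show "inf_semilattice_axioms (L\<lparr>carrier := D\<rparr>)"
      by standard (use g in \<open>simp; blast\<close>)
  qed
  interpret L': inf_semilattice "L\<lparr>carrier := D\<rparr>" by (rule L')
  show "\<Sqinter>\<^bsub>L\<lparr>carrier := D\<rparr>\<^esub>S = \<Sqinter>S" if S: "finite S" "S \<subseteq> D"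
  proof (rule L'.Inf_eqI)
    have "S \<subseteq> carrier L" using S D by auto
    note le_Inf_iff[OF S(1) this]
    then show "x \<sqsubseteq>\<^bsub>L\<lparr>carrier := D\<rparr>\<^esub> \<Sqinter>S \<longleftrightarrow> (\<forall>s\<in>S. x \<sqsubseteq>\<^bsub>L\<lparr>carrier := D\<rparr>\<^esub> s)"
      if "x \<in> carrier (L\<lparr>carrier := D\<rparr>)" for x using that D by auto
  qed (use S cl in auto)
qed

end

lemma preserves_finite_meetsI:
  assumes "\<And>x. x \<in> carrier L \<Longrightarrow> h x \<in> carrier M"
    and "\<And>S. \<lbrakk>finite S; S \<subseteq> carrier L\<rbrakk> \<Longrightarrow> h (\<Sqinter>\<^bsub>L\<^esub>S) = \<Sqinter>\<^bsub>M\<^esub>(h ` S)"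
  shows "preserves_finite_meets L M h"
  using assms unfolding preserves_finite_meets_def by blast

lemma preserves_finite_meetsD:
  assumes "preserves_finite_meets L M h"
  shows "x \<in> carrier L \<Longrightarrow> h x \<in> carrier M"
    and "\<lbrakk>finite S; S \<subseteq> carrier L\<rbrakk> \<Longrightarrow> h (\<Sqinter>\<^bsub>L\<^esub>S) = \<Sqinter>\<^bsub>M\<^esub>(h ` S)"
  using assms unfolding preserves_finite_meets_def by blast+

lemma preserves_finite_meets_restrict:
  assumes h: "preserves_finite_meets L M h" and L: "inf_semilattice L" and M: "inf_semilattice M"
    and D: "D \<subseteq> carrier L" "\<And>S. \<lbrakk>finite S; S \<subseteq> D\<rbrakk> \<Longrightarrow> \<Sqinter>\<^bsub>L\<^esub>S \<in> D"
    and E: "E \<subseteq> carrier M" "\<And>S. \<lbrakk>finite S; S \<subseteq> E\<rbrakk> \<Longrightarrow> \<Sqinter>\<^bsub>M\<^esub>S \<in> E"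
    and hDE: "\<And>x. x \<in> D \<Longrightarrow> h x \<in> E"
  shows "preserves_finite_meets (L\<lparr>carrier := D\<rparr>) (M\<lparr>carrier := E\<rparr>) h"
proof (rule preserves_finite_meetsI)
  show "h x \<in> carrier (M\<lparr>carrier := E\<rparr>)" if "x \<in> carrier (L\<lparr>carrier := D\<rparr>)" for x
    using hDE that by simp
  fix S assume "finite S" "S \<subseteq> carrier (L\<lparr>carrier := D\<rparr>)"
  then have S: "finite S" "S \<subseteq> D" by simp_all
  then have hS: "finite (h ` S)" "h ` S \<subseteq> E" using hDE by blast+
  have "h (\<Sqinter>\<^bsub>L\<^esub>S) = \<Sqinter>\<^bsub>M\<^esub>(h ` S)"
    by (rule preserves_finite_meetsD(2)[OF h S(1)]) (use S D(1) in blast)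
  then show "h (\<Sqinter>\<^bsub>L\<lparr>carrier := D\<rparr>\<^esub>S) = \<Sqinter>\<^bsub>M\<lparr>carrier := E\<rparr>\<^esub>(h ` S)"
    using inf_semilattice.subset_finite_meets(2)[OF L D S]
      inf_semilattice.subset_finite_meets(2)[OF M E hS] by simp
qed

lemma preserves_finite_meets_cong:
  assumes h: "preserves_finite_meets L M h" and eq: "\<And>x. x \<in> carrier L \<Longrightarrow> h' x = h x"
    and L: "inf_semilattice L"
  shows "preserves_finite_meets L M h'"
proof (rule preserves_finite_meetsI)
  show "h' x \<in> carrier M" if "x \<in> carrier L" for x
    using preserves_finite_meetsD(1)[OF h that] eq[OF that] by simp
  fix S assume S: "finite S" "S \<subseteq> carrier L"
  then have "h' ` S = h ` S" using eq by (intro image_cong) auto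
  then show "h' (\<Sqinter>\<^bsub>L\<^esub>S) = \<Sqinter>\<^bsub>M\<^esub>(h' ` S)"
    using preserves_finite_meetsD(2)[OF h S] eq[OF inf_semilattice.Inf_closed[OF L S]] by simp
qed

lemma preserves_finite_meets_id: "preserves_finite_meets L L (\<lambda>x. x)"
  by (rule preserves_finite_meetsI) simp_all

lemma preserves_finite_meets_comp:
  assumes h: "preserves_finite_meets L M h" and k: "preserves_finite_meets M N k"
  shows "preserves_finite_meets L N (\<lambda>x. k (h x))"
proof (rule preserves_finite_meetsI)
  show "k (h x) \<in> carrier N" if "x \<in> carrier L" for x
    using preserves_finite_meetsD(1)[OF k preserves_finite_meetsD(1)[OF h that]] .
  fix S assume S: "finite S" "S \<subseteq> carrier L"
  then have hS: "finite (h ` S)" "h ` S \<subseteq> carrier M"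
    using preserves_finite_meetsD(1)[OF h] by blast+
  show "k (h (\<Sqinter>\<^bsub>L\<^esub>S)) = \<Sqinter>\<^bsub>N\<^esub>((\<lambda>x. k (h x)) ` S)"
    using preserves_finite_meetsD(2)[OF h S] preserves_finite_meetsD(2)[OF k hS]
    by (simp add: image_image)
qed

lemma preserves_finite_meets_mono:
  assumes h: "preserves_finite_meets L M h" and L: "inf_semilattice L" and M: "inf_semilattice M"
    and xy: "x \<in> carrier L" "y \<in> carrier L" "x \<sqsubseteq>\<^bsub>L\<^esub> y"
  shows "h x \<sqsubseteq>\<^bsub>M\<^esub> h y"
proof -
  interpret L: inf_semilattice L by (rule L)
  interpret M: inf_semilattice M by (rule M)
  have "\<Sqinter>\<^bsub>L\<^esub>{x, y} = x"
    using xy L.le_trans by (intro L.Inf_eqI) auto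
  then have "\<Sqinter>\<^bsub>M\<^esub>{h x, h y} = h x"
    using preserves_finite_meetsD(2)[OF h, of "{x, y}"] xy by simp
  then show ?thesis
    using M.le_meet_iff[of "h x" "h y" "h x"] preserves_finite_meetsD(1)[OF h] xy
    unfolding meet_def by simp
qed

lemma preserves_finite_meets_meet:
  assumes "preserves_finite_meets L M h" "x \<in> carrier L" "y \<in> carrier L"
  shows "h (x \<sqinter>\<^bsub>L\<^esub> y) = h x \<sqinter>\<^bsub>M\<^esub> h y"
  using preserves_finite_meetsD(2)[OF assms(1), of "{x, y}"] assms unfolding meet_def by simp

text \<open>
  Finite meets include the empty one, so a greatest element is mapped to a greatest element.
\<close>

lemma preserves_finite_meets_top:
  assumes h: "preserves_finite_meets L M h" and L: "inf_semilattice L" and M: "inf_semilattice M"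
    and x: "x \<in> carrier L" "\<And>z. z \<in> carrier L \<Longrightarrow> z \<sqsubseteq>\<^bsub>L\<^esub> x" and z: "z \<in> carrier M"
  shows "z \<sqsubseteq>\<^bsub>M\<^esub> h x"
proof -
  have "\<Sqinter>\<^bsub>L\<^esub>{} = x" using x by (intro inf_semilattice.Inf_eqI[OF L]) auto
  then have "h x = \<Sqinter>\<^bsub>M\<^esub>{}" using preserves_finite_meetsD(2)[OF h, of "{}"] by simp
  then show ?thesis using inf_semilattice.le_Inf_iff[OF M, of "{}" z] z by simp
qed

section \<open>Doctrines and generalised elements\<close>

abbreviation fibre_le :: "'p \<Rightarrow> ('o, 'm, 'p) doctrine \<Rightarrow> 'o \<Rightarrow> 'p \<Rightarrow> bool"
  (\<open>(_ \<le>[_,_]/ _)\<close> [51, 0, 0, 51] 50) where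
  "x \<le>[P,A] y \<equiv> x \<sqsubseteq>\<^bsub>fib P A\<^esub> y"

text \<open>
  The predicate \<open>\<rho>\<close> on \<open>A \<times> B\<close> evaluated at the generalised elements \<open>f\<close> and \<open>g\<close> of stage \<open>Y\<close>.
\<close>

definition inst :: "('o, 'm, 'p) doctrine \<Rightarrow> 'o \<Rightarrow> 'o \<Rightarrow> 'o \<Rightarrow> 'p \<Rightarrow> 'm \<Rightarrow> 'm \<Rightarrow> 'p" where
  "inst P Y A B \<rho> f g = rei P Y (prd P A B) (pairing P Y A B f g) \<rho>"

lemmas tri_defs = prd3_def tri1_def tri2_def tri3_def tri12_def tri23_def tri13_def

context doctrine
begin

lemma fib_refl [simp]: "\<lbrakk>A \<in> Ob P; x \<in> carrier (fib P A)\<rbrakk> \<Longrightarrow> x \<le>[P,A] x"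
proof -
  assume A: "A \<in> Ob P" "x \<in> carrier (fib P A)"
  interpret inf_semilattice "fib P A" by (rule fib[OF A(1)])
  show ?thesis using A by simp
qed

lemma fib_trans:
  "\<lbrakk>x \<le>[P,A] y; y \<le>[P,A] z; A \<in> Ob P;
    x \<in> carrier (fib P A); y \<in> carrier (fib P A); z \<in> carrier (fib P A)\<rbrakk> \<Longrightarrow> x \<le>[P,A] z"
proof -
  assume A: "x \<le>[P,A] y" "y \<le>[P,A] z" "A \<in> Ob P"
    "x \<in> carrier (fib P A)" "y \<in> carrier (fib P A)" "z \<in> carrier (fib P A)"
  interpret inf_semilattice "fib P A" by (rule fib[OF A(3)])
  show ?thesis by (rule le_trans[OF A(1,2,4-6)])
qed

lemma fib_antisym:
  "\<lbrakk>x \<le>[P,A] y; y \<le>[P,A] x; A \<in> Ob P;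
    x \<in> carrier (fib P A); y \<in> carrier (fib P A)\<rbrakk> \<Longrightarrow> x = y"
proof -
  assume A: "x \<le>[P,A] y" "y \<le>[P,A] x" "A \<in> Ob P"
    "x \<in> carrier (fib P A)" "y \<in> carrier (fib P A)"
  interpret inf_semilattice "fib P A" by (rule fib[OF A(3)])
  show ?thesis by (rule le_antisym[OF A(1,2,4,5)])
qed

lemmas Inf_fib_closed = inf_semilattice.Inf_closed[OF fib]
lemmas le_Inf_fib_iff = inf_semilattice.le_Inf_iff[OF fib]

lemma meet_fib_closed [simp]:
  "\<lbrakk>A \<in> Ob P; x \<in> carrier (fib P A); y \<in> carrier (fib P A)\<rbrakk> \<Longrightarrow> x \<sqinter>\<^bsub>fib P A\<^esub> y \<in> carrier (fib P A)"
  by (rule inf_semilattice.meet_closed[OF fib])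

lemma le_meet_fib_iff [simp]:
  "\<lbrakk>A \<in> Ob P; x \<in> carrier (fib P A); y \<in> carrier (fib P A); z \<in> carrier (fib P A)\<rbrakk> \<Longrightarrow>
    z \<le>[P,A] x \<sqinter>\<^bsub>fib P A\<^esub> y \<longleftrightarrow> z \<le>[P,A] x \<and> z \<le>[P,A] y"
  by (rule inf_semilattice.le_meet_iff[OF fib])

lemma meet_fib_le1: "\<lbrakk>A \<in> Ob P; x \<in> carrier (fib P A); y \<in> carrier (fib P A)\<rbrakk> \<Longrightarrow>
    x \<sqinter>\<^bsub>fib P A\<^esub> y \<le>[P,A] x"
  and meet_fib_le2: "\<lbrakk>A \<in> Ob P; x \<in> carrier (fib P A); y \<in> carrier (fib P A)\<rbrakk> \<Longrightarrow>
    x \<sqinter>\<^bsub>fib P A\<^esub> y \<le>[P,A] y"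
  using le_meet_fib_iff[of A x y "x \<sqinter>\<^bsub>fib P A\<^esub> y"] fib_refl[of A "x \<sqinter>\<^bsub>fib P A\<^esub> y"]
    meet_fib_closed[of A x y]
  by simp_all

lemma rei_closed [simp]:
  "\<lbrakk>A \<in> Ob P; B \<in> Ob P; f \<in> Hom P A B; \<alpha> \<in> carrier (fib P B)\<rbrakk> \<Longrightarrow> rei P A B f \<alpha> \<in> carrier (fib P A)"
  using preserves_finite_meetsD(1)[OF rei_meets] .

declare rei_idn [simp]

lemma rei_rei [simp]:
  "\<lbrakk>A \<in> Ob P; B \<in> Ob P; D \<in> Ob P; f \<in> Hom P A B; g \<in> Hom P B D; \<alpha> \<in> carrier (fib P D)\<rbrakk> \<Longrightarrow>
    rei P A B f (rei P B D g \<alpha>) = rei P A D (cmp P A B D g f) \<alpha>"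
  by (rule rei_cmp[symmetric])

lemma rei_Inf:
  "\<lbrakk>A \<in> Ob P; B \<in> Ob P; f \<in> Hom P A B; finite S; S \<subseteq> carrier (fib P B)\<rbrakk> \<Longrightarrow>
    rei P A B f (\<Sqinter>\<^bsub>fib P B\<^esub>S) = \<Sqinter>\<^bsub>fib P A\<^esub>(rei P A B f ` S)"
  using preserves_finite_meetsD(2)[OF rei_meets] .

lemma rei_meet [simp]:
  "\<lbrakk>A \<in> Ob P; B \<in> Ob P; f \<in> Hom P A B; x \<in> carrier (fib P B); y \<in> carrier (fib P B)\<rbrakk> \<Longrightarrow>
    rei P A B f (x \<sqinter>\<^bsub>fib P B\<^esub> y) = rei P A B f x \<sqinter>\<^bsub>fib P A\<^esub> rei P A B f y"
  using rei_Inf[of A B f "{x, y}"] unfolding meet_def by simp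

lemma rei_mono:
  "\<lbrakk>x \<le>[P,B] y; A \<in> Ob P; B \<in> Ob P; f \<in> Hom P A B; x \<in> carrier (fib P B); y \<in> carrier (fib P B)\<rbrakk> \<Longrightarrow>
    rei P A B f x \<le>[P,A] rei P A B f y"
  by (rule preserves_finite_meets_mono[OF rei_meets fib fib])

lemma le_rei_mono:
  "\<lbrakk>\<gamma> \<le>[P,A] rei P A B f x; x \<le>[P,B] y; A \<in> Ob P; B \<in> Ob P; f \<in> Hom P A B;
    \<gamma> \<in> carrier (fib P A); x \<in> carrier (fib P B); y \<in> carrier (fib P B)\<rbrakk> \<Longrightarrow>
    \<gamma> \<le>[P,A] rei P A B f y"
  using fib_trans[of A \<gamma> "rei P A B f x" "rei P A B f y"] rei_mono[of B x y A f] by simp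

lemma rei_top:
  assumes "A \<in> Ob P" "B \<in> Ob P" "f \<in> Hom P A B" "x \<in> carrier (fib P B)"
    and "\<And>z. z \<in> carrier (fib P B) \<Longrightarrow> z \<le>[P,B] x" and "\<gamma> \<in> carrier (fib P A)"
  shows "\<gamma> \<le>[P,A] rei P A B f x"
  by (rule preserves_finite_meets_top[OF rei_meets fib fib]) (use assms in simp_all)

lemma inst_closed [simp]:
  "\<lbrakk>Y \<in> Ob P; A \<in> Ob P; B \<in> Ob P; f \<in> Hom P Y A; g \<in> Hom P Y B; \<rho> \<in> carrier (fib P (prd P A B))\<rbrakk> \<Longrightarrow>
    inst P Y A B \<rho> f g \<in> carrier (fib P Y)"
  unfolding inst_def by simp

lemma rei_inst [simp]:
  "\<lbrakk>Z \<in> Ob P; Y \<in> Ob P; A \<in> Ob P; B \<in> Ob P; h \<in> Hom P Z Y; f \<in> Hom P Y A; g \<in> Hom P Y B;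
    \<rho> \<in> carrier (fib P (prd P A B))\<rbrakk> \<Longrightarrow>
    rei P Z Y h (inst P Y A B \<rho> f g) = inst P Z A B \<rho> (cmp P Z Y A f h) (cmp P Z Y B g h)"
  unfolding inst_def by simp

lemma inst_pr [simp]:
  "\<lbrakk>A \<in> Ob P; B \<in> Ob P; \<rho> \<in> carrier (fib P (prd P A B))\<rbrakk> \<Longrightarrow>
    inst P (prd P A B) A B \<rho> (pr1 P A B) (pr2 P A B) = \<rho>"
  unfolding inst_def by simp

lemma inst_rei [simp]:
  "\<lbrakk>Y \<in> Ob P; A \<in> Ob P; B \<in> Ob P; D \<in> Ob P; f \<in> Hom P Y A; g \<in> Hom P Y B; h \<in> Hom P (prd P A B) D;
    \<alpha> \<in> carrier (fib P D)\<rbrakk> \<Longrightarrow>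
    inst P Y A B (rei P (prd P A B) D h \<alpha>) f g = rei P Y D
      (cmp P Y (prd P A B) D h (pairing P Y A B f g)) \<alpha>"
  unfolding inst_def by simp

lemma inst_inst [simp]:
  "\<lbrakk>Y \<in> Ob P; A \<in> Ob P; B \<in> Ob P; D \<in> Ob P; E \<in> Ob P; f \<in> Hom P Y A; g \<in> Hom P Y B;
    u \<in> Hom P (prd P A B) D; v \<in> Hom P (prd P A B) E; \<rho> \<in> carrier (fib P (prd P D E))\<rbrakk> \<Longrightarrow>
    inst P Y A B (inst P (prd P A B) D E \<rho> u v) f g =
      inst P Y D E \<rho> (cmp P Y (prd P A B) D u (pairing P Y A B f g))
        (cmp P Y (prd P A B) E v (pairing P Y A B f g))"
  unfolding inst_def by simp

lemma inst_meet [simp]: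
  "\<lbrakk>Y \<in> Ob P; A \<in> Ob P; B \<in> Ob P; f \<in> Hom P Y A; g \<in> Hom P Y B;
    \<rho> \<in> carrier (fib P (prd P A B)); \<sigma> \<in> carrier (fib P (prd P A B))\<rbrakk> \<Longrightarrow>
    inst P Y A B (\<rho> \<sqinter>\<^bsub>fib P (prd P A B)\<^esub> \<sigma>) f g = inst P Y A B \<rho> f g \<sqinter>\<^bsub>fib P Y\<^esub> inst P Y A B \<sigma> f g"
  unfolding inst_def by simp

lemma le_inst_mono:
  "\<lbrakk>\<gamma> \<le>[P,Y] inst P Y A B x f g; x \<le>[P,prd P A B] y; Y \<in> Ob P; A \<in> Ob P; B \<in> Ob P;
    f \<in> Hom P Y A; g \<in> Hom P Y B; \<gamma> \<in> carrier (fib P Y);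
    x \<in> carrier (fib P (prd P A B)); y \<in> carrier (fib P (prd P A B))\<rbrakk> \<Longrightarrow>
    \<gamma> \<le>[P,Y] inst P Y A B y f g"
  unfolding inst_def by (rule le_rei_mono[of Y \<gamma> "prd P A B" _ x]) simp_all

text \<open>
  It suffices to evaluate at the two projections, the generic pair of elements, where a predicate
  has itself as value.
\<close>

lemma le_prd_iff:
  assumes "A \<in> Ob P" "B \<in> Ob P" "x \<in> carrier (fib P (prd P A B))" "y \<in> carrier (fib P (prd P A B))"
  shows "x \<le>[P,prd P A B] y \<longleftrightarrow> (\<forall>Y \<in> Ob P. \<forall>f \<in> Hom P Y A. \<forall>g \<in> Hom P Y B. \<forall>\<gamma> \<in> carrier (fib P Y).
    \<gamma> \<le>[P,Y] inst P Y A B x f g \<longrightarrow> \<gamma> \<le>[P,Y] inst P Y A B y f g)" (is "_ \<longleftrightarrow> ?R")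
proof
  assume "x \<le>[P,prd P A B] y"
  then show ?R using le_inst_mono[of _ _ A B x _ _ y] assms by simp
next
  assume ?R
  then have "x \<le>[P,prd P A B] inst P (prd P A B) A B x (pr1 P A B) (pr2 P A B) \<longrightarrow>
    x \<le>[P,prd P A B] inst P (prd P A B) A B y (pr1 P A B) (pr2 P A B)"
    using assms by (meson pr1_Hom pr2_Hom prd_Ob)
  then show "x \<le>[P,prd P A B] y" using assms by simp
qed

lemma rei_prod_arrow [simp]:
  "\<lbrakk>A \<in> Ob P; B \<in> Ob P; A' \<in> Ob P; B' \<in> Ob P; f \<in> Hom P A A'; g \<in> Hom P B B';
    \<rho> \<in> carrier (fib P (prd P A' B'))\<rbrakk> \<Longrightarrow>
    rei P (prd P A B) (prd P A' B') (prod_arrow P A B A' B' f g) \<rho> =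
    inst P (prd P A B) A' B' \<rho> (cmp P (prd P A B) A A' f (pr1 P A B))
      (cmp P (prd P A B) B B' g (pr2 P A B))"
  unfolding prod_arrow_def inst_def by simp

lemma rei_diagonal [simp]:
  "\<lbrakk>A \<in> Ob P; \<beta> \<in> carrier (fib P (prd P A A))\<rbrakk> \<Longrightarrow>
    rei P A (prd P A A) (diagonal P A) \<beta> = inst P A A A \<beta> (idn P A) (idn P A)"
  unfolding diagonal_def inst_def by simp

lemma rei_swap [simp]:
  "\<lbrakk>A \<in> Ob P; \<beta> \<in> carrier (fib P (prd P A A))\<rbrakk> \<Longrightarrow>
    rei P (prd P A A) (prd P A A) (swap P A) \<beta> = inst P (prd P A A) A A \<beta> (pr2 P A A) (pr1 P A A)"
  unfolding swap_def inst_def by simp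

lemma tri12_eq [simp]:
  "\<lbrakk>X \<in> Ob P; A \<in> Ob P; B \<in> Ob P\<rbrakk> \<Longrightarrow> tri12 P X A B = pr1 P (prd P X A) B"
  unfolding tri_defs by simp

lemma par_diagonal_eq [simp]:
  "\<lbrakk>X \<in> Ob P; A \<in> Ob P\<rbrakk> \<Longrightarrow>
    par_diagonal P X A = pairing P (prd P X A) (prd P X A) A (idn P (prd P X A)) (pr2 P X A)"
  unfolding par_diagonal_def by simp

lemma rei_tri23 [simp]:
  "\<lbrakk>X \<in> Ob P; A \<in> Ob P; B \<in> Ob P; \<beta> \<in> carrier (fib P (prd P A B))\<rbrakk> \<Longrightarrow>
    rei P (prd P (prd P X A) B) (prd P A B) (tri23 P X A B) \<beta> =
    inst P (prd P (prd P X A) B) A B \<beta>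
      (cmp P (prd P (prd P X A) B) (prd P X A) A (pr2 P X A) (pr1 P (prd P X A) B))
        (pr2 P (prd P X A) B)"
  unfolding tri_defs inst_def ..

lemma rei_tri13 [simp]:
  "\<lbrakk>X \<in> Ob P; A \<in> Ob P; B \<in> Ob P; \<beta> \<in> carrier (fib P (prd P X B))\<rbrakk> \<Longrightarrow>
    rei P (prd P (prd P X A) B) (prd P X B) (tri13 P X A B) \<beta> =
    inst P (prd P (prd P X A) B) X B \<beta>
      (cmp P (prd P (prd P X A) B) (prd P X A) X (pr1 P X A) (pr1 P (prd P X A) B))
        (pr2 P (prd P X A) B)"
  unfolding tri_defs inst_def ..

lemma rei_pr1_tri12:
  "\<lbrakk>X \<in> Ob P; A \<in> Ob P; B \<in> Ob P; \<beta> \<in> carrier (fib P (prd P X A))\<rbrakk> \<Longrightarrow>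
    rei P (prd P (prd P X A) B) (prd P X A) (pr1 P (prd P X A) B) \<beta> =
    inst P (prd P (prd P X A) B) X A \<beta>
      (cmp P (prd P (prd P X A) B) (prd P X A) X (pr1 P X A) (pr1 P (prd P X A) B))
      (cmp P (prd P (prd P X A) B) (prd P X A) A (pr2 P X A) (pr1 P (prd P X A) B))"
  unfolding inst_def by simp

section \<open>Equality, equivalence relations and descent data\<close>

lemma galoisI:
  assumes "A \<in> Ob P" "B \<in> Ob P"
    and "\<And>x. x \<in> carrier (fib P A) \<Longrightarrow> l x \<in> carrier (fib P B)"
    and "\<And>y. y \<in> carrier (fib P B) \<Longrightarrow> u y \<in> carrier (fib P A)"
    and "\<And>x y. \<lbrakk>x \<in> carrier (fib P A); y \<in> carrier (fib P B)\<rbrakk> \<Longrightarrow> l x \<le>[P,B] y \<longleftrightarrow> x \<le>[P,A] u y"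
  shows "galois_connection \<lparr>orderA = fib P A, orderB = fib P B, lower = l, upper = u\<rparr>"
proof -
  have po: "partial_order (fib P X)" if "X \<in> Ob P" for X
    using fib[OF that] unfolding inf_semilattice_def by blast
  show ?thesis
    unfolding galois_connection_def connection_def galois_connection_axioms_def
    using assms po by simp
qed

text \<open>
  The rules of equality imply the two adjunctions. The predicate \<open>P\<^bsub>pr\<^sub>1\<^esub>(x) \<and> d\<close> states \<open>x\<close> of
  the first element and the equality of both; if \<open>y\<close> holds on the diagonal wherever \<open>x\<close> does, then
  substitution moves \<open>y\<close> from the diagonal to the given pair. Conversely, reflexivity makes \<open>d\<close>
  true on the diagonal. The parametrised adjunction is the same argument with the further variable
  carried in \<open>u\<close>.
\<close>

lemma is_deltaI:
  assumes A: "A \<in> Ob P" and d: "d \<in> carrier (fib P (prd P A A))"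
    and refl: "\<And>\<gamma>. \<gamma> \<in> carrier (fib P A) \<Longrightarrow> \<gamma> \<le>[P,A] inst P A A A d (idn P A) (idn P A)"
    and subst2: "\<And>Y \<gamma> \<beta> f g. \<lbrakk>Y \<in> Ob P; \<gamma> \<in> carrier (fib P Y); \<beta> \<in> carrier (fib P (prd P A A));
      f \<in> Hom P Y A; g \<in> Hom P Y A; \<gamma> \<le>[P,Y] inst P Y A A d f g;
      \<gamma> \<le>[P,Y] inst P Y A A \<beta> f f\<rbrakk> \<Longrightarrow> \<gamma> \<le>[P,Y] inst P Y A A \<beta> f g"
    and subst3: "\<And>X Y \<gamma> \<beta> u g. \<lbrakk>X \<in> Ob P; Y \<in> Ob P; \<gamma> \<in> carrier (fib P Y);
      \<beta> \<in> carrier (fib P (prd P (prd P X A) A));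
      u \<in> Hom P Y (prd P X A); g \<in> Hom P Y A;
      \<gamma> \<le>[P,Y] inst P Y A A d (cmp P Y (prd P X A) A (pr2 P X A) u) g;
      \<gamma> \<le>[P,Y] inst P Y (prd P X A) A \<beta> u (cmp P Y (prd P X A) A (pr2 P X A) u)\<rbrakk> \<Longrightarrow>
      \<gamma> \<le>[P,Y] inst P Y (prd P X A) A \<beta> u g"
  shows "is_delta P A d"
  unfolding is_delta_def
proof (intro conjI ballI)
  note [simp] = A d
  show "d \<in> carrier (fib P (prd P A A))" by simp
  show "galois_connection \<lparr>orderA = fib P A, orderB = fib P (prd P A A),
      lower = \<lambda>\<alpha>. rei P (prd P A A) A (pr1 P A A) \<alpha> \<sqinter>\<^bsub>fib P (prd P A A)\<^esub> d,
      upper = rei P A (prd P A A) (diagonal P A)\<rparr>"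
  proof (rule galoisI)
    fix x y assume [simp]: "x \<in> carrier (fib P A)" "y \<in> carrier (fib P (prd P A A))"
    let ?l = "rei P (prd P A A) A (pr1 P A A) x \<sqinter>\<^bsub>fib P (prd P A A)\<^esub> d"
    show "?l \<le>[P,prd P A A] y \<longleftrightarrow> x \<le>[P,A] rei P A (prd P A A) (diagonal P A) y"
    proof
      assume ly: "?l \<le>[P,prd P A A] y"
      have "x \<le>[P,A] inst P A A A ?l (idn P A) (idn P A)" using refl by simp
      from le_inst_mono[OF this ly] show "x \<le>[P,A] rei P A (prd P A A) (diagonal P A) y" by simp
    next
      assume "x \<le>[P,A] rei P A (prd P A A) (diagonal P A) y"
      then have "x \<le>[P,A] inst P A A A y (idn P A) (idn P A)" by simp
      from le_rei_mono[OF meet_fib_le1 this, of "prd P A A" "pr1 P A A" d]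
      have "?l \<le>[P,prd P A A] inst P (prd P A A) A A y (pr1 P A A) (pr1 P A A)" by simp
      moreover have "?l \<le>[P,prd P A A] inst P (prd P A A) A A d (pr1 P A A) (pr2 P A A)"
        by (simp add: meet_fib_le2)
      ultimately show "?l \<le>[P,prd P A A] y"
        using subst2[of "prd P A A" ?l y "pr1 P A A" "pr2 P A A"] by simp
    qed
  qed simp_all
  fix X assume [simp]: "X \<in> Ob P"
  let ?W = "prd P X A"
  have "galois_connection \<lparr>orderA = fib P ?W, orderB = fib P (prd P ?W A),
      lower = \<lambda>\<alpha>. rei P (prd P ?W A) ?W (pr1 P ?W A) \<alpha> \<sqinter>\<^bsub>fib P (prd P ?W A)\<^esub>
        rei P (prd P ?W A) (prd P A A) (tri23 P X A A) d,
      upper = rei P ?W (prd P ?W A) (par_diagonal P X A)\<rparr>"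
  proof (rule galoisI)
    fix x y assume [simp]: "x \<in> carrier (fib P ?W)" "y \<in> carrier (fib P (prd P ?W A))"
    let ?l = "rei P (prd P ?W A) ?W (pr1 P ?W A) x \<sqinter>\<^bsub>fib P (prd P ?W A)\<^esub>
        rei P (prd P ?W A) (prd P A A) (tri23 P X A A) d"
    have diag: "rei P ?W (prd P ?W A) (par_diagonal P X A) y =
      inst P ?W ?W A y (idn P ?W) (pr2 P X A)"
      by (simp add: inst_def)
    have l: "?l \<in> carrier (fib P (prd P ?W A))" by simp
    show "?l \<le>[P,prd P ?W A] y \<longleftrightarrow> x \<le>[P,?W] rei P ?W (prd P ?W A) (par_diagonal P X A) y"
    proof
      assume ly: "?l \<le>[P,prd P ?W A] y"
      have "x \<le>[P,?W] rei P ?W A (pr2 P X A) (inst P A A A d (idn P A) (idn P A))"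
        using refl by (intro rei_top) simp_all
      then have "x \<le>[P,?W] inst P ?W ?W A ?l (idn P ?W) (pr2 P X A)"
        by simp
      from le_inst_mono[OF this ly]
      show "x \<le>[P,?W] rei P ?W (prd P ?W A) (par_diagonal P X A) y" unfolding diag by simp
    next
      assume "x \<le>[P,?W] rei P ?W (prd P ?W A) (par_diagonal P X A) y"
      then have "x \<le>[P,?W] inst P ?W ?W A y (idn P ?W) (pr2 P X A)" unfolding diag .
      from le_rei_mono[OF meet_fib_le1 this, of "prd P ?W A" "pr1 P ?W A"
        "rei P (prd P ?W A) (prd P A A) (tri23 P X A A) d"]
      have "?l \<le>[P,prd P ?W A] inst P (prd P ?W A) ?W A y (pr1 P ?W A)
          (cmp P (prd P ?W A) ?W A (pr2 P X A) (pr1 P ?W A))" by simp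
      moreover have "?l \<le>[P,prd P ?W A] inst P (prd P ?W A) A A d
          (cmp P (prd P ?W A) ?W A (pr2 P X A) (pr1 P ?W A)) (pr2 P ?W A)"
        by (simp add: meet_fib_le2)
      ultimately show "?l \<le>[P,prd P ?W A] y"
        using subst3[of X "prd P ?W A" ?l y "pr1 P ?W A" "pr2 P ?W A"] by simp
    qed
  qed (simp_all add: tri23_def tri2_def tri3_def prd3_def)
  then show "galois_connection \<lparr>orderA = fib P (prd P X A), orderB = fib P (prd3 P X A A),
      lower = \<lambda>\<alpha>. rei P (prd3 P X A A) (prd P X A) (tri12 P X A A) \<alpha> \<sqinter>\<^bsub>fib P (prd3 P X A A)\<^esub>
        rei P (prd3 P X A A) (prd P A A) (tri23 P X A A) d,
      upper = rei P (prd P X A) (prd3 P X A A) (par_diagonal P X A)\<rparr>"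
    by (simp add: prd3_def)
qed

lemma is_delta_refl:
  assumes d: "is_delta P A d" and A: "A \<in> Ob P" "Y \<in> Ob P" "\<gamma> \<in> carrier (fib P Y)" "f \<in> Hom P Y A"
  shows "\<gamma> \<le>[P,Y] inst P Y A A d f f"
proof -
  note [simp] = A
  have dc [simp]: "d \<in> carrier (fib P (prd P A A))" using d unfolding is_delta_def by blast
  interpret G: galois_connection "\<lparr>orderA = fib P A, orderB = fib P (prd P A A),
      lower = \<lambda>\<alpha>. rei P (prd P A A) A (pr1 P A A) \<alpha> \<sqinter>\<^bsub>fib P (prd P A A)\<^esub> d,
      upper = rei P A (prd P A A) (diagonal P A)\<rparr>" 
    using d unfolding is_delta_def by blast
  have "x \<le>[P,A] inst P A A A d (idn P A) (idn P A)" if "x \<in> carrier (fib P A)" for x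
    using G.right[of x d] that by (simp add: meet_fib_le2)
  from rei_top[OF A(2,1,4) _ this A(3)] show ?thesis by simp
qed

lemma is_delta_subst2:
  assumes d: "is_delta P A d" and A: "A \<in> Ob P" "Y \<in> Ob P" "\<gamma> \<in> carrier (fib P Y)"
    "\<beta> \<in> carrier (fib P (prd P A A))" "f \<in> Hom P Y A" "g \<in> Hom P Y A"
    and le: "\<gamma> \<le>[P,Y] inst P Y A A d f g" "\<gamma> \<le>[P,Y] inst P Y A A \<beta> f f"
  shows "\<gamma> \<le>[P,Y] inst P Y A A \<beta> f g"
proof -
  note [simp] = A
  have dc [simp]: "d \<in> carrier (fib P (prd P A A))" using d unfolding is_delta_def by blast
  interpret G: galois_connection "\<lparr>orderA = fib P A, orderB = fib P (prd P A A),
      lower = \<lambda>\<alpha>. rei P (prd P A A) A (pr1 P A A) \<alpha> \<sqinter>\<^bsub>fib P (prd P A A)\<^esub> d,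
      upper = rei P A (prd P A A) (diagonal P A)\<rparr>" 
    using d unfolding is_delta_def by blast
  have "rei P (prd P A A) A (pr1 P A A) (inst P A A A \<beta> (idn P A) (idn P A)) \<sqinter>\<^bsub>fib P (prd P A A)\<^esub> d
      \<le>[P,prd P A A] \<beta>" using G.deflation[of \<beta>] by simp
  from le_inst_mono[OF _ this, of Y \<gamma> f g] show ?thesis using le by simp
qed

text \<open>
  Substitution with a parameter \<open>k\<close> comes from the second adjunction, applied to the predicate
  that \<open>\<phi>\<close> becomes on \<open>(X \<times> A) \<times> A\<close> when its second argument is the last variable.
\<close>

lemma is_delta_subst:
  assumes d: "is_delta P A d" and A: "X \<in> Ob P" "A \<in> Ob P" "Y \<in> Ob P" "\<gamma> \<in> carrier (fib P Y)"
    "\<phi> \<in> carrier (fib P (prd P X A))" "k \<in> Hom P Y X" "f \<in> Hom P Y A" "g \<in> Hom P Y A"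
    and le: "\<gamma> \<le>[P,Y] inst P Y A A d f g" "\<gamma> \<le>[P,Y] inst P Y X A \<phi> k f"
  shows "\<gamma> \<le>[P,Y] inst P Y X A \<phi> k g"
proof -
  note [simp] = A
  let ?W = "prd P X A"
  have dc [simp]: "d \<in> carrier (fib P (prd P A A))" using d unfolding is_delta_def by blast
  have gal: "galois_connection \<lparr>orderA = fib P (prd P X A), orderB = fib P (prd3 P X A A),
      lower = \<lambda>\<alpha>. rei P (prd3 P X A A) (prd P X A) (tri12 P X A A) \<alpha> \<sqinter>\<^bsub>fib P (prd3 P X A A)\<^esub>
        rei P (prd3 P X A A) (prd P A A) (tri23 P X A A) d,
      upper = rei P (prd P X A) (prd3 P X A A) (par_diagonal P X A)\<rparr>" 
    using d A(1) unfolding is_delta_def by blast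
  interpret G: galois_connection "\<lparr>orderA = fib P ?W, orderB = fib P (prd P ?W A),
      lower = \<lambda>\<alpha>. rei P (prd P ?W A) ?W (pr1 P ?W A) \<alpha> \<sqinter>\<^bsub>fib P (prd P ?W A)\<^esub>
        rei P (prd P ?W A) (prd P A A) (tri23 P X A A) d,
      upper = rei P ?W (prd P ?W A) (par_diagonal P X A)\<rparr>"
    using gal by (simp add: prd3_def)
  let ?\<beta> = "rei P (prd P ?W A) ?W (tri13 P X A A) \<phi>"
  have "rei P (prd P ?W A) ?W (pr1 P ?W A) \<phi> \<sqinter>\<^bsub>fib P (prd P ?W A)\<^esub>
        rei P (prd P ?W A) (prd P A A) (tri23 P X A A) d \<le>[P,prd P ?W A] ?\<beta>"
    using G.left[of \<phi> ?\<beta>] by simp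
  from le_inst_mono[OF _ this, of Y \<gamma> "pairing P Y X A k f" g] le
  show ?thesis by (simp add: inst_def)
qed

end

context elementary_doctrine
begin

text \<open>
  The predicate \<open>\<delta>\<close> is defined by a definite description, so it has to be shown unique: each of
  two equality predicates is reflexive, hence contains the other by substitution.
\<close>

lemma delta_is_delta: "A \<in> Ob P \<Longrightarrow> is_delta P A (delta P A)"
  and is_delta_eq: "\<lbrakk>A \<in> Ob P; is_delta P A d\<rbrakk> \<Longrightarrow> delta P A = d"
proof -
  have le: "d \<le>[P,prd P A A] d'" if A: "A \<in> Ob P" and d: "is_delta P A d" "is_delta P A d'"
    for A d d'
  proof -
    note [simp] = A
    have [simp]: "d \<in> carrier (fib P (prd P A A))" "d' \<in> carrier (fib P (prd P A A))"
      using d unfolding is_delta_def by blast+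
    have "d \<le>[P,prd P A A] inst P (prd P A A) A A d' (pr1 P A A) (pr2 P A A)"
      by (rule is_delta_subst2[OF d(1)]) (use is_delta_refl[OF d(2)] in simp_all)
    then show ?thesis by simp
  qed
  have uniq: "d = d'" if A: "A \<in> Ob P" and d: "is_delta P A d" "is_delta P A d'" for A d d'
    by (rule fib_antisym[OF le[OF A d] le[OF A d(2,1)]]) (use d A in \<open>auto simp: is_delta_def\<close>)
  show "is_delta P A (delta P A)" if A: "A \<in> Ob P"
    unfolding delta_def using delta_exists[OF A] uniq[OF A] by (metis theI)
  show "delta P A = d" if "A \<in> Ob P" "is_delta P A d"
    unfolding delta_def using that uniq by blast
qed

lemma delta_closed [simp]: "A \<in> Ob P \<Longrightarrow> delta P A \<in> carrier (fib P (prd P A A))"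
  using delta_is_delta unfolding is_delta_def by blast

lemmas delta_refl = is_delta_refl[OF delta_is_delta]
lemmas delta_subst2 = is_delta_subst2[OF delta_is_delta]
lemmas delta_subst = is_delta_subst[OF delta_is_delta]

text \<open>
  Substituting \<open>g\<close> for the second argument of \<open>\<rho>(f, f)\<close> shows that a reflexive relation contains
  equality.
\<close>

lemma delta_le_iff:
  assumes [simp]: "A \<in> Ob P" "\<rho> \<in> carrier (fib P (prd P A A))"
  shows "delta P A \<le>[P,prd P A A] \<rho> \<longleftrightarrow>
    (\<forall>Y \<in> Ob P. \<forall>f \<in> Hom P Y A. \<forall>\<gamma> \<in> carrier (fib P Y). \<gamma> \<le>[P,Y] inst P Y A A \<rho> f f)"
proof
  assume le: "delta P A \<le>[P,prd P A A] \<rho>"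
  show "\<forall>Y \<in> Ob P. \<forall>f \<in> Hom P Y A. \<forall>\<gamma> \<in> carrier (fib P Y). \<gamma> \<le>[P,Y] inst P Y A A \<rho> f f"
    using le_inst_mono[OF delta_refl le] by simp
next
  assume "\<forall>Y \<in> Ob P. \<forall>f \<in> Hom P Y A. \<forall>\<gamma> \<in> carrier (fib P Y). \<gamma> \<le>[P,Y] inst P Y A A \<rho> f f"
  then have "delta P A \<le>[P,prd P A A] inst P (prd P A A) A A \<rho> (pr1 P A A) (pr2 P A A)"
    by - (rule delta_subst2, simp_all)
  then show "delta P A \<le>[P,prd P A A] \<rho>" by simp
qed

text \<open>
  The definition states the three laws at the generic pair and the generic triple of elements;
  they follow from the laws at all generalised elements by evaluating at projections.
\<close>

lemma equiv_relI:
  assumes A: "A \<in> Ob P" and \<rho>: "\<rho> \<in> carrier (fib P (prd P A A))"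
    and refl: "\<And>Y f \<gamma>. \<lbrakk>Y \<in> Ob P; f \<in> Hom P Y A; \<gamma> \<in> carrier (fib P Y)\<rbrakk> \<Longrightarrow>
      \<gamma> \<le>[P,Y] inst P Y A A \<rho> f f"
    and sym: "\<And>Y f g \<gamma>. \<lbrakk>Y \<in> Ob P; f \<in> Hom P Y A; g \<in> Hom P Y A; \<gamma> \<in> carrier (fib P Y);
      \<gamma> \<le>[P,Y] inst P Y A A \<rho> f g\<rbrakk> \<Longrightarrow> \<gamma> \<le>[P,Y] inst P Y A A \<rho> g f"
    and trans: "\<And>Y f g h \<gamma>. \<lbrakk>Y \<in> Ob P; f \<in> Hom P Y A; g \<in> Hom P Y A; h \<in> Hom P Y A;
      \<gamma> \<in> carrier (fib P Y); \<gamma> \<le>[P,Y] inst P Y A A \<rho> f g; \<gamma> \<le>[P,Y] inst P Y A A \<rho> g h\<rbrakk> \<Longrightarrow>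
      \<gamma> \<le>[P,Y] inst P Y A A \<rho> f h"
  shows "equiv_rel P A \<rho>"
proof -
  note [simp] = A \<rho>
  have d: "delta P A \<le>[P,prd P A A] \<rho>" using delta_le_iff refl by simp
  have s: "\<rho> \<le>[P,prd P A A] inst P (prd P A A) A A \<rho> (pr2 P A A) (pr1 P A A)"
    using sym[of "prd P A A" "pr1 P A A" "pr2 P A A" \<rho>] by simp
  let ?W = "prd P (prd P A A) A"
  let ?p = "cmp P ?W (prd P A A) A (pr1 P A A) (pr1 P (prd P A A) A)"
  let ?q = "cmp P ?W (prd P A A) A (pr2 P A A) (pr1 P (prd P A A) A)"
  let ?r = "pr2 P (prd P A A) A"
  let ?m = "inst P ?W A A \<rho> ?p ?q \<sqinter>\<^bsub>fib P ?W\<^esub> inst P ?W A A \<rho> ?q ?r"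
  have "?m \<le>[P,?W] inst P ?W A A \<rho> ?p ?r"
    by (rule trans[of ?W ?p ?q ?r]) (simp_all add: meet_fib_le1 meet_fib_le2)
  then show ?thesis
    unfolding equiv_rel_def Let_def using d s by (simp add: prd3_def rei_pr1_tri12)
qed

lemma equiv_rel_closed: "equiv_rel P A \<rho> \<Longrightarrow> \<rho> \<in> carrier (fib P (prd P A A))"
  unfolding equiv_rel_def Let_def by blast

lemma equiv_refl:
  assumes "equiv_rel P A \<rho>" "A \<in> Ob P" "Y \<in> Ob P" "f \<in> Hom P Y A" "\<gamma> \<in> carrier (fib P Y)"
  shows "\<gamma> \<le>[P,Y] inst P Y A A \<rho> f f"
proof -
  have "delta P A \<le>[P,prd P A A] \<rho>" using assms(1) unfolding equiv_rel_def Let_def by blast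
  then show ?thesis using delta_le_iff[OF assms(2) equiv_rel_closed[OF assms(1)]] assms(3-5) by simp
qed

lemma equiv_sym:
  assumes e: "equiv_rel P A \<rho>" and [simp]: "A \<in> Ob P" "Y \<in> Ob P" "f \<in> Hom P Y A" "g \<in> Hom P Y A"
    "\<gamma> \<in> carrier (fib P Y)" and le: "\<gamma> \<le>[P,Y] inst P Y A A \<rho> f g"
  shows "\<gamma> \<le>[P,Y] inst P Y A A \<rho> g f"
proof -
  note [simp] = equiv_rel_closed[OF e]
  have "\<rho> \<le>[P,prd P A A] inst P (prd P A A) A A \<rho> (pr2 P A A) (pr1 P A A)"
    using e unfolding equiv_rel_def Let_def by simp
  from le_inst_mono[OF le this] show ?thesis by simp
qed

lemma equiv_trans:
  assumes e: "equiv_rel P A \<rho>" and [simp]: "A \<in> Ob P" "Y \<in> Ob P" "f \<in> Hom P Y A" "g \<in> Hom P Y A"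
    "h \<in> Hom P Y A" "\<gamma> \<in> carrier (fib P Y)"
    and le: "\<gamma> \<le>[P,Y] inst P Y A A \<rho> f g" "\<gamma> \<le>[P,Y] inst P Y A A \<rho> g h"
  shows "\<gamma> \<le>[P,Y] inst P Y A A \<rho> f h"
proof -
  note [simp] = equiv_rel_closed[OF e]
  let ?W = "prd P (prd P A A) A"
  let ?p = "cmp P ?W (prd P A A) A (pr1 P A A) (pr1 P (prd P A A) A)"
  let ?q = "cmp P ?W (prd P A A) A (pr2 P A A) (pr1 P (prd P A A) A)"
  let ?r = "pr2 P (prd P A A) A"
  let ?m = "inst P ?W A A \<rho> ?p ?q \<sqinter>\<^bsub>fib P ?W\<^esub> inst P ?W A A \<rho> ?q ?r"
  have m: "?m \<le>[P,?W] inst P ?W A A \<rho> ?p ?r"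
    using e unfolding equiv_rel_def Let_def by (simp add: prd3_def rei_pr1_tri12)
  have "\<gamma> \<le>[P,Y] inst P Y (prd P A A) A ?m (pairing P Y A A f g) h"
    using le by simp
  from le_inst_mono[OF this m] show ?thesis by simp
qed

lemma descentI:
  assumes [simp]: "A \<in> Ob P" "\<rho> \<in> carrier (fib P (prd P A A))" "\<alpha> \<in> carrier (fib P A)"
    and d: "\<And>Y f g \<gamma>. \<lbrakk>Y \<in> Ob P; f \<in> Hom P Y A; g \<in> Hom P Y A; \<gamma> \<in> carrier (fib P Y);
      \<gamma> \<le>[P,Y] rei P Y A f \<alpha>; \<gamma> \<le>[P,Y] inst P Y A A \<rho> f g\<rbrakk> \<Longrightarrow> \<gamma> \<le>[P,Y] rei P Y A g \<alpha>"
  shows "\<alpha> \<in> descent P A \<rho>"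
proof -
  have "rei P (prd P A A) A (pr1 P A A) \<alpha> \<sqinter>\<^bsub>fib P (prd P A A)\<^esub> \<rho> \<le>[P,prd P A A]
      rei P (prd P A A) A (pr2 P A A) \<alpha>"
    by (rule d[of _ "pr1 P A A"]) (simp_all add: meet_fib_le1 meet_fib_le2)
  then show ?thesis unfolding descent_def Let_def by simp
qed

lemma descent_closed: "\<alpha> \<in> descent P A \<rho> \<Longrightarrow> \<alpha> \<in> carrier (fib P A)"
  unfolding descent_def Let_def by blast

lemma descent_subst:
  assumes d: "\<alpha> \<in> descent P A \<rho>" and [simp]: "A \<in> Ob P" "\<rho> \<in> carrier (fib P (prd P A A))"
    "Y \<in> Ob P" "f \<in> Hom P Y A" "g \<in> Hom P Y A" "\<gamma> \<in> carrier (fib P Y)"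
    and le: "\<gamma> \<le>[P,Y] rei P Y A f \<alpha>" "\<gamma> \<le>[P,Y] inst P Y A A \<rho> f g"
  shows "\<gamma> \<le>[P,Y] rei P Y A g \<alpha>"
proof -
  note [simp] = descent_closed[OF d]
  have m: "rei P (prd P A A) A (pr1 P A A) \<alpha> \<sqinter>\<^bsub>fib P (prd P A A)\<^esub> \<rho> \<le>[P,prd P A A]
      rei P (prd P A A) A (pr2 P A A) \<alpha>"
    using d unfolding descent_def Let_def by simp
  from le_inst_mono[OF _ m, of Y \<gamma> f g] show ?thesis using le by simp
qed

text \<open>
  Reindexing preserves finite meets, so the descent condition can be checked on each member of \<open>S\<close>
  separately.
\<close>

lemma descent_Inf:
  assumes [simp]: "A \<in> Ob P" "\<rho> \<in> carrier (fib P (prd P A A))" and S: "finite S" "S \<subseteq> descent P A \<rho>"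
  shows "\<Sqinter>\<^bsub>fib P A\<^esub>S \<in> descent P A \<rho>"
proof -
  have Sc: "S \<subseteq> carrier (fib P A)" using S descent_closed by blast
  show ?thesis
  proof (rule descentI)
    show "\<Sqinter>\<^bsub>fib P A\<^esub>S \<in> carrier (fib P A)" using S Sc by (intro Inf_fib_closed) simp_all
    fix Y f g \<gamma>
    assume [simp]: "Y \<in> Ob P" "f \<in> Hom P Y A" "g \<in> Hom P Y A" "\<gamma> \<in> carrier (fib P Y)"
      and le: "\<gamma> \<le>[P,Y] rei P Y A f (\<Sqinter>\<^bsub>fib P A\<^esub>S)" "\<gamma> \<le>[P,Y] inst P Y A A \<rho> f g"
    have iff: "\<gamma> \<le>[P,Y] rei P Y A h (\<Sqinter>\<^bsub>fib P A\<^esub>S) \<longleftrightarrow> (\<forall>s\<in>S. \<gamma> \<le>[P,Y] rei P Y A h s)"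
      if [simp]: "h \<in> Hom P Y A" for h
    proof -
      have "rei P Y A h ` S \<subseteq> carrier (fib P Y)" using Sc by auto
      then show ?thesis using S Sc by (simp add: rei_Inf le_Inf_fib_iff)
    qed
    have "\<forall>s\<in>S. \<gamma> \<le>[P,Y] rei P Y A g s"
    proof
      fix s assume s: "s \<in> S"
      show "\<gamma> \<le>[P,Y] rei P Y A g s"
        by (rule descent_subst[of s A \<rho> Y f]) (use s S le iff in auto)
    qed
    then show "\<gamma> \<le>[P,Y] rei P Y A g (\<Sqinter>\<^bsub>fib P A\<^esub>S)" using iff by simp
  qed simp_all
qed

lemma equiv_delta:
  assumes [simp]: "A \<in> Ob P"
  shows "equiv_rel P A (delta P A)"
proof (rule equiv_relI)
  fix Y f g \<gamma>
  assume a [simp]: "Y \<in> Ob P" "f \<in> Hom P Y A" "g \<in> Hom P Y A" "\<gamma> \<in> carrier (fib P Y)"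
    and le: "\<gamma> \<le>[P,Y] inst P Y A A (delta P A) f g"
  let ?\<beta> = "inst P (prd P A A) A A (delta P A) (pr2 P A A) (pr1 P A A)"
  have "\<gamma> \<le>[P,Y] inst P Y A A ?\<beta> f g"
    by (rule delta_subst2) (use le delta_refl in simp_all)
  then show "\<gamma> \<le>[P,Y] inst P Y A A (delta P A) g f" by simp
  fix h assume [simp]: "h \<in> Hom P Y A" and le': "\<gamma> \<le>[P,Y] inst P Y A A (delta P A) g h"
  show "\<gamma> \<le>[P,Y] inst P Y A A (delta P A) f h"
    by (rule delta_subst[of A A Y \<gamma> _ f g h]) (use le le' in simp_all)
qed (simp_all add: delta_refl)

lemma descent_delta:
  assumes [simp]: "A \<in> Ob P"
  shows "descent P A (delta P A) = carrier (fib P A)"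
proof
  show "descent P A (delta P A) \<subseteq> carrier (fib P A)" using descent_closed by blast
  show "carrier (fib P A) \<subseteq> descent P A (delta P A)"
  proof
    fix \<alpha> assume [simp]: "\<alpha> \<in> carrier (fib P A)"
    show "\<alpha> \<in> descent P A (delta P A)"
    proof (rule descentI)
      fix Y f g \<gamma>
      assume [simp]: "Y \<in> Ob P" "f \<in> Hom P Y A" "g \<in> Hom P Y A" "\<gamma> \<in> carrier (fib P Y)"
        and le: "\<gamma> \<le>[P,Y] rei P Y A f \<alpha>" "\<gamma> \<le>[P,Y] inst P Y A A (delta P A) f g"
      have "\<gamma> \<le>[P,Y] inst P Y A A (rei P (prd P A A) A (pr2 P A A) \<alpha>) f g"
        by (rule delta_subst2) (use le in simp_all)
      then show "\<gamma> \<le>[P,Y] rei P Y A g \<alpha>" by simp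
    qed simp_all
  qed
qed

lemma prod_rel_closed [simp]:
  "\<lbrakk>A \<in> Ob P; B \<in> Ob P; \<rho> \<in> carrier (fib P (prd P A A)); \<sigma> \<in> carrier (fib P (prd P B B))\<rbrakk> \<Longrightarrow>
    prod_rel P A \<rho> B \<sigma> \<in> carrier (fib P (prd P (prd P A B) (prd P A B)))"
  unfolding prod_rel_def Let_def by simp

lemma le_prod_rel_iff [simp]:
  assumes [simp]: "A \<in> Ob P" "B \<in> Ob P" "\<rho> \<in> carrier (fib P (prd P A A))"
    "\<sigma> \<in> carrier (fib P (prd P B B))"
    "Y \<in> Ob P" "f \<in> Hom P Y (prd P A B)" "g \<in> Hom P Y (prd P A B)" "\<gamma> \<in> carrier (fib P Y)"
  shows "\<gamma> \<le>[P,Y] inst P Y (prd P A B) (prd P A B) (prod_rel P A \<rho> B \<sigma>) f g \<longleftrightarrow>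
    \<gamma> \<le>[P,Y] inst P Y A A \<rho> (cmp P Y (prd P A B) A (pr1 P A B) f)
      (cmp P Y (prd P A B) A (pr1 P A B) g) \<and>
    \<gamma> \<le>[P,Y] inst P Y B B \<sigma> (cmp P Y (prd P A B) B (pr2 P A B) f)
      (cmp P Y (prd P A B) B (pr2 P A B) g)"
  unfolding prod_rel_def Let_def by simp

lemma equiv_prod_rel:
  assumes [simp]: "A \<in> Ob P" "B \<in> Ob P" and e: "equiv_rel P A \<rho>" "equiv_rel P B \<sigma>"
  shows "equiv_rel P (prd P A B) (prod_rel P A \<rho> B \<sigma>)"
proof -
  note [simp] = equiv_rel_closed[OF e(1)] equiv_rel_closed[OF e(2)]
  show ?thesis
  proof (rule equiv_relI)
    fix Y f g \<gamma>
    assume [simp]: "Y \<in> Ob P" "f \<in> Hom P Y (prd P A B)" "\<gamma> \<in> carrier (fib P Y)"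
    show "\<gamma> \<le>[P,Y] inst P Y (prd P A B) (prd P A B) (prod_rel P A \<rho> B \<sigma>) f f"
      by (simp add: equiv_refl[OF e(1)] equiv_refl[OF e(2)])
    assume [simp]: "g \<in> Hom P Y (prd P A B)" 
      and le: "\<gamma> \<le>[P,Y] inst P Y (prd P A B) (prd P A B) (prod_rel P A \<rho> B \<sigma>) f g"
    show "\<gamma> \<le>[P,Y] inst P Y (prd P A B) (prd P A B) (prod_rel P A \<rho> B \<sigma>) g f"
      using le by (simp add: equiv_sym[OF e(1)] equiv_sym[OF e(2)])
    fix h assume [simp]: "h \<in> Hom P Y (prd P A B)"
      and le': "\<gamma> \<le>[P,Y] inst P Y (prd P A B) (prd P A B) (prod_rel P A \<rho> B \<sigma>) g h"
    let ?f = "\<lambda>k. cmp P Y (prd P A B) A (pr1 P A B) k"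
      and ?g = "\<lambda>k. cmp P Y (prd P A B) B (pr2 P A B) k"
    show "\<gamma> \<le>[P,Y] inst P Y (prd P A B) (prd P A B) (prod_rel P A \<rho> B \<sigma>) f h"
      using le le' equiv_trans[OF e(1), of Y "?f f" "?f g" "?f h" \<gamma>]
        equiv_trans[OF e(2), of Y "?g f" "?g g" "?g h" \<gamma>] by simp
  qed simp_all
qed

text \<open>
  A coarser equivalence relation \<open>\<tau>\<close> is automatically compatible with \<open>\<rho>\<close> in both arguments:
  replacing \<open>f\<^sub>1, f\<^sub>2\<close> by \<open>\<rho>\<close>-related elements \<open>g\<^sub>1, g\<^sub>2\<close> gives a chain \<open>g\<^sub>1, f\<^sub>1, f\<^sub>2, g\<^sub>2\<close> of
  \<open>\<tau>\<close>-related ones.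
\<close>

lemma equiv_rel_descent:
  assumes [simp]: "A \<in> Ob P" and e: "equiv_rel P A \<tau>" and [simp]: "\<rho> \<in> carrier (fib P (prd P A A))"
    and ge: "\<rho> \<le>[P,prd P A A] \<tau>"
  shows "\<tau> \<in> descent P (prd P A A) (prod_rel P A \<rho> A \<rho>)"
proof (rule descentI)
  note [simp] = equiv_rel_closed[OF e]
  show "\<tau> \<in> carrier (fib P (prd P A A))" by simp
  fix Y f g \<gamma>
  assume [simp]: "Y \<in> Ob P" "f \<in> Hom P Y (prd P A A)" "g \<in> Hom P Y (prd P A A)"
    "\<gamma> \<in> carrier (fib P Y)"
    and le: "\<gamma> \<le>[P,Y] rei P Y (prd P A A) f \<tau>"
    "\<gamma> \<le>[P,Y] inst P Y (prd P A A) (prd P A A) (prod_rel P A \<rho> A \<rho>) f g"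
  let ?p = "\<lambda>h. cmp P Y (prd P A A) A (pr1 P A A) h"
    and ?q = "\<lambda>h. cmp P Y (prd P A A) A (pr2 P A A) h"
  have eta: "rei P Y (prd P A A) h \<tau> = inst P Y A A \<tau> (?p h) (?q h)" if "h \<in> Hom P Y (prd P A A)"
    for h
    using that by (simp add: inst_def)
  have le': "\<gamma> \<le>[P,Y] inst P Y A A \<tau> (?p f) (?p g)" "\<gamma> \<le>[P,Y] inst P Y A A \<tau> (?q f) (?q g)"
    using le(2) le_inst_mono[OF _ ge] by simp_all
  have "\<gamma> \<le>[P,Y] inst P Y A A \<tau> (?p g) (?p f)"
    by (rule equiv_sym[OF e]) (use le' in simp_all)
  then have "\<gamma> \<le>[P,Y] inst P Y A A \<tau> (?p g) (?q f)"
    by (rule equiv_trans[OF e, rotated 6]) (use le eta in simp_all)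
  then have "\<gamma> \<le>[P,Y] inst P Y A A \<tau> (?p g) (?q g)"
    by (rule equiv_trans[OF e, rotated 6]) (use le' in simp_all)
  then show "\<gamma> \<le>[P,Y] rei P Y (prd P A A) g \<tau>" by (simp add: eta)
qed simp_all

text \<open>
  Pairs with equal components are equal: substitution replaces the first component and then the
  second one.
\<close>

lemma delta_prd:
  assumes [simp]: "A \<in> Ob P" "B \<in> Ob P"
  shows "prod_rel P A (delta P A) B (delta P B) = delta P (prd P A B)"
proof (rule fib_antisym)
  let ?W = "prd P A B" and ?d = "delta P (prd P A B)"
  note [simp] = equiv_delta
  show "?d \<le>[P,prd P ?W ?W] prod_rel P A (delta P A) B (delta P B)"
    by (simp add: delta_le_iff delta_refl)
  show "prod_rel P A (delta P A) B (delta P B) \<le>[P,prd P ?W ?W] ?d"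
  proof (subst le_prd_iff; (intro ballI impI)?)
    fix Y f g \<gamma>
    assume [simp]: "Y \<in> Ob P" "f \<in> Hom P Y ?W" "g \<in> Hom P Y ?W" "\<gamma> \<in> carrier (fib P Y)"
      and le: "\<gamma> \<le>[P,Y] inst P Y ?W ?W (prod_rel P A (delta P A) B (delta P B)) f g"
    let ?f1 = "cmp P Y ?W A (pr1 P A B) f" and ?f2 = "cmp P Y ?W B (pr2 P A B) f"
    let ?g1 = "cmp P Y ?W A (pr1 P A B) g" and ?g2 = "cmp P Y ?W B (pr2 P A B) g"
    \<comment> \<open>\<open>?D(w, a)\<close> says that \<open>w\<close> equals the pair of \<open>a\<close> and the second component of \<open>w\<close>.\<close>
    let ?D = "inst P (prd P ?W A) ?W ?W ?d (pr1 P ?W A) (pairing P (prd P ?W A) A B (pr2 P ?W A)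
      (cmp P (prd P ?W A) ?W B (pr2 P A B) (pr1 P ?W A)))"
    have "\<gamma> \<le>[P,Y] inst P Y ?W A ?D f ?g1"
      by (rule delta_subst[of A ?W Y \<gamma> ?D f ?f1]) (use le delta_refl in simp_all)
    then have 1: "\<gamma> \<le>[P,Y] inst P Y ?W ?W ?d f (pairing P Y A B ?g1 ?f2)" by simp
    let ?V = "prd P (prd P ?W A) B"
    let ?p = "pr1 P (prd P ?W A) B"
    \<comment> \<open>\<open>?E((w, a), b)\<close> says that \<open>w\<close> equals the pair of \<open>a\<close> and \<open>b\<close>.\<close>
    let ?E = "inst P ?V ?W ?W ?d (cmp P ?V (prd P ?W A) ?W (pr1 P ?W A) ?p)
      (pairing P ?V A B (cmp P ?V (prd P ?W A) A (pr2 P ?W A) ?p) (pr2 P (prd P ?W A) B))"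
    have "\<gamma> \<le>[P,Y] inst P Y (prd P ?W A) B ?E (pairing P Y ?W A f ?g1) ?g2"
      by (rule delta_subst[of B "prd P ?W A" Y \<gamma> ?E _ ?f2]) (use le 1 in simp_all)
    then show "\<gamma> \<le>[P,Y] inst P Y ?W ?W ?d f g" by simp
  qed simp_all
qed simp_all

lemma le_kernel_iff:
  assumes [simp]: "A \<in> Ob P" "B \<in> Ob P" "f \<in> Hom P A B" "\<rho> \<in> carrier (fib P (prd P A A))"
    "\<sigma> \<in> carrier (fib P (prd P B B))"
  shows "\<rho> \<le>[P,prd P A A] rei P (prd P A A) (prd P B B) (prod_arrow P A A B B f f) \<sigma> \<longleftrightarrow>
    (\<forall>Y \<in> Ob P. \<forall>u \<in> Hom P Y A. \<forall>v \<in> Hom P Y A. \<forall>\<gamma> \<in> carrier (fib P Y).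
      \<gamma> \<le>[P,Y] inst P Y A A \<rho> u v \<longrightarrow>
      \<gamma> \<le>[P,Y] inst P Y B B \<sigma> (cmp P Y A B f u) (cmp P Y A B f v))"
  by (subst le_prd_iff) simp_all

end

section \<open>The 1-cells and 2-cells of ED\<close>

lemma ED_simps [simp]:
  "cell0 ED = {P. elementary_doctrine P}" "cell1 ED = {F. elementary_map F}"
  "cell2 ED = {\<theta>. elementary_trans \<theta>}"
  "src1 ED = dom_d" "tgt1 ED = cod_d" "src2 ED = dom_m" "tgt2 ED = cod_m"
  "one1 ED = id_map" "one2 ED = id_trans"
  "comp1 ED = comp_map" "vcomp ED = vcomp_trans" "hcomp ED = hcomp_trans"
  by (simp_all add: ED_def)

locale ed_hom =
  fixes P R :: "('o, 'm, 'p) doctrine" and F :: "('o, 'm, 'p) doctrine_map"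
  assumes hom1: "F \<in> hom1 ED P R"
begin

lemma dom [simp]: "dom_d F = P" and cod [simp]: "cod_d F = R" and map: "elementary_map F"
  using hom1 unfolding hom1_def by simp_all

sublocale P: elementary_doctrine P using map unfolding elementary_map_def by simp
sublocale R: elementary_doctrine R using map unfolding elementary_map_def by simp

lemma omap_ext: "omap F \<in> Ob P \<rightarrow>\<^sub>E Ob R"
  using elementary_map.omap[OF map] by simp

lemma amap_ext: "amap F \<in> (\<Pi>\<^sub>E A \<in> Ob P. \<Pi>\<^sub>E B \<in> Ob P. Hom P A B \<rightarrow>\<^sub>E Hom R (omap F A) (omap F B))"
  using elementary_map.amap[OF map] by simp

lemma fmap_ext: "fmap F \<in> (\<Pi>\<^sub>E A \<in> Ob P. carrier (fib P A) \<rightarrow>\<^sub>E carrier (fib R (omap F A)))"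
  using elementary_map.fmap[OF map] by simp

lemma omap_Ob [simp]: "A \<in> Ob P \<Longrightarrow> omap F A \<in> Ob R"
  using omap_ext by blast

lemma amap_Hom [simp]: "\<lbrakk>A \<in> Ob P; B \<in> Ob P; f \<in> Hom P A B\<rbrakk> \<Longrightarrow> amap F A B f \<in>
  Hom R (omap F A) (omap F B)"
  using amap_ext by (blast dest: PiE_mem)

lemma fmap_closed [simp]: "\<lbrakk>A \<in> Ob P; \<alpha> \<in> carrier (fib P A)\<rbrakk> \<Longrightarrow> fmap F A \<alpha> \<in>
  carrier (fib R (omap F A))"
  using fmap_ext by (blast dest: PiE_mem)

lemma amap_idn [simp]: "A \<in> Ob P \<Longrightarrow> amap F A A (idn P A) = idn R (omap F A)"
  using elementary_map.amap_idn[OF map] by simp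

lemma amap_cmp [simp]: "\<lbrakk>A \<in> Ob P; B \<in> Ob P; D \<in> Ob P; f \<in> Hom P A B; g \<in> Hom P B D\<rbrakk> \<Longrightarrow>
    amap F A D (cmp P A B D g f) = cmp R (omap F A) (omap F B) (omap F D) (amap F B D g)
      (amap F A B f)"
  using elementary_map.amap_cmp[OF map] by simp

lemma preserves_products: "\<lbrakk>A \<in> Ob P; B \<in> Ob P; is_product P A B W p q\<rbrakk> \<Longrightarrow>
    is_product R (omap F A) (omap F B) (omap F W) (amap F W A p) (amap F W B q)"
  using elementary_map.preserves_products[OF map] by simp

lemma fmap_natural: "\<lbrakk>A \<in> Ob P; B \<in> Ob P; f \<in> Hom P A B; \<alpha> \<in> carrier (fib P B)\<rbrakk> \<Longrightarrow>
    fmap F A (rei P A B f \<alpha>) = rei R (omap F A) (omap F B) (amap F A B f) (fmap F B \<alpha>)"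
  using elementary_map.fmap_natural[OF map] by simp

lemma fmap_meets: "A \<in> Ob P \<Longrightarrow> preserves_finite_meets (fib P A) (fib R (omap F A)) (fmap F A)"
  using elementary_map.fmap_meets[OF map] by simp

lemma fmap_delta: "A \<in> Ob P \<Longrightarrow> fmap F (prd P A A) (delta P A) =
    inst R (omap F (prd P A A)) (omap F A) (omap F A) (delta R (omap F A))
      (amap F (prd P A A) A (pr1 P A A)) (amap F (prd P A A) A (pr2 P A A))"
  using elementary_map.fmap_delta[OF map, of A] unfolding comparison_def Let_def inst_def by simp

lemma product_image: "\<lbrakk>A \<in> Ob P; B \<in> Ob P\<rbrakk> \<Longrightarrow>
    is_product R (omap F A) (omap F B) (omap F (prd P A B))
      (amap F (prd P A B) A (pr1 P A B)) (amap F (prd P A B) B (pr2 P A B))"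
  by (rule preserves_products[OF _ _ P.prd])

lemma amap_pr1_pairing [simp]:
  "\<lbrakk>Y \<in> Ob P; A \<in> Ob P; B \<in> Ob P; f \<in> Hom P Y A; g \<in> Hom P Y B\<rbrakk> \<Longrightarrow>
    cmp R (omap F Y) (omap F (prd P A B)) (omap F A) (amap F (prd P A B) A (pr1 P A B))
      (amap F Y (prd P A B) (pairing P Y A B f g)) = amap F Y A f"
  and amap_pr2_pairing [simp]:
  "\<lbrakk>Y \<in> Ob P; A \<in> Ob P; B \<in> Ob P; f \<in> Hom P Y A; g \<in> Hom P Y B\<rbrakk> \<Longrightarrow>
    cmp R (omap F Y) (omap F (prd P A B)) (omap F B) (amap F (prd P A B) B (pr2 P A B))
      (amap F Y (prd P A B) (pairing P Y A B f g)) = amap F Y B g"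
  by (simp_all flip: amap_cmp)

lemma fmap_mono: "\<lbrakk>x \<le>[P,A] y; A \<in> Ob P; x \<in> carrier (fib P A); y \<in> carrier (fib P A)\<rbrakk> \<Longrightarrow>
    fmap F A x \<le>[R,omap F A] fmap F A y"
  by (rule preserves_finite_meets_mono[OF fmap_meets P.fib R.fib]) simp_all

lemma fmap_meet [simp]: "\<lbrakk>A \<in> Ob P; x \<in> carrier (fib P A); y \<in> carrier (fib P A)\<rbrakk> \<Longrightarrow>
    fmap F A (x \<sqinter>\<^bsub>fib P A\<^esub> y) = fmap F A x \<sqinter>\<^bsub>fib R (omap F A)\<^esub> fmap F A y"
  by (rule preserves_finite_meets_meet[OF fmap_meets])

lemma fmap_top:
  assumes "A \<in> Ob P" "x \<in> carrier (fib P A)" "\<And>z. z \<in> carrier (fib P A) \<Longrightarrow> z \<le>[P,A] x"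
    "\<gamma> \<in> carrier (fib R (omap F A))"
  shows "\<gamma> \<le>[R,omap F A] fmap F A x"
  by (rule preserves_finite_meets_top[OF fmap_meets P.fib R.fib]) (use assms in simp_all)

end

text \<open>
  The families \<open>S\<close> and \<open>T\<close> of codomains may differ: two functors are compared before it is known
  that they agree on objects.
\<close>

lemma PiE_eqI: "\<lbrakk>f \<in> Pi\<^sub>E I S; g \<in> Pi\<^sub>E I T; \<And>i. i \<in> I \<Longrightarrow> f i = g i\<rbrakk> \<Longrightarrow> f = g"
  by (rule extensionalityI[of _ I]) (auto simp: PiE_def)

lemma ed_hom_eqI:
  assumes F: "F \<in> hom1 ED P R" and G: "G \<in> hom1 ED P R"
    and o: "\<And>A. A \<in> Ob P \<Longrightarrow> omap F A = omap G A"
    and a: "\<And>A B f. \<lbrakk>A \<in> Ob P; B \<in> Ob P; f \<in> Hom P A B\<rbrakk> \<Longrightarrow> amap F A B f = amap G A B f"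
    and f: "\<And>A \<alpha>. \<lbrakk>A \<in> Ob P; \<alpha> \<in> carrier (fib P A)\<rbrakk> \<Longrightarrow> fmap F A \<alpha> = fmap G A \<alpha>"
  shows "F = G"
proof -
  interpret F: ed_hom P R F by standard (rule F)
  interpret G: ed_hom P R G by standard (rule G)
  note F_amap = PiE_mem[OF F.amap_ext] and G_amap = PiE_mem[OF G.amap_ext]
  have "omap F = omap G" by (rule PiE_eqI[OF F.omap_ext G.omap_ext o])
  moreover have "amap F = amap G"
    by (intro PiE_eqI[OF F.amap_ext G.amap_ext] PiE_eqI[OF F_amap G_amap]
        PiE_eqI[OF PiE_mem[OF F_amap] PiE_mem[OF G_amap]] a)
  moreover have "fmap F = fmap G"
    by (intro PiE_eqI[OF F.fmap_ext G.fmap_ext] PiE_eqI[OF PiE_mem[OF F.fmap_ext]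
      PiE_mem[OF G.fmap_ext]] f)
  ultimately show ?thesis using F.dom G.dom F.cod G.cod by (intro doctrine_map.equality) simp_all
qed

text \<open>
  To preserve all products it is enough to preserve the chosen ones, since any other product is
  isomorphic to a chosen one and functors preserve isomorphisms.
\<close>

lemma ed_homI:
  assumes P: "elementary_doctrine P" and R: "elementary_doctrine R"
    and dc: "dom_d F = P" "cod_d F = R"
    and omap: "omap F \<in> Ob P \<rightarrow>\<^sub>E Ob R"
    and amap: "amap F \<in> (\<Pi>\<^sub>E A \<in> Ob P. \<Pi>\<^sub>E B \<in> Ob P. Hom P A B \<rightarrow>\<^sub>E Hom R (omap F A) (omap F B))"
    and amap_idn: "\<And>A. A \<in> Ob P \<Longrightarrow> amap F A A (idn P A) = idn R (omap F A)"
    and amap_cmp: "\<And>A B D f g. \<lbrakk>A \<in> Ob P; B \<in> Ob P; D \<in> Ob P; f \<in> Hom P A B; g \<in> Hom P B D\<rbrakk> \<Longrightarrow>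
      amap F A D (cmp P A B D g f) =
        cmp R (omap F A) (omap F B) (omap F D) (amap F B D g) (amap F A B f)"
    and product_image: "\<And>A B. \<lbrakk>A \<in> Ob P; B \<in> Ob P\<rbrakk> \<Longrightarrow>
      is_product R (omap F A) (omap F B) (omap F (prd P A B))
        (amap F (prd P A B) A (pr1 P A B)) (amap F (prd P A B) B (pr2 P A B))"
    and fmap: "fmap F \<in> (\<Pi>\<^sub>E A \<in> Ob P. carrier (fib P A) \<rightarrow>\<^sub>E carrier (fib R (omap F A)))"
    and fmap_natural: "\<And>A B f \<alpha>. \<lbrakk>A \<in> Ob P; B \<in> Ob P; f \<in> Hom P A B; \<alpha> \<in> carrier (fib P B)\<rbrakk> \<Longrightarrow>
      fmap F A (rei P A B f \<alpha>) = rei R (omap F A) (omap F B) (amap F A B f) (fmap F B \<alpha>)"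
    and fmap_meets: "\<And>A. A \<in> Ob P \<Longrightarrow> preserves_finite_meets (fib P A) (fib R (omap F A)) (fmap F A)"
    and fmap_delta: "\<And>A. A \<in> Ob P \<Longrightarrow> fmap F (prd P A A) (delta P A) =
      inst R (omap F (prd P A A)) (omap F A) (omap F A) (delta R (omap F A))
        (amap F (prd P A A) A (pr1 P A A)) (amap F (prd P A A) A (pr2 P A A))"
  shows "F \<in> hom1 ED P R"
proof -
  interpret P: elementary_doctrine P by (rule P)
  interpret R: elementary_doctrine R by (rule R)
  have [simp]: "A \<in> Ob P \<Longrightarrow> omap F A \<in> Ob R" for A using omap by blast
  have [simp]: "\<lbrakk>A \<in> Ob P; B \<in> Ob P; f \<in> Hom P A B\<rbrakk> \<Longrightarrow> amap F A B f \<in> Hom R (omap F A) (omap F B)"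
    for A B f
    using amap by (blast dest: PiE_mem)
  have pp: "is_product R (omap F A) (omap F B) (omap F W) (amap F W A p) (amap F W B q)"
    if A [simp]: "A \<in> Ob P" "B \<in> Ob P" and W: "is_product P A B W p q" for A B W p q
  proof -
    note [simp] = is_productD[OF W]
    let ?i = "pairing P W A B p q"
    obtain j where j [simp]: "j \<in> Hom P (prd P A B) W"
      and ji: "cmp P W (prd P A B) W j ?i = idn P W"
      and ij: "cmp P (prd P A B) W (prd P A B) ?i j = idn P (prd P A B)"
      by (rule P.product_comparison_iso[OF W A])
    have "is_product R (omap F A) (omap F B) (omap F W)
      (cmp R (omap F W) (omap F (prd P A B)) (omap F A) (amap F (prd P A B) A (pr1 P A B))
        (amap F W (prd P A B) ?i))
      (cmp R (omap F W) (omap F (prd P A B)) (omap F B) (amap F (prd P A B) B (pr2 P A B))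
        (amap F W (prd P A B) ?i))"
      by (rule R.is_product_iso[OF product_image, where j = "amap F (prd P A B) W j"])
        (simp_all add: ij ji amap_idn flip: amap_cmp)
    then show ?thesis by (simp flip: amap_cmp)
  qed
  have "elementary_map F"
    unfolding elementary_map_def elementary_map_axioms_def dc
    using P R omap amap amap_idn amap_cmp pp fmap fmap_natural fmap_meets fmap_delta
    unfolding inst_def comparison_def Let_def dc by simp
  then show ?thesis unfolding hom1_def using dc by simp
qed

locale ed_cell = F: ed_hom P R F + G: ed_hom P R G
  for P R :: "('o, 'm, 'p) doctrine" and F G :: "('o, 'm, 'p) doctrine_map" +
  fixes \<theta> :: "('o, 'm, 'p) doctrine_trans"
  assumes hom2: "\<theta> \<in> hom2 ED F G"
begin

lemma src [simp]: "dom_m \<theta> = F" and tgt [simp]: "cod_m \<theta> = G" and trans: "elementary_trans \<theta>"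
  using hom2 unfolding hom2_def by simp_all

lemma component_ext: "component \<theta> \<in> (\<Pi>\<^sub>E A \<in> Ob P. Hom R (omap F A) (omap G A))"
  using elementary_trans.component[OF trans] by simp

lemma component_Hom [simp]: "A \<in> Ob P \<Longrightarrow> component \<theta> A \<in> Hom R (omap F A) (omap G A)"
  using component_ext by blast

lemma natural: "\<lbrakk>A \<in> Ob P; B \<in> Ob P; f \<in> Hom P A B\<rbrakk> \<Longrightarrow>
    cmp R (omap F A) (omap F B) (omap G B) (component \<theta> B) (amap F A B f) =
    cmp R (omap F A) (omap G A) (omap G B) (amap G A B f) (component \<theta> A)"
  using elementary_trans.natural[OF trans] by simp

lemma fmap_le: "\<lbrakk>A \<in> Ob P; \<alpha> \<in> carrier (fib P A)\<rbrakk> \<Longrightarrow>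
    fmap F A \<alpha> \<le>[R,omap F A] rei R (omap F A) (omap G A) (component \<theta> A) (fmap G A \<alpha>)"
  using elementary_trans.fmap_le[OF trans] by simp

end

lemma ed_cellI:
  assumes F: "F \<in> hom1 ED P R" and G: "G \<in> hom1 ED P R" and st: "dom_m \<theta> = F" "cod_m \<theta> = G"
    and "component \<theta> \<in> (\<Pi>\<^sub>E A \<in> Ob P. Hom R (omap F A) (omap G A))"
    and "\<And>A B f. \<lbrakk>A \<in> Ob P; B \<in> Ob P; f \<in> Hom P A B\<rbrakk> \<Longrightarrow>
      cmp R (omap F A) (omap F B) (omap G B) (component \<theta> B) (amap F A B f) =
      cmp R (omap F A) (omap G A) (omap G B) (amap G A B f) (component \<theta> A)"
    and "\<And>A \<alpha>. \<lbrakk>A \<in> Ob P; \<alpha> \<in> carrier (fib P A)\<rbrakk> \<Longrightarrow>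
      fmap F A \<alpha> \<le>[R,omap F A] rei R (omap F A) (omap G A) (component \<theta> A) (fmap G A \<alpha>)"
  shows "\<theta> \<in> hom2 ED F G"
proof -
  interpret F: ed_hom P R F by standard (rule F)
  interpret G: ed_hom P R G by standard (rule G)
  have "elementary_trans \<theta>"
    unfolding elementary_trans_def elementary_trans_axioms_def st
    using assms(5-7) F.map G.map by simp
  then show ?thesis unfolding hom2_def using st by simp
qed

lemma ed_cell_eqI:
  assumes "\<theta> \<in> hom2 ED F G" "\<phi> \<in> hom2 ED F G" and F: "F \<in> hom1 ED P R"
    and c: "\<And>A. A \<in> Ob P \<Longrightarrow> component \<theta> A = component \<phi> A"
  shows "\<theta> = \<phi>"
proof -
  interpret F: ed_hom P R F by standard (rule F)
  have st: "dom_m \<theta> = F" "cod_m \<theta> = G" "dom_m \<phi> = F" "cod_m \<phi> = G"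
    and t: "elementary_trans \<theta>" "elementary_trans \<phi>"
    using assms unfolding hom2_def by simp_all
  have "component \<theta> = component \<phi>"
    by (rule PiE_eqI[OF elementary_trans.component[OF t(1), unfolded st]
      elementary_trans.component[OF t(2), unfolded st]])
      (use c st in simp)
  then show ?thesis using st by (intro doctrine_trans.equality) simp_all
qed

section \<open>The quotient completion of an elementary doctrine\<close>

lemma quotient_doctrine_simps [simp]:
  "idn (quotient_doctrine e P) X = idn P (under e X)"
  "cmp (quotient_doctrine e P) X Y Z = cmp P (under e X) (under e Y) (under e Z)"
  "pr1 (quotient_doctrine e P) X Y = pr1 P (under e X) (under e Y)"
  "pr2 (quotient_doctrine e P) X Y = pr2 P (under e X) (under e Y)"
  "rei (quotient_doctrine e P) X Y = rei P (under e X) (under e Y)"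
  "carrier (fib (quotient_doctrine e P) X) = descent P (under e X) (rel e X)"
  "le (fib (quotient_doctrine e P) X) = le (fib P (under e X))"
  by (simp_all add: quotient_doctrine_def)

locale quotient_completion = elementary_doctrine P for P :: "('o, 'm, 'p) doctrine" +
  fixes e :: "'o \<times> 'p \<Rightarrow> 'o"
  assumes inj_e: "inj e"
begin

abbreviation "Q \<equiv> quotient_doctrine e P"
abbreviation "U \<equiv> under e"
abbreviation "r \<equiv> rel e"

lemma U_e [simp]: "U (e (A, \<rho>)) = A" and r_e [simp]: "r (e (A, \<rho>)) = \<rho>"
  using inj_e by (simp_all add: under_def rel_def)

lemma Q_Ob_iff: "X \<in> Ob Q \<longleftrightarrow> U X \<in> Ob P \<and> equiv_rel P (U X) (r X) \<and> e (U X, r X) = X"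
proof
  show "X \<in> Ob Q \<Longrightarrow> U X \<in> Ob P \<and> equiv_rel P (U X) (r X) \<and> e (U X, r X) = X"
    unfolding quotient_doctrine_def by auto
  assume "U X \<in> Ob P \<and> equiv_rel P (U X) (r X) \<and> e (U X, r X) = X"
  then have "\<exists>A \<rho>. X = e (A, \<rho>) \<and> A \<in> Ob P \<and> equiv_rel P A \<rho>"
    by (intro exI[of _ "U X"] exI[of _ "r X"]) simp
  then show "X \<in> Ob Q" unfolding quotient_doctrine_def by simp
qed

lemma e_Ob [simp]: "\<lbrakk>A \<in> Ob P; equiv_rel P A \<rho>\<rbrakk> \<Longrightarrow> e (A, \<rho>) \<in> Ob Q"
  unfolding Q_Ob_iff by simp

lemma U_Ob [simp]: "X \<in> Ob Q \<Longrightarrow> U X \<in> Ob P"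
  and r_equiv: "X \<in> Ob Q \<Longrightarrow> equiv_rel P (U X) (r X)"
  and e_U_r [simp]: "X \<in> Ob Q \<Longrightarrow> e (U X, r X) = X"
  unfolding Q_Ob_iff by simp_all

lemma r_closed [simp]: "X \<in> Ob Q \<Longrightarrow> r X \<in> carrier (fib P (prd P (U X) (U X)))"
  by (rule equiv_rel_closed[OF r_equiv])

lemma Q_eqI: "\<lbrakk>X \<in> Ob Q; Y \<in> Ob Q; U X = U Y; r X = r Y\<rbrakk> \<Longrightarrow> X = Y"
  by (metis e_U_r)

lemma Q_prd [simp]: "U (prd Q X Y) = prd P (U X) (U Y)"
  "r (prd Q X Y) = prod_rel P (U X) (r X) (U Y) (r Y)"
  by (simp_all add: quotient_doctrine_def)

lemma Q_prd_Ob [simp]: "\<lbrakk>X \<in> Ob Q; Y \<in> Ob Q\<rbrakk> \<Longrightarrow> prd Q X Y \<in> Ob Q"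
proof -
  have "prd Q X Y = e (prd P (U X) (U Y), prod_rel P (U X) (r X) (U Y) (r Y))"
    unfolding quotient_doctrine_def by simp
  moreover assume "X \<in> Ob Q" "Y \<in> Ob Q"
  ultimately show ?thesis by (simp add: equiv_prod_rel r_equiv)
qed

lemma Q_Hom_iff: "f \<in> Hom Q X Y \<longleftrightarrow> f \<in> Hom P (U X) (U Y) \<and> r X \<le>[P,prd P (U X) (U X)]
    rei P (prd P (U X) (U X)) (prd P (U Y) (U Y)) (prod_arrow P (U X) (U X) (U Y) (U Y) f f) (r Y)"
  unfolding quotient_doctrine_def by (simp add: Let_def)

lemma Q_HomD: "f \<in> Hom Q X Y \<Longrightarrow> f \<in> Hom P (U X) (U Y)"
  unfolding Q_Hom_iff by simp

lemma Q_HomI: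
  assumes "X \<in> Ob Q" "Y \<in> Ob Q" "f \<in> Hom P (U X) (U Y)"
    and "\<And>Z u v \<gamma>. \<lbrakk>Z \<in> Ob P; u \<in> Hom P Z (U X); v \<in> Hom P Z (U X); \<gamma> \<in> carrier (fib P Z);
      \<gamma> \<le>[P,Z] inst P Z (U X) (U X) (r X) u v\<rbrakk> \<Longrightarrow>
      \<gamma> \<le>[P,Z] inst P Z (U Y) (U Y) (r Y) (cmp P Z (U X) (U Y) f u) (cmp P Z (U X) (U Y) f v)"
  shows "f \<in> Hom Q X Y"
  unfolding Q_Hom_iff
proof (intro conjI assms(3))
  show "r X \<le>[P,prd P (U X) (U X)]
    rei P (prd P (U X) (U X)) (prd P (U Y) (U Y)) (prod_arrow P (U X) (U X) (U Y) (U Y) f f) (r Y)"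
  proof (rule iffD2[OF le_kernel_iff])
    show "\<forall>Z \<in> Ob P. \<forall>u \<in> Hom P Z (U X). \<forall>v \<in> Hom P Z (U X). \<forall>\<gamma> \<in> carrier (fib P Z).
      \<gamma> \<le>[P,Z] inst P Z (U X) (U X) (r X) u v \<longrightarrow>
      \<gamma> \<le>[P,Z] inst P Z (U Y) (U Y) (r Y) (cmp P Z (U X) (U Y) f u) (cmp P Z (U X) (U Y) f v)"
      by (intro ballI impI assms(4))
  qed (use assms(1-3) in simp_all)
qed

lemma Q_Hom_resp:
  assumes "f \<in> Hom Q X Y" "X \<in> Ob Q" "Y \<in> Ob Q" "Z \<in> Ob P" "u \<in> Hom P Z (U X)" "v \<in> Hom P Z (U X)"
    "\<gamma> \<in> carrier (fib P Z)" "\<gamma> \<le>[P,Z] inst P Z (U X) (U X) (r X) u v"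
  shows "\<gamma> \<le>[P,Z] inst P Z (U Y) (U Y) (r Y) (cmp P Z (U X) (U Y) f u) (cmp P Z (U X) (U Y) f v)"
proof -
  have "r X \<le>[P,prd P (U X) (U X)]
    rei P (prd P (U X) (U X)) (prd P (U Y) (U Y)) (prod_arrow P (U X) (U X) (U Y) (U Y) f f) (r Y)"
    using assms(1) unfolding Q_Hom_iff by blast
  then show ?thesis
    using le_kernel_iff[of "U X" "U Y" f "r X" "r Y"] Q_HomD[OF assms(1)] assms(2-8)
    by (simp del: rei_prod_arrow)
qed

sublocale Q: category Q
proof
  fix X Y Z W f g h
  assume X: "X \<in> Ob Q"
  show "idn Q X \<in> Hom Q X X" by (rule Q_HomI) (use X in simp_all)
  assume Y: "Y \<in> Ob Q"
  show "cmp Q X Y Y (idn Q Y) f = f" if "f \<in> Hom Q X Y" using Q_HomD[OF that] X Y by simp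
  show "cmp Q X X Y f (idn Q X) = f" if "f \<in> Hom Q X Y" using Q_HomD[OF that] X Y by simp
  assume Z: "Z \<in> Ob Q" and f: "f \<in> Hom Q X Y" and g: "g \<in> Hom Q Y Z"
  note [simp] = X Y Z Q_HomD[OF f] Q_HomD[OF g]
  show "cmp Q X Y Z g f \<in> Hom Q X Z"
  proof (rule Q_HomI)
    fix V u v \<gamma>
    assume V [simp]: "V \<in> Ob P" "u \<in> Hom P V (U X)" "v \<in> Hom P V (U X)" "\<gamma> \<in> carrier (fib P V)"
      and le: "\<gamma> \<le>[P,V] inst P V (U X) (U X) (r X) u v"
    show "\<gamma> \<le>[P,V] inst P V (U Z) (U Z) (r Z)
      (cmp P V (U X) (U Z) (cmp Q X Y Z g f) u) (cmp P V (U X) (U Z) (cmp Q X Y Z g f) v)"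
      using Q_Hom_resp[OF g Y Z V(1) _ _ V(4) Q_Hom_resp[OF f X Y V le]] by simp
  qed simp_all
  assume W: "W \<in> Ob Q" and h: "h \<in> Hom Q Z W"
  show "cmp Q X Y W (cmp Q Y Z W h g) f = cmp Q X Z W h (cmp Q X Y Z g f)"
    using Q_HomD[OF h] W by simp
qed

lemma Q_pairing_Hom:
  assumes ob: "Y \<in> Ob Q" "A \<in> Ob Q" "B \<in> Ob Q" and f: "f \<in> Hom Q Y A" and g: "g \<in> Hom Q Y B"
  shows "pairing P (U Y) (U A) (U B) f g \<in> Hom Q Y (prd Q A B)"
proof -
  note [simp] = ob Q_HomD[OF f] Q_HomD[OF g]
  show ?thesis
    by (rule Q_HomI) (simp_all add: Q_Hom_resp[OF f] Q_Hom_resp[OF g])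
qed

sublocale Q: product_category Q
proof
  fix A B assume ob [simp]: "A \<in> Ob Q" "B \<in> Ob Q"
  show "is_product Q A B (prd Q A B) (pr1 Q A B) (pr2 Q A B)"
    unfolding is_product_def
  proof (intro conjI ballI)
    show "prd Q A B \<in> Ob Q" by simp
    show "pr1 Q A B \<in> Hom Q (prd Q A B) A" "pr2 Q A B \<in> Hom Q (prd Q A B) B"
      by (rule Q_HomI; simp)+
    fix Y f g assume Y: "Y \<in> Ob Q" and f: "f \<in> Hom Q Y A" and g: "g \<in> Hom Q Y B"
    note [simp] = Y Q_HomD[OF f] Q_HomD[OF g]
    show "\<exists>!h. h \<in> Hom Q Y (prd Q A B) \<and> cmp Q Y (prd Q A B) A (pr1 Q A B) h = f \<and>
        cmp Q Y (prd Q A B) B (pr2 Q A B) h = g"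
    proof (rule ex1I[of _ "pairing P (U Y) (U A) (U B) f g"])
      fix h assume h: "h \<in> Hom Q Y (prd Q A B) \<and> cmp Q Y (prd Q A B) A (pr1 Q A B) h = f \<and>
        cmp Q Y (prd Q A B) B (pr2 Q A B) h = g"
      then have [simp]: "h \<in> Hom P (U Y) (prd P (U A) (U B))" using Q_HomD[of h Y "prd Q A B"]
        by simp
      show "h = pairing P (U Y) (U A) (U B) f g"
        by (rule pairing_unique[symmetric]) (use h in simp_all)
    qed (use Q_pairing_Hom[OF Y ob f g] in simp)
  qed
qed

lemma Q_pairing [simp]:
  assumes ob: "Y \<in> Ob Q" "A \<in> Ob Q" "B \<in> Ob Q" and f: "f \<in> Hom Q Y A" and g: "g \<in> Hom Q Y B"
  shows "pairing Q Y A B f g = pairing P (U Y) (U A) (U B) f g"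
  by (rule Q.pairing_unique[OF ob Q_pairing_Hom[OF assms]])
    (use Q_HomD[OF f] Q_HomD[OF g] ob in simp_all)

lemma Q_fib: "fib Q X = (fib P (U X))\<lparr>carrier := descent P (U X) (r X)\<rparr>"
  unfolding quotient_doctrine_def by simp

text \<open>
  An arrow of quotients sends related elements to related elements, which a descent datum on the
  codomain cannot tell apart.
\<close>

lemma Q_rei_descent:
  assumes X: "X \<in> Ob Q" and Y: "Y \<in> Ob Q" and f: "f \<in> Hom Q X Y" and \<alpha>: "\<alpha> \<in> descent P (U Y) (r Y)"
  shows "rei P (U X) (U Y) f \<alpha> \<in> descent P (U X) (r X)"
proof -
  note [simp] = X Y Q_HomD[OF f] descent_closed[OF \<alpha>]
  show ?thesis
  proof (rule descentI)
    fix Z u v \<gamma>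
    assume Z [simp]: "Z \<in> Ob P" "u \<in> Hom P Z (U X)" "v \<in> Hom P Z (U X)" "\<gamma> \<in> carrier (fib P Z)"
      and le: "\<gamma> \<le>[P,Z] rei P Z (U X) u (rei P (U X) (U Y) f \<alpha>)"
      "\<gamma> \<le>[P,Z] inst P Z (U X) (U X) (r X) u v"
    show "\<gamma> \<le>[P,Z] rei P Z (U X) v (rei P (U X) (U Y) f \<alpha>)"
      using descent_subst[OF \<alpha> _ _ _ _ _ _ _ Q_Hom_resp[OF f X Y Z le(2)]] le(1) by simp
  qed simp_all
qed

lemma descent_subset: "descent P A \<rho> \<subseteq> carrier (fib P A)"
  using descent_closed by blast

sublocale Q: doctrine Q
proof (rule doctrine.intro[OF Q.product_category_axioms doctrine_axioms.intro])
  show "inf_semilattice (fib Q X)" if X: "X \<in> Ob Q" for X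
    unfolding Q_fib
    by (rule inf_semilattice.subset_finite_meets(1)[OF fib descent_subset descent_Inf])
      (use X in simp_all)
  show "preserves_finite_meets (fib Q Y) (fib Q X) (rei Q X Y f)"
    if X: "X \<in> Ob Q" and Y: "Y \<in> Ob Q" and f: "f \<in> Hom Q X Y" for X Y f
    unfolding Q_fib quotient_doctrine_simps
    by (rule preserves_finite_meets_restrict[OF rei_meets fib fib descent_subset descent_Inf
          descent_subset descent_Inf Q_rei_descent[OF X Y f]])
      (use X Y Q_HomD[OF f] in simp_all)
  show "rei Q X X (idn Q X) \<alpha> = \<alpha>" if "X \<in> Ob Q" "\<alpha> \<in> carrier (fib Q X)" for X \<alpha>
    using that descent_closed[of \<alpha>] by simp
  show "rei Q X Z (cmp Q X Y Z g f) \<alpha> = rei Q X Y f (rei Q Y Z g \<alpha>)"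
    if "X \<in> Ob Q" "Y \<in> Ob Q" "Z \<in> Ob Q" "f \<in> Hom Q X Y" "g \<in> Hom Q Y Z" "\<alpha> \<in> carrier (fib Q Z)"
    for X Y Z f g \<alpha>
    using that Q_HomD[of f X Y] Q_HomD[of g Y Z] descent_closed[of \<alpha>] by simp
qed

lemma Q_inst [simp]:
  assumes "Y \<in> Ob Q" "A \<in> Ob Q" "B \<in> Ob Q" "f \<in> Hom Q Y A" "g \<in> Hom Q Y B"
  shows "inst Q Y A B \<rho> f g = inst P (U Y) (U A) (U B) \<rho> f g"
  unfolding inst_def using assms by simp

text \<open>
  The relation \<open>\<rho>\<close> plays the role of equality on \<open>(A, \<rho>)\<close>: substitution holds for \<open>\<rho>\<close> because the
  predicates in question are descent data.
\<close>

lemma Q_is_delta: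
  assumes X [simp]: "X \<in> Ob Q"
  shows "is_delta Q X (r X)"
proof (rule Q.is_deltaI)
  note e = r_equiv[OF X]
  \<comment> \<open>A descent datum on a product admits substitution of related elements in its second argument.\<close>
  have des: "\<gamma> \<le>[P,U Y] inst P (U Y) (U A) (U B) \<beta> f g'"
    if [simp]: "Y \<in> Ob Q" "A \<in> Ob Q" "B \<in> Ob Q" and \<beta>: "\<beta> \<in> carrier (fib Q (prd Q A B))"
      and f: "f \<in> Hom Q Y A"
      and g: "g \<in> Hom Q Y B" "g' \<in> Hom Q Y B" and [simp]: "\<gamma> \<in> carrier (fib P (U Y))"
      and le: "\<gamma> \<le>[P,U Y] inst P (U Y) (U A) (U B) \<beta> f g"
      "\<gamma> \<le>[P,U Y] inst P (U Y) (U B) (U B) (r B) g g'" for Y A B \<beta> f g g' \<gamma>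
  proof -
    note [simp] = Q_HomD[OF f] Q_HomD[OF g(1)] Q_HomD[OF g(2)]
    have [simp]: "\<beta> \<in> descent P (prd P (U A) (U B)) (prod_rel P (U A) (r A) (U B) (r B))" using \<beta>
      by simp
    show ?thesis
      unfolding inst_def
      by (rule descent_subst[of \<beta> "prd P (U A) (U B)" "prod_rel P (U A) (r A) (U B) (r B)" "U Y"
            "pairing P (U Y) (U A) (U B) f g"])
        (use le equiv_refl[OF r_equiv] in \<open>simp_all add: inst_def[symmetric]\<close>)
  qed
  show "r X \<in> carrier (fib Q (prd Q X X))" using equiv_rel_descent[OF _ e] by simp
  show "\<gamma> \<le>[Q,X] inst Q X X X (r X) (idn Q X) (idn Q X)" if "\<gamma> \<in> carrier (fib Q X)" for \<gamma>
    using that descent_closed[of \<gamma> "U X" "r X"] Q.idn_Hom[OF X] by (simp add: equiv_refl[OF e])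
  show "\<gamma> \<le>[Q,Y] inst Q Y X X \<beta> f g"
    if "Y \<in> Ob Q" "\<gamma> \<in> carrier (fib Q Y)" "\<beta> \<in> carrier (fib Q (prd Q X X))" "f \<in> Hom Q Y X"
      "g \<in> Hom Q Y X"
    and "\<gamma> \<le>[Q,Y] inst Q Y X X (r X) f g" "\<gamma> \<le>[Q,Y] inst Q Y X X \<beta> f f" for Y \<gamma> \<beta> f g
    using des[OF that(1) X X that(3) that(4,4,5)] descent_closed[of \<gamma> "U Y" "r Y"] that by simp
  show "\<gamma> \<le>[Q,Y] inst Q Y (prd Q A X) X \<beta> u g"
    if "A \<in> Ob Q" "Y \<in> Ob Q" "\<gamma> \<in> carrier (fib Q Y)" "\<beta> \<in> carrier (fib Q (prd Q (prd Q A X) X))"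
      "u \<in> Hom Q Y (prd Q A X)" "g \<in> Hom Q Y X"
      and le: "\<gamma> \<le>[Q,Y] inst Q Y X X (r X) (cmp Q Y (prd Q A X) X (pr2 Q A X) u) g"
      "\<gamma> \<le>[Q,Y] inst Q Y (prd Q A X) X \<beta> u (cmp Q Y (prd Q A X) X (pr2 Q A X) u)"
    for A Y \<gamma> \<beta> u g
  proof -
    have h: "cmp Q Y (prd Q A X) X (pr2 Q A X) u \<in> Hom Q Y X" 
      using that(1,2,5) by (intro Q.cmp_Hom Q.pr2_Hom Q_prd_Ob) simp_all
    have A2: "prd Q A X \<in> Ob Q" using that by simp
    have "\<gamma> \<in> carrier (fib P (U Y))" using that descent_closed[of \<gamma> "U Y" "r Y"] by simp
    from des[OF that(2) A2 X that(4,5) h that(6) this] show ?thesis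
      using le unfolding Q_inst[OF that(2) X X h that(6)] Q_inst[OF that(2) A2 X that(5) h]
        Q_inst[OF that(2) A2 X that(5,6)] by simp
  qed
qed simp_all

sublocale Q: elementary_doctrine Q
  by standard (use Q_is_delta in blast)

lemma Q_delta [simp]: "X \<in> Ob Q \<Longrightarrow> delta Q X = r X"
  by (rule Q.is_delta_eq[OF _ Q_is_delta])

text \<open>
  The object \<open>(A, \<delta>)\<close> is \<open>A\<close> without any identification: every arrow from \<open>A\<close> to the object
  underlying a quotient is an arrow out of it, and every predicate on \<open>A\<close> is a descent datum for
  \<open>\<delta>\<close>. Statements about quotients can therefore be tested at all stages \<open>Y\<close> of the original
  doctrine.
\<close>

lemma disc_Ob [simp]: "A \<in> Ob P \<Longrightarrow> e (A, delta P A) \<in> Ob Q"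
  by (simp add: equiv_delta)

lemma disc_Hom:
  assumes [simp]: "A \<in> Ob P" "Y \<in> Ob Q" "f \<in> Hom P A (U Y)"
  shows "f \<in> Hom Q (e (A, delta P A)) Y"
  unfolding Q_Hom_iff by (simp add: delta_le_iff equiv_refl[OF r_equiv])

text \<open>
  Quotients of quotients are quotients: an equivalence relation on \<open>(A, \<rho>)\<close> is an equivalence
  relation on \<open>A\<close> that contains \<open>\<rho>\<close>. The multiplication \<open>((A, \<rho>), \<tau>) \<mapsto> (A, \<tau>)\<close> rests on this.
\<close>

lemma Q_equiv_rel_iff:
  assumes X [simp]: "X \<in> Ob Q"
  shows "equiv_rel Q X \<tau> \<longleftrightarrow> equiv_rel P (U X) \<tau> \<and> r X \<le>[P,prd P (U X) (U X)] \<tau>"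
proof (intro iffI conjI)
  assume eq: "equiv_rel Q X \<tau>"
  then show ge: "r X \<le>[P,prd P (U X) (U X)] \<tau>"
    unfolding equiv_rel_def Let_def by simp
  have [simp]: "\<tau> \<in> carrier (fib P (prd P (U X) (U X)))"
    using Q.equiv_rel_closed[OF eq] descent_closed by simp
  show "equiv_rel P (U X) \<tau>"
  proof (rule equiv_relI)
    fix Y f g h \<gamma>
    assume [simp]: "Y \<in> Ob P" "f \<in> Hom P Y (U X)" "\<gamma> \<in> carrier (fib P Y)"
    note hom = disc_Hom[of Y X]
    show "\<gamma> \<le>[P,Y] inst P Y (U X) (U X) \<tau> f f"
      using Q.equiv_refl[OF eq X, of "e (Y, delta P Y)" f \<gamma>] hom by (simp add: descent_delta)
    assume [simp]: "g \<in> Hom P Y (U X)" and le: "\<gamma> \<le>[P,Y] inst P Y (U X) (U X) \<tau> f g"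
    show "\<gamma> \<le>[P,Y] inst P Y (U X) (U X) \<tau> g f"
      using Q.equiv_sym[OF eq X, of "e (Y, delta P Y)" f g \<gamma>] hom le by (simp add: descent_delta)
    assume [simp]: "h \<in> Hom P Y (U X)" and le': "\<gamma> \<le>[P,Y] inst P Y (U X) (U X) \<tau> g h"
    show "\<gamma> \<le>[P,Y] inst P Y (U X) (U X) \<tau> f h"
      using Q.equiv_trans[OF eq X, of "e (Y, delta P Y)" f g h \<gamma>] hom le le'
        by (simp add: descent_delta)
  qed simp_all
next
  assume "equiv_rel P (U X) \<tau> \<and> r X \<le>[P,prd P (U X) (U X)] \<tau>"
  then have eq: "equiv_rel P (U X) \<tau>" and ge: "r X \<le>[P,prd P (U X) (U X)] \<tau>" by simp_all
  note [simp] = equiv_rel_closed[OF eq]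
  have c: "\<tau> \<in> carrier (fib Q (prd Q X X))" using equiv_rel_descent[OF _ eq _ ge] by simp
  show "equiv_rel Q X \<tau>"
  proof (rule Q.equiv_relI[OF X c])
    fix Y f g h \<gamma>
    assume Y [simp]: "Y \<in> Ob Q" and f [simp]: "f \<in> Hom Q Y X" and \<gamma>: "\<gamma> \<in> carrier (fib Q Y)"
    have [simp]: "\<gamma> \<in> carrier (fib P (U Y))" using \<gamma> descent_closed by simp
    note [simp] = Q_HomD[OF f]
    show "\<gamma> \<le>[Q,Y] inst Q Y X X \<tau> f f" by (simp add: equiv_refl[OF eq])
    assume g [simp]: "g \<in> Hom Q Y X" and le: "\<gamma> \<le>[Q,Y] inst Q Y X X \<tau> f g"
    note [simp] = Q_HomD[OF g]
    show "\<gamma> \<le>[Q,Y] inst Q Y X X \<tau> g f" using le by (simp add: equiv_sym[OF eq])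
    assume h [simp]: "h \<in> Hom Q Y X" and le': "\<gamma> \<le>[Q,Y] inst Q Y X X \<tau> g h"
    note [simp] = Q_HomD[OF h]
    show "\<gamma> \<le>[Q,Y] inst Q Y X X \<tau> f h"
      using le le' equiv_trans[OF eq, of "U Y" f g h \<gamma>] by simp
  qed
qed

lemma Q_descent:
  assumes X [simp]: "X \<in> Ob Q" and eq: "equiv_rel Q X \<tau>"
  shows "descent Q X \<tau> = descent P (U X) \<tau>"
proof (intro equalityI subsetI)
  have eqP: "equiv_rel P (U X) \<tau>" and ge: "r X \<le>[P,prd P (U X) (U X)] \<tau>"
    using eq Q_equiv_rel_iff by simp_all
  note [simp] = equiv_rel_closed[OF eqP] Q.equiv_rel_closed[OF eq]
  fix \<alpha>
  show "\<alpha> \<in> descent P (U X) \<tau>" if \<alpha>: "\<alpha> \<in> descent Q X \<tau>"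
  proof (rule descentI)
    show "\<alpha> \<in> carrier (fib P (U X))" using Q.descent_closed[OF \<alpha>] descent_closed by simp
    fix Y f g \<gamma>
    assume [simp]: "Y \<in> Ob P" "f \<in> Hom P Y (U X)" "g \<in> Hom P Y (U X)" "\<gamma> \<in> carrier (fib P Y)"
      and le: "\<gamma> \<le>[P,Y] rei P Y (U X) f \<alpha>" "\<gamma> \<le>[P,Y] inst P Y (U X) (U X) \<tau> f g"
    show "\<gamma> \<le>[P,Y] rei P Y (U X) g \<alpha>"
      using Q.descent_subst[OF \<alpha> X, of "e (Y, delta P Y)" f g \<gamma>] disc_Hom[of Y X] le
        Q.equiv_rel_closed[OF eq] by (simp add: descent_delta)
  qed simp_all
  show "\<alpha> \<in> descent Q X \<tau>" if \<alpha>: "\<alpha> \<in> descent P (U X) \<tau>"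
  proof (rule Q.descentI[OF X])
    note [simp] = descent_closed[OF \<alpha>]
    have "\<alpha> \<in> descent P (U X) (r X)"
    proof (rule descentI)
      fix Y f g \<gamma>
      assume [simp]: "Y \<in> Ob P" "f \<in> Hom P Y (U X)" "g \<in> Hom P Y (U X)" "\<gamma> \<in> carrier (fib P Y)"
        and le: "\<gamma> \<le>[P,Y] rei P Y (U X) f \<alpha>" "\<gamma> \<le>[P,Y] inst P Y (U X) (U X) (r X) f g"
      show "\<gamma> \<le>[P,Y] rei P Y (U X) g \<alpha>"
        by (rule descent_subst[OF \<alpha>]) (use le le_inst_mono[OF le(2) ge] in simp_all)
    qed simp_all
    then show "\<alpha> \<in> carrier (fib Q X)" by simp
    show "\<tau> \<in> carrier (fib Q (prd Q X X))" by (rule Q.equiv_rel_closed[OF eq])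
    fix Y f g \<gamma>
    assume Y [simp]: "Y \<in> Ob Q" and f [simp]: "f \<in> Hom Q Y X" and g [simp]: "g \<in> Hom Q Y X"
      and \<gamma>: "\<gamma> \<in> carrier (fib Q Y)"
      and le: "\<gamma> \<le>[Q,Y] rei Q Y X f \<alpha>" "\<gamma> \<le>[Q,Y] inst Q Y X X \<tau> f g"
    have [simp]: "\<gamma> \<in> carrier (fib P (U Y))" using \<gamma> descent_closed by simp
    note [simp] = Q_HomD[OF f] Q_HomD[OF g]
    show "\<gamma> \<le>[Q,Y] rei Q Y X g \<alpha>"
      using descent_subst[OF \<alpha>, of "U Y" f g \<gamma>] le by simp
  qed
qed

end

section \<open>Elementary doctrines form a 2-category\<close>

lemma hom1D: "F \<in> hom1 ED P R \<Longrightarrow> ed_hom P R F"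
  by (rule ed_hom.intro)

lemma hom2D: "\<lbrakk>F \<in> hom1 ED P R; G \<in> hom1 ED P R; \<theta> \<in> hom2 ED F G\<rbrakk> \<Longrightarrow> ed_cell P R F G \<theta>"
  by (intro ed_cell.intro ed_cell_axioms.intro hom1D)

lemma hom2_hom1:
  assumes "\<theta> \<in> hom2 ED F G"
  shows "F \<in> hom1 ED (dom_d F) (cod_d F)" "G \<in> hom1 ED (dom_d F) (cod_d F)"
proof -
  have st: "dom_m \<theta> = F" "cod_m \<theta> = G" and t: "elementary_trans \<theta>"
    using assms unfolding hom2_def by simp_all
  interpret elementary_trans \<theta> by (rule t)
  show "F \<in> hom1 ED (dom_d F) (cod_d F)" "G \<in> hom1 ED (dom_d F) (cod_d F)"
    using F.elementary_map_axioms G.elementary_map_axioms same_dom same_cod st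
    unfolding hom1_def by simp_all
qed

lemma id_map_simps [simp]:
  "dom_d (id_map P) = P" "cod_d (id_map P) = P"
  "A \<in> Ob P \<Longrightarrow> omap (id_map P) A = A"
  "\<lbrakk>A \<in> Ob P; B \<in> Ob P; f \<in> Hom P A B\<rbrakk> \<Longrightarrow> amap (id_map P) A B f = f"
  "\<lbrakk>A \<in> Ob P; \<alpha> \<in> carrier (fib P A)\<rbrakk> \<Longrightarrow> fmap (id_map P) A \<alpha> = \<alpha>"
  by (simp_all add: id_map_def)

lemma comp_map_simps [simp]:
  "dom_d (comp_map G F) = dom_d F" "cod_d (comp_map G F) = cod_d G"
  "A \<in> Ob (dom_d F) \<Longrightarrow> omap (comp_map G F) A = omap G (omap F A)"
  "\<lbrakk>A \<in> Ob (dom_d F); B \<in> Ob (dom_d F); f \<in> Hom (dom_d F) A B\<rbrakk> \<Longrightarrow>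
    amap (comp_map G F) A B f = amap G (omap F A) (omap F B) (amap F A B f)"
  "\<lbrakk>A \<in> Ob (dom_d F); \<alpha> \<in> carrier (fib (dom_d F) A)\<rbrakk> \<Longrightarrow>
    fmap (comp_map G F) A \<alpha> = fmap G (omap F A) (fmap F A \<alpha>)"
  by (simp_all add: comp_map_def Let_def)

lemma trans_simps [simp]:
  "dom_m (id_trans F) = F" "cod_m (id_trans F) = F"
  "A \<in> Ob (dom_d F) \<Longrightarrow> component (id_trans F) A = idn (cod_d F) (omap F A)"
  "dom_m (vcomp_trans \<phi> \<theta>) = dom_m \<theta>" "cod_m (vcomp_trans \<phi> \<theta>) = cod_m \<phi>"
  "A \<in> Ob (dom_d (dom_m \<theta>)) \<Longrightarrow> component (vcomp_trans \<phi> \<theta>) A = cmp (cod_d (dom_m \<theta>))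
    (omap (dom_m \<theta>) A) (omap (cod_m \<theta>) A) (omap (cod_m \<phi>) A) (component \<phi> A) (component \<theta> A)"
  "dom_m (hcomp_trans \<phi> \<theta>) = comp_map (dom_m \<phi>) (dom_m \<theta>)"
  "cod_m (hcomp_trans \<phi> \<theta>) = comp_map (cod_m \<phi>) (cod_m \<theta>)"
  "A \<in> Ob (dom_d (dom_m \<theta>)) \<Longrightarrow> component (hcomp_trans \<phi> \<theta>) A = cmp (cod_d (dom_m \<phi>))
    (omap (dom_m \<phi>) (omap (dom_m \<theta>) A)) (omap (dom_m \<phi>) (omap (cod_m \<theta>) A))
      (omap (cod_m \<phi>) (omap (cod_m \<theta>) A))
    (component \<phi> (omap (cod_m \<theta>) A))
    (amap (dom_m \<phi>) (omap (dom_m \<theta>) A) (omap (cod_m \<theta>) A) (component \<theta> A))"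
  by (simp_all add: id_trans_def vcomp_trans_def hcomp_trans_def Let_def)

lemma id_map_hom:
  assumes P: "elementary_doctrine P"
  shows "id_map P \<in> hom1 ED P P"
proof -
  interpret P: elementary_doctrine P by (rule P)
  show ?thesis
  proof (rule ed_homI)
    show "omap (id_map P) \<in> Ob P \<rightarrow>\<^sub>E Ob P" by (simp add: id_map_def)
    show "amap (id_map P) \<in> (\<Pi>\<^sub>E A \<in> Ob P. \<Pi>\<^sub>E B \<in> Ob P. Hom P A B \<rightarrow>\<^sub>E Hom P (omap (id_map P) A)
      (omap (id_map P) B))"
      by (auto simp add: id_map_def)
    show "fmap (id_map P) \<in> (\<Pi>\<^sub>E A \<in> Ob P. carrier (fib P A) \<rightarrow>\<^sub>E carrier
      (fib P (omap (id_map P) A)))"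
      by (auto simp add: id_map_def)
    show "preserves_finite_meets (fib P A) (fib P (omap (id_map P) A)) (fmap (id_map P) A)"
      if A: "A \<in> Ob P" for A
      using preserves_finite_meets_cong[OF preserves_finite_meets_id _ P.fib[OF A]] A by simp
  qed (simp_all add: P P.prd)
qed

lemma comp_map_hom:
  assumes F: "F \<in> hom1 ED P R" and G: "G \<in> hom1 ED R S"
  shows "comp_map G F \<in> hom1 ED P S"
proof -
  interpret F: ed_hom P R F by (rule hom1D[OF F])
  interpret G: ed_hom R S G by (rule hom1D[OF G])
  show ?thesis
  proof (rule ed_homI)
    show "omap (comp_map G F) \<in> Ob P \<rightarrow>\<^sub>E Ob S" by (auto simp: comp_map_def Let_def)
    show "amap (comp_map G F) \<in> (\<Pi>\<^sub>E A \<in> Ob P. \<Pi>\<^sub>E B \<in> Ob P. Hom P A B \<rightarrow>\<^sub>E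
        Hom S (omap (comp_map G F) A) (omap (comp_map G F) B))"
      by (auto simp: comp_map_def Let_def)
    show "fmap (comp_map G F) \<in> (\<Pi>\<^sub>E A \<in> Ob P. carrier (fib P A) \<rightarrow>\<^sub>E carrier
      (fib S (omap (comp_map G F) A)))"
      by (auto simp: comp_map_def Let_def)
    show "preserves_finite_meets (fib P A) (fib S (omap (comp_map G F) A)) (fmap (comp_map G F) A)"
      if A: "A \<in> Ob P" for A
      using preserves_finite_meets_cong[OF preserves_finite_meets_comp[OF F.fmap_meets[OF A]
        G.fmap_meets[OF F.omap_Ob[OF A]]]
          _ F.P.fib[OF A]] A by simp
    show "is_product S (omap (comp_map G F) A) (omap (comp_map G F) B)
      (omap (comp_map G F) (prd P A B))
        (amap (comp_map G F) (prd P A B) A (pr1 P A B))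
          (amap (comp_map G F) (prd P A B) B (pr2 P A B))"
      if "A \<in> Ob P" "B \<in> Ob P" for A B
      using G.preserves_products[OF _ _ F.product_image[OF that]] that by simp
    show "fmap (comp_map G F) (prd P A A) (delta P A) =
      inst S (omap (comp_map G F) (prd P A A)) (omap (comp_map G F) A) (omap (comp_map G F) A)
        (delta S (omap (comp_map G F) A))
        (amap (comp_map G F) (prd P A A) A (pr1 P A A))
          (amap (comp_map G F) (prd P A A) A (pr2 P A A))"
      if A [simp]: "A \<in> Ob P" for A
    proof -
      have "fmap (comp_map G F) (prd P A A) (delta P A) = fmap G (omap F (prd P A A))
         (inst R (omap F (prd P A A)) (omap F A) (omap F A) (delta R (omap F A))
           (amap F (prd P A A) A (pr1 P A A)) (amap F (prd P A A) A (pr2 P A A)))"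
        by (simp add: F.fmap_delta)
      also have "\<dots> = rei S (omap G (omap F (prd P A A))) (omap G (prd R (omap F A) (omap F A)))
          (amap G (omap F (prd P A A)) (prd R (omap F A) (omap F A))
            (pairing R (omap F (prd P A A)) (omap F A) (omap F A)
              (amap F (prd P A A) A (pr1 P A A)) (amap F (prd P A A) A (pr2 P A A))))
          (fmap G (prd R (omap F A) (omap F A)) (delta R (omap F A)))"
        by (simp add: inst_def G.fmap_natural)
      also have "\<dots> = inst S (omap (comp_map G F) (prd P A A)) (omap (comp_map G F) A)
        (omap (comp_map G F) A)
        (delta S (omap (comp_map G F) A))
        (amap (comp_map G F) (prd P A A) A (pr1 P A A))
          (amap (comp_map G F) (prd P A A) A (pr2 P A A))"
        by (simp add: G.fmap_delta)
      finally show ?thesis .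
    qed
  qed (use F.P.elementary_doctrine_axioms G.R.elementary_doctrine_axioms in
      \<open>simp_all add: F.fmap_natural G.fmap_natural\<close>)
qed

lemma id_trans_cell:
  assumes F: "F \<in> hom1 ED P R"
  shows "id_trans F \<in> hom2 ED F F"
proof -
  interpret F: ed_hom P R F by (rule hom1D[OF F])
  show ?thesis
    by (rule ed_cellI[OF F F]) (simp_all add: id_trans_def)
qed

lemma vcomp_trans_cell:
  assumes F: "F \<in> hom1 ED P R" and G: "G \<in> hom1 ED P R" and H: "H \<in> hom1 ED P R"
    and t: "\<theta> \<in> hom2 ED F G" and p: "\<phi> \<in> hom2 ED G H"
  shows "vcomp_trans \<phi> \<theta> \<in> hom2 ED F H"
proof -
  interpret t: ed_cell P R F G \<theta> by (rule hom2D[OF F G t])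
  interpret p: ed_cell P R G H \<phi> by (rule hom2D[OF G H p])
  show ?thesis
  proof (rule ed_cellI[OF F H])
    show "component (vcomp_trans \<phi> \<theta>) \<in> (\<Pi>\<^sub>E A \<in> Ob P. Hom R (omap F A) (omap H A))"
      by (auto simp: vcomp_trans_def Let_def)
    show "cmp R (omap F A) (omap F B) (omap H B) (component (vcomp_trans \<phi> \<theta>) B) (amap F A B f) =
      cmp R (omap F A) (omap H A) (omap H B) (amap H A B f) (component (vcomp_trans \<phi> \<theta>) A)"
      if [simp]: "A \<in> Ob P" "B \<in> Ob P" "f \<in> Hom P A B" for A B f
    proof -
      have "cmp R (omap F A) (omap F B) (omap H B) (component (vcomp_trans \<phi> \<theta>) B) (amap F A B f) =
        cmp R (omap F A) (omap G A) (omap H B)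
          (cmp R (omap G A) (omap G B) (omap H B) (component \<phi> B) (amap G A B f)) (component \<theta> A)"
        by (simp add: t.natural)
      also have "cmp R (omap G A) (omap G B) (omap H B) (component \<phi> B) (amap G A B f) =
          cmp R (omap G A) (omap H A) (omap H B) (amap H A B f) (component \<phi> A)"
        by (rule p.natural) simp_all
      finally show ?thesis by simp
    qed
    fix A \<alpha> assume [simp]: "A \<in> Ob P" "\<alpha> \<in> carrier (fib P A)"
    show "fmap F A \<alpha> \<le>[R,omap F A]
      rei R (omap F A) (omap H A) (component (vcomp_trans \<phi> \<theta>) A) (fmap H A \<alpha>)"
      using t.F.R.le_rei_mono[OF t.fmap_le p.fmap_le] by simp
  qed simp_all
qed

lemma hcomp_trans_cell:
  assumes F: "F \<in> hom1 ED P R" and F': "F' \<in> hom1 ED P R" and G: "G \<in> hom1 ED R S"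
    and G': "G' \<in> hom1 ED R S"
    and t: "\<theta> \<in> hom2 ED F F'" and p: "\<phi> \<in> hom2 ED G G'"
  shows "hcomp_trans \<phi> \<theta> \<in> hom2 ED (comp_map G F) (comp_map G' F')"
proof -
  interpret t: ed_cell P R F F' \<theta> by (rule hom2D[OF F F' t])
  interpret p: ed_cell R S G G' \<phi> by (rule hom2D[OF G G' p])
  show ?thesis
  proof (rule ed_cellI[OF comp_map_hom[OF F G] comp_map_hom[OF F' G']])
    show "component (hcomp_trans \<phi> \<theta>) \<in> (\<Pi>\<^sub>E A \<in> Ob P. Hom S (omap (comp_map G F) A)
      (omap (comp_map G' F') A))"
      by (auto simp: hcomp_trans_def Let_def)
    fix A assume [simp]: "A \<in> Ob P"
    show "cmp S (omap (comp_map G F) A) (omap (comp_map G F) B) (omap (comp_map G' F') B)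
        (component (hcomp_trans \<phi> \<theta>) B) (amap (comp_map G F) A B f) =
      cmp S (omap (comp_map G F) A) (omap (comp_map G' F') A) (omap (comp_map G' F') B)
        (amap (comp_map G' F') A B f) (component (hcomp_trans \<phi> \<theta>) A)"
      if [simp]: "B \<in> Ob P" "f \<in> Hom P A B" for B f
    proof -
      let ?f = "amap F' A B f"
      have "cmp S (omap G (omap F A)) (omap G (omap F B)) (omap G (omap F' B))
          (amap G (omap F B) (omap F' B) (component \<theta> B))
            (amap G (omap F A) (omap F B) (amap F A B f)) =
        cmp S (omap G (omap F A)) (omap G (omap F' A)) (omap G (omap F' B))
          (amap G (omap F' A) (omap F' B) ?f) (amap G (omap F A) (omap F' A) (component \<theta> A))"
        by (simp add: t.natural flip: p.F.amap_cmp)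
      then have "cmp S (omap (comp_map G F) A) (omap (comp_map G F) B) (omap (comp_map G' F') B)
        (component (hcomp_trans \<phi> \<theta>) B) (amap (comp_map G F) A B f) =
        cmp S (omap G (omap F A)) (omap G (omap F' A)) (omap G' (omap F' B))
         (cmp S (omap G (omap F' A)) (omap G (omap F' B)) (omap G' (omap F' B))
           (component \<phi> (omap F' B)) (amap G (omap F' A) (omap F' B) ?f))
         (amap G (omap F A) (omap F' A) (component \<theta> A))"
        by simp
      also have "cmp S (omap G (omap F' A)) (omap G (omap F' B)) (omap G' (omap F' B))
           (component \<phi> (omap F' B)) (amap G (omap F' A) (omap F' B) ?f) =
         cmp S (omap G (omap F' A)) (omap G' (omap F' A)) (omap G' (omap F' B))
           (amap G' (omap F' A) (omap F' B) ?f) (component \<phi> (omap F' A))"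
        by (simp add: p.natural)
      finally show ?thesis by simp
    qed
    fix \<alpha> assume [simp]: "\<alpha> \<in> carrier (fib P A)"
    have "fmap G (omap F A) (fmap F A \<alpha>) \<le>[S,omap G (omap F A)]
      fmap G (omap F A) (rei R (omap F A) (omap F' A) (component \<theta> A) (fmap F' A \<alpha>))"
      by (rule p.F.fmap_mono[OF t.fmap_le]) simp_all
    then have "fmap G (omap F A) (fmap F A \<alpha>) \<le>[S,omap G (omap F A)]
      rei S (omap G (omap F A)) (omap G (omap F' A)) (amap G (omap F A) (omap F' A) (component \<theta> A))
        (fmap G (omap F' A) (fmap F' A \<alpha>))"
      by (simp add: p.F.fmap_natural)
    from p.F.R.le_rei_mono[OF this p.fmap_le]
    show "fmap (comp_map G F) A \<alpha> \<le>[S,omap (comp_map G F) A]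
      rei S (omap (comp_map G F) A) (omap (comp_map G' F') A) (component (hcomp_trans \<phi> \<theta>) A)
        (fmap (comp_map G' F') A \<alpha>)"
      by simp
  qed simp_all
qed

theorem two_category_ED: "two_category ED"
proof
  show "src1 ED F \<in> cell0 ED \<and> tgt1 ED F \<in> cell0 ED" if "F \<in> cell1 ED" for F
    using that by (simp add: elementary_map_def)
  show "src2 ED \<theta> \<in> cell1 ED \<and> tgt2 ED \<theta> \<in> cell1 ED" if "\<theta> \<in> cell2 ED" for \<theta>
    using that by (simp add: elementary_trans_def)
  show "src1 ED (src2 ED \<theta>) = src1 ED (tgt2 ED \<theta>) \<and> tgt1 ED (src2 ED \<theta>) = tgt1 ED (tgt2 ED \<theta>)"
    if "\<theta> \<in> cell2 ED" for \<theta>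
    using that elementary_trans.same_dom elementary_trans.same_cod by auto
  show "one1 ED P \<in> hom1 ED P P" if "P \<in> cell0 ED" for P using that id_map_hom by simp
  fix P R F assume F: "F \<in> hom1 ED P R"
  interpret F: ed_hom P R F by (rule hom1D[OF F])
  show "one1 ED R \<odot>\<^bsub>ED\<^esub> F = F"
    using comp_map_hom[OF F id_map_hom[OF F.R.elementary_doctrine_axioms]] F
    by (auto intro!: ed_hom_eqI)
  show "F \<odot>\<^bsub>ED\<^esub> one1 ED P = F"
    using comp_map_hom[OF id_map_hom[OF F.P.elementary_doctrine_axioms] F] F
    by (auto intro!: ed_hom_eqI)
  fix S G assume G: "G \<in> hom1 ED R S"
  interpret G: ed_hom R S G by (rule hom1D[OF G])
  show "G \<odot>\<^bsub>ED\<^esub> F \<in> hom1 ED P S" using comp_map_hom[OF F G] by simp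
  show "one2 ED G \<star>\<^bsub>ED\<^esub> one2 ED F = one2 ED (G \<odot>\<^bsub>ED\<^esub> F)"
    using hcomp_trans_cell[OF F F G G id_trans_cell[OF F] id_trans_cell[OF G]]
      id_trans_cell[OF comp_map_hom[OF F G]] comp_map_hom[OF F G] by (auto intro!: ed_cell_eqI)
  fix V H assume H: "H \<in> hom1 ED S V"
  interpret H: ed_hom S V H by (rule hom1D[OF H])
  show "(H \<odot>\<^bsub>ED\<^esub> G) \<odot>\<^bsub>ED\<^esub> F = H \<odot>\<^bsub>ED\<^esub> (G \<odot>\<^bsub>ED\<^esub> F)"
    using comp_map_hom[OF F comp_map_hom[OF G H]] comp_map_hom[OF comp_map_hom[OF F G] H]
    by (auto intro!: ed_hom_eqI)
next
  fix F :: "('a, 'b, 'c) doctrine_map" assume "F \<in> cell1 ED"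
  then have "F \<in> hom1 ED (dom_d F) (cod_d F)" unfolding hom1_def by simp
  from id_trans_cell[OF this] show "one2 ED F \<in> hom2 ED F F" by simp
next
  fix F G \<theta> assume t: "\<theta> \<in> hom2 ED F G"
  define P R where "P = dom_d F" "R = cod_d F"
  have F: "F \<in> hom1 ED P R" and G: "G \<in> hom1 ED P R" using hom2_hom1[OF t] P_R_def by simp_all
  interpret t: ed_cell P R F G \<theta> by (rule hom2D[OF F G t])
  show "one2 ED G \<bullet>\<^bsub>ED\<^esub> \<theta> = \<theta>"
    using vcomp_trans_cell[OF F G G t id_trans_cell[OF G]] t F by (auto intro!: ed_cell_eqI)
  show "\<theta> \<bullet>\<^bsub>ED\<^esub> one2 ED F = \<theta>"
    using vcomp_trans_cell[OF F F G id_trans_cell[OF F] t] t F by (auto intro!: ed_cell_eqI)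
  fix H \<phi> assume p: "\<phi> \<in> hom2 ED G H"
  have H: "H \<in> hom1 ED P R" using hom2_hom1[OF p] by simp
  interpret p: ed_cell P R G H \<phi> by (rule hom2D[OF G H p])
  show "\<phi> \<bullet>\<^bsub>ED\<^esub> \<theta> \<in> hom2 ED F H" using vcomp_trans_cell[OF F G H t p] by simp
  fix J \<psi> assume s: "\<psi> \<in> hom2 ED H J"
  have J: "J \<in> hom1 ED P R" using hom2_hom1[OF s] p.G.dom p.G.cod by simp
  interpret s: ed_cell P R H J \<psi> by (rule hom2D[OF H J s])
  show "(\<psi> \<bullet>\<^bsub>ED\<^esub> \<phi>) \<bullet>\<^bsub>ED\<^esub> \<theta> = \<psi> \<bullet>\<^bsub>ED\<^esub> (\<phi> \<bullet>\<^bsub>ED\<^esub> \<theta>)"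
    using vcomp_trans_cell[OF F G J t vcomp_trans_cell[OF G H J p s]]
      vcomp_trans_cell[OF F H J vcomp_trans_cell[OF F G H t p] s] F by (auto intro!: ed_cell_eqI)
next
  fix P R F F' \<theta>
  assume F: "F \<in> hom1 ED P R" and F': "F' \<in> hom1 ED P R" and t: "\<theta> \<in> hom2 ED F F'"
  interpret t: ed_cell P R F F' \<theta> by (rule hom2D[OF F F' t])
  note iP = id_map_hom[OF t.F.P.elementary_doctrine_axioms]
    and iR = id_map_hom[OF t.F.R.elementary_doctrine_axioms]
  have 1: "comp_map (id_map R) F = F" "comp_map (id_map R) F' = F'" "comp_map F (id_map P) = F"
    "comp_map F' (id_map P) = F'"
    using comp_map_hom[OF F iR] comp_map_hom[OF F' iR] comp_map_hom[OF iP F] comp_map_hom[OF iP F']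
      F F'
    by (auto intro!: ed_hom_eqI)
  show "one2 ED (one1 ED R) \<star>\<^bsub>ED\<^esub> \<theta> = \<theta>"
    using hcomp_trans_cell[OF F F' iR iR t id_trans_cell[OF iR]] t F 1 by (auto intro!: ed_cell_eqI)
  show "\<theta> \<star>\<^bsub>ED\<^esub> one2 ED (one1 ED P) = \<theta>"
    using hcomp_trans_cell[OF iP iP F F' id_trans_cell[OF iP] t] t F 1 by (auto intro!: ed_cell_eqI)
  fix S G G' \<phi>
  assume G: "G \<in> hom1 ED R S" and G': "G' \<in> hom1 ED R S" and p: "\<phi> \<in> hom2 ED G G'"
  interpret p: ed_cell R S G G' \<phi> by (rule hom2D[OF G G' p])
  show "\<phi> \<star>\<^bsub>ED\<^esub> \<theta> \<in> hom2 ED (G \<odot>\<^bsub>ED\<^esub> F) (G' \<odot>\<^bsub>ED\<^esub> F')" using hcomp_trans_cell[OF F F' G G' t p]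
    by simp
  fix V H H' \<psi>
  assume H: "H \<in> hom1 ED S V" and H': "H' \<in> hom1 ED S V" and s: "\<psi> \<in> hom2 ED H H'"
  interpret s: ed_cell S V H H' \<psi> by (rule hom2D[OF H H' s])
  have "comp_map (comp_map H G) F = comp_map H (comp_map G F)"
    "comp_map (comp_map H' G') F' = comp_map H' (comp_map G' F')"
    using comp_map_hom[OF F comp_map_hom[OF G H]] comp_map_hom[OF comp_map_hom[OF F G] H]
      comp_map_hom[OF F' comp_map_hom[OF G' H']] comp_map_hom[OF comp_map_hom[OF F' G'] H']
    by (auto intro!: ed_hom_eqI)
  then show "(\<psi> \<star>\<^bsub>ED\<^esub> \<phi>) \<star>\<^bsub>ED\<^esub> \<theta> = \<psi> \<star>\<^bsub>ED\<^esub> (\<phi> \<star>\<^bsub>ED\<^esub> \<theta>)"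
    using hcomp_trans_cell[OF F F' comp_map_hom[OF G H] comp_map_hom[OF G' H']
      t hcomp_trans_cell[OF G G' H H' p s]]
      hcomp_trans_cell[OF comp_map_hom[OF F G] comp_map_hom[OF F' G']
        H H' hcomp_trans_cell[OF F F' G G' t p] s]
      comp_map_hom[OF comp_map_hom[OF F G] H] by (auto intro!: ed_cell_eqI)
next
  fix P R F F' F'' S G G' G'' \<theta> \<theta>' \<phi> \<phi>'
  assume F: "F \<in> hom1 ED P R" and F': "F' \<in> hom1 ED P R" and F'': "F'' \<in> hom1 ED P R"
    and G: "G \<in> hom1 ED R S" and G': "G' \<in> hom1 ED R S" and G'': "G'' \<in> hom1 ED R S"
    and t: "\<theta> \<in> hom2 ED F F'" and t': "\<theta>' \<in> hom2 ED F' F''"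
    and p: "\<phi> \<in> hom2 ED G G'" and p': "\<phi>' \<in> hom2 ED G' G''"
  interpret t: ed_cell P R F F' \<theta> by (rule hom2D[OF F F' t])
  interpret t': ed_cell P R F' F'' \<theta>' by (rule hom2D[OF F' F'' t'])
  interpret p: ed_cell R S G G' \<phi> by (rule hom2D[OF G G' p])
  interpret p': ed_cell R S G' G'' \<phi>' by (rule hom2D[OF G' G'' p'])
  have "hcomp_trans (vcomp_trans \<phi>' \<phi>) (vcomp_trans \<theta>' \<theta>) =
    vcomp_trans (hcomp_trans \<phi>' \<theta>') (hcomp_trans \<phi> \<theta>)"
  proof (rule ed_cell_eqI)
    show "comp_map G F \<in> hom1 ED P S" by (rule comp_map_hom[OF F G])
    show "hcomp_trans (vcomp_trans \<phi>' \<phi>) (vcomp_trans \<theta>' \<theta>) \<in>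
      hom2 ED (comp_map G F) (comp_map G'' F'')"
      by (rule hcomp_trans_cell[OF F F'' G G'' vcomp_trans_cell[OF F F' F'' t t']
        vcomp_trans_cell[OF G G' G'' p p']])
    show "vcomp_trans (hcomp_trans \<phi>' \<theta>') (hcomp_trans \<phi> \<theta>) \<in>
      hom2 ED (comp_map G F) (comp_map G'' F'')"
      by (rule vcomp_trans_cell[OF comp_map_hom[OF F G] comp_map_hom[OF F' G']
        comp_map_hom[OF F'' G'']
            hcomp_trans_cell[OF F F' G G' t p] hcomp_trans_cell[OF F' F'' G' G'' t' p']])
    fix A assume [simp]: "A \<in> Ob P"
    let ?a = "amap G (omap F A) (omap F' A) (component \<theta> A)"
    have "cmp S (omap G (omap F A)) (omap G (omap F' A)) (omap G' (omap F'' A))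
        (cmp S (omap G (omap F' A)) (omap G (omap F'' A)) (omap G' (omap F'' A))
          (component \<phi> (omap F'' A))
          (amap G (omap F' A) (omap F'' A) (component \<theta>' A))) ?a =
      cmp S (omap G (omap F A)) (omap G (omap F' A)) (omap G' (omap F'' A))
        (cmp S (omap G (omap F' A)) (omap G' (omap F' A)) (omap G' (omap F'' A))
          (amap G' (omap F' A) (omap F'' A) (component \<theta>' A)) (component \<phi> (omap F' A))) ?a"
      by (subst p.natural) simp_all
    then show "component (hcomp_trans (vcomp_trans \<phi>' \<phi>) (vcomp_trans \<theta>' \<theta>)) A =
      component (vcomp_trans (hcomp_trans \<phi>' \<theta>') (hcomp_trans \<phi> \<theta>)) A"
      by simp
  qed
  then show "(\<phi>' \<bullet>\<^bsub>ED\<^esub> \<phi>) \<star>\<^bsub>ED\<^esub> (\<theta>' \<bullet>\<^bsub>ED\<^esub> \<theta>) = (\<phi>' \<star>\<^bsub>ED\<^esub> \<theta>') \<bullet>\<^bsub>ED\<^esub> (\<phi> \<star>\<^bsub>ED\<^esub> \<theta>)"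
    by simp
qed

section \<open>Images of relations under 1-cells\<close>

text \<open>
  The relation that a 1-cell \<open>F\<close> puts on \<open>F A\<close> when it is applied to \<open>(A, \<rho>)\<close>.
\<close>

definition image_rel :: "('o, 'm, 'p) doctrine_map \<Rightarrow> 'o \<Rightarrow> 'p \<Rightarrow> 'p" where
  "image_rel F A \<rho> = (let AA = prd (dom_d F) A A; W = prd (cod_d F) (omap F A) (omap F A) in
    rei (cod_d F) W (omap F AA) (inverse_arrow (cod_d F) (omap F AA) W (comparison F A A))
      (fmap F AA \<rho>))"

context ed_hom
begin

text \<open>
  Pairs of elements of \<open>F A\<close> and \<open>F B\<close> are elements of \<open>F (A \<times> B)\<close>, where predicates of the form
  \<open>F \<rho>\<close> live. All properties of \<open>image_rel\<close> are transported along this correspondence.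
\<close>

lemma product_element:
  assumes "A \<in> Ob P" "B \<in> Ob P" "Z \<in> Ob R" "x \<in> Hom R Z (omap F A)" "y \<in> Hom R Z (omap F B)"
  obtains z where "z \<in> Hom R Z (omap F (prd P A B))"
    "cmp R Z (omap F (prd P A B)) (omap F A) (amap F (prd P A B) A (pr1 P A B)) z = x"
    "cmp R Z (omap F (prd P A B)) (omap F B) (amap F (prd P A B) B (pr2 P A B)) z = y"
  by (rule is_product_mediate[OF product_image[OF assms(1,2)] assms(3-5)])

lemma
  assumes [simp]: "A \<in> Ob P" "\<rho> \<in> carrier (fib P (prd P A A))"
  shows image_rel_closed [simp]: "image_rel F A \<rho> \<in> carrier (fib R (prd R (omap F A) (omap F A)))"
    and image_rel_generic: "inst R (omap F (prd P A A)) (omap F A) (omap F A) (image_rel F A \<rho>)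
      (amap F (prd P A A) A (pr1 P A A)) (amap F (prd P A A) A (pr2 P A A)) = fmap F (prd P A A) \<rho>"
    and image_rel_eqI: "\<lbrakk>\<sigma> \<in> carrier (fib R (prd R (omap F A) (omap F A)));
      inst R (omap F (prd P A A)) (omap F A) (omap F A) \<sigma>
      (amap F (prd P A A) A (pr1 P A A)) (amap F (prd P A A) A (pr2 P A A)) = fmap F (prd P A A) \<rho>\<rbrakk>
        \<Longrightarrow>
      image_rel F A \<rho> = \<sigma>"
proof -
  let ?FA = "omap F A" and ?FAA = "omap F (prd P A A)"
  let ?p = "amap F (prd P A A) A (pr1 P A A)" and ?q = "amap F (prd P A A) A (pr2 P A A)"
  obtain j where j [simp]: "j \<in> Hom R (prd R ?FA ?FA) ?FAA"
    and jc: "cmp R ?FAA (prd R ?FA ?FA) ?FAA j (pairing R ?FAA ?FA ?FA ?p ?q) = idn R ?FAA"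
    and cj: "cmp R (prd R ?FA ?FA) ?FAA (prd R ?FA ?FA) (pairing R ?FAA ?FA ?FA ?p ?q) j =
      idn R (prd R ?FA ?FA)"
    by (rule R.product_comparison_iso[OF product_image[of A A]]) simp_all
  have "inverse_arrow R ?FAA (prd R ?FA ?FA) (comparison F A A) = j"
    unfolding comparison_def Let_def dom cod
    by (rule R.inverse_arrow_eq[OF _ _ _ j jc cj]) simp_all
  then have im: "image_rel F A \<rho> = rei R (prd R ?FA ?FA) ?FAA j (fmap F (prd P A A) \<rho>)"
    unfolding image_rel_def Let_def by simp
  show "image_rel F A \<rho> \<in> carrier (fib R (prd R ?FA ?FA))" unfolding im by simp
  show "inst R ?FAA ?FA ?FA (image_rel F A \<rho>) ?p ?q = fmap F (prd P A A) \<rho>"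
    unfolding im inst_def using jc by simp
  assume s: "\<sigma> \<in> carrier (fib R (prd R ?FA ?FA))" and eq:
    "inst R ?FAA ?FA ?FA \<sigma> ?p ?q = fmap F (prd P A A) \<rho>"
  have "rei R (prd R ?FA ?FA) ?FAA j (inst R ?FAA ?FA ?FA \<sigma> ?p ?q) = \<sigma>"
    unfolding inst_def using s cj by simp
  then show "image_rel F A \<rho> = \<sigma>" unfolding im eq .
qed

text \<open>
  The pair of \<open>F f\<close> and \<open>F g\<close> is represented by the element \<open>F \<langle>f, g\<rangle>\<close> of \<open>F (A \<times> A)\<close>, and \<open>F\<close> is
  natural on predicates.
\<close>

lemma image_rel_amap:
  assumes [simp]: "A \<in> Ob P" "\<rho> \<in> carrier (fib P (prd P A A))" "Y \<in> Ob P" "f \<in> Hom P Y A"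
    "g \<in> Hom P Y A"
  shows "inst R (omap F Y) (omap F A) (omap F A) (image_rel F A \<rho>) (amap F Y A f) (amap F Y A g) =
    fmap F Y (inst P Y A A \<rho> f g)"
proof -
  have "fmap F Y (inst P Y A A \<rho> f g) =
    rei R (omap F Y) (omap F (prd P A A)) (amap F Y (prd P A A) (pairing P Y A A f g))
      (fmap F (prd P A A) \<rho>)"
    unfolding inst_def by (simp add: fmap_natural)
  then show ?thesis by (simp flip: image_rel_generic)
qed

lemma image_le:
  assumes le: "x \<le>[P,Y] y" and "\<gamma> \<le>[R,Z] rei R Z (omap F Y) z (fmap F Y x)"
    and "Y \<in> Ob P" "Z \<in> Ob R" "z \<in> Hom R Z (omap F Y)" "x \<in> carrier (fib P Y)"
      "y \<in> carrier (fib P Y)"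
    "\<gamma> \<in> carrier (fib R Z)"
  shows "\<gamma> \<le>[R,Z] rei R Z (omap F Y) z (fmap F Y y)"
  by (rule R.le_rei_mono[OF assms(2) fmap_mono[OF le]]) (use assms in simp_all)

text \<open>
  The hypothesis is an inequality over \<open>A \<times> A\<close>. Its image under \<open>F\<close>, reindexed along the element
  \<open>z\<close> of \<open>F (A \<times> A)\<close> that represents the pair \<open>x, y\<close>, is the conclusion.
\<close>

lemma image_rel_resp:
  assumes [simp]: "A \<in> Ob P" "B \<in> Ob P" "f \<in> Hom P A B" "\<rho> \<in> carrier (fib P (prd P A A))"
    "\<sigma> \<in> carrier (fib P (prd P B B))"
    and fr: "\<rho> \<le>[P,prd P A A] rei P (prd P A A) (prd P B B) (prod_arrow P A A B B f f) \<sigma>"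
    and [simp]: "Z \<in> Ob R" "x \<in> Hom R Z (omap F A)" "y \<in> Hom R Z (omap F A)" "\<gamma> \<in> carrier (fib R Z)"
    and le: "\<gamma> \<le>[R,Z] inst R Z (omap F A) (omap F A) (image_rel F A \<rho>) x y"
  shows "\<gamma> \<le>[R,Z] inst R Z (omap F B) (omap F B) (image_rel F B \<sigma>)
    (cmp R Z (omap F A) (omap F B) (amap F A B f) x)
      (cmp R Z (omap F A) (omap F B) (amap F A B f) y)"
proof -
  obtain z where z [simp]: "z \<in> Hom R Z (omap F (prd P A A))"
    and xy: "cmp R Z (omap F (prd P A A)) (omap F A) (amap F (prd P A A) A (pr1 P A A)) z = x"
    "cmp R Z (omap F (prd P A A)) (omap F A) (amap F (prd P A A) A (pr2 P A A)) z = y"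
    by (rule product_element[of A A Z x y]) simp_all
  have "\<gamma> \<le>[R,Z] rei R Z (omap F (prd P A A)) z (fmap F (prd P A A) \<rho>)"
    using le xy by (simp flip: image_rel_generic)
  from image_le[OF fr this] show ?thesis
    by (simp add: xy flip: image_rel_amap)
qed

lemma image_equiv_rel:
  assumes [simp]: "A \<in> Ob P" and e: "equiv_rel P A \<rho>"
  shows "equiv_rel R (omap F A) (image_rel F A \<rho>)"
proof -
  note [simp] = P.equiv_rel_closed[OF e]
  let ?F = "omap F A" and ?\<rho> = "image_rel F A \<rho>"
  show ?thesis
  proof (rule R.equiv_relI)
    fix Z x y w \<gamma>
    assume [simp]: "Z \<in> Ob R" "x \<in> Hom R Z ?F" "\<gamma> \<in> carrier (fib R Z)"
    \<comment> \<open>The value of \<open>\<rho>\<close> on the diagonal is a greatest element, and \<open>F\<close> preserves the empty meet.\<close>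
    have "\<gamma>' \<le>[R,?F] inst R ?F ?F ?F ?\<rho> (amap F A A (idn P A)) (amap F A A (idn P A))"
      if [simp]: "\<gamma>' \<in> carrier (fib R ?F)" for \<gamma>'
      unfolding image_rel_amap[OF \<open>A \<in> Ob P\<close> P.equiv_rel_closed[OF e]
        \<open>A \<in> Ob P\<close> P.idn_Hom P.idn_Hom, OF \<open>A \<in> Ob P\<close> \<open>A \<in> Ob P\<close>]
      by (rule fmap_top) (simp_all add: P.equiv_refl[OF e])
    then have "\<gamma> \<le>[R,Z] rei R Z ?F x (inst R ?F ?F ?F ?\<rho> (amap F A A (idn P A))
      (amap F A A (idn P A)))"
      by (intro R.rei_top) simp_all
    then show "\<gamma> \<le>[R,Z] inst R Z ?F ?F ?\<rho> x x" by simp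
    assume [simp]: "y \<in> Hom R Z ?F" and le: "\<gamma> \<le>[R,Z] inst R Z ?F ?F ?\<rho> x y"
    obtain z where z [simp]: "z \<in> Hom R Z (omap F (prd P A A))"
      and xy: "cmp R Z (omap F (prd P A A)) ?F (amap F (prd P A A) A (pr1 P A A)) z = x"
      "cmp R Z (omap F (prd P A A)) ?F (amap F (prd P A A) A (pr2 P A A)) z = y"
      by (rule product_element[of A A Z x y]) simp_all
    have 1: "\<gamma> \<le>[R,Z] rei R Z (omap F (prd P A A)) z (fmap F (prd P A A) \<rho>)"
      using le xy by (simp flip: image_rel_generic)
    have "\<rho> \<le>[P,prd P A A] inst P (prd P A A) A A \<rho> (pr2 P A A) (pr1 P A A)"
      by (rule P.equiv_sym[OF e]) simp_all
    from image_le[OF this 1] show "\<gamma> \<le>[R,Z] inst R Z ?F ?F ?\<rho> y x"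
      by (simp add: xy flip: image_rel_amap)
    assume [simp]: "w \<in> Hom R Z ?F" and le': "\<gamma> \<le>[R,Z] inst R Z ?F ?F ?\<rho> y w"
    let ?W = "prd P (prd P A A) A"
    let ?p = "cmp P ?W (prd P A A) A (pr1 P A A) (pr1 P (prd P A A) A)"
    let ?q = "cmp P ?W (prd P A A) A (pr2 P A A) (pr1 P (prd P A A) A)"
    let ?r = "pr2 P (prd P A A) A"
    let ?m = "inst P ?W A A \<rho> ?p ?q \<sqinter>\<^bsub>fib P ?W\<^esub> inst P ?W A A \<rho> ?q ?r"
    \<comment> \<open>The triple \<open>x, y, w\<close> is represented by one element \<open>v\<close> of \<open>F ((A \<times> A) \<times> A)\<close>.\<close>
    obtain v where v [simp]: "v \<in> Hom R Z (omap F ?W)"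
      and vz: "cmp R Z (omap F ?W) (omap F (prd P A A))
        (amap F ?W (prd P A A) (pr1 P (prd P A A) A)) v = z"
      and vw: "cmp R Z (omap F ?W) ?F (amap F ?W A ?r) v = w"
      by (rule product_element[of "prd P A A" A Z z w]) simp_all
    have "?m \<le>[P,?W] inst P ?W A A \<rho> ?p ?r"
      by (rule P.equiv_trans[OF e, of _ ?p ?q]) (simp_all add: P.meet_fib_le1 P.meet_fib_le2)
    moreover have "\<gamma> \<le>[R,Z] rei R Z (omap F ?W) v (fmap F ?W ?m)"
      using le le' by (simp add: vz vw xy flip: image_rel_amap)
    ultimately have "\<gamma> \<le>[R,Z] rei R Z (omap F ?W) v (fmap F ?W (inst P ?W A A \<rho> ?p ?r))"
      by (rule image_le) simp_all
    then show "\<gamma> \<le>[R,Z] inst R Z ?F ?F ?\<rho> x w"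
      by (simp add: vz vw xy flip: image_rel_amap)
  qed simp_all
qed

lemma image_descent:
  assumes [simp]: "A \<in> Ob P" "\<rho> \<in> carrier (fib P (prd P A A))" and \<alpha>: "\<alpha> \<in> descent P A \<rho>"
  shows "fmap F A \<alpha> \<in> descent R (omap F A) (image_rel F A \<rho>)"
proof -
  note [simp] = P.descent_closed[OF \<alpha>]
  let ?m = "rei P (prd P A A) A (pr1 P A A) \<alpha> \<sqinter>\<^bsub>fib P (prd P A A)\<^esub> \<rho>"
  have m: "?m \<le>[P,prd P A A] rei P (prd P A A) A (pr2 P A A) \<alpha>"
    by (rule P.descent_subst[OF \<alpha>, of _ "pr1 P A A"]) (simp_all add: P.meet_fib_le1 P.meet_fib_le2)
  show ?thesis
  proof (rule R.descentI)
    fix Z x y \<gamma>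
    assume [simp]: "Z \<in> Ob R" "x \<in> Hom R Z (omap F A)" "y \<in> Hom R Z (omap F A)"
      "\<gamma> \<in> carrier (fib R Z)"
      and le: "\<gamma> \<le>[R,Z] rei R Z (omap F A) x (fmap F A \<alpha>)"
      "\<gamma> \<le>[R,Z] inst R Z (omap F A) (omap F A) (image_rel F A \<rho>) x y"
    obtain z where z [simp]: "z \<in> Hom R Z (omap F (prd P A A))"
      and xy: "cmp R Z (omap F (prd P A A)) (omap F A) (amap F (prd P A A) A (pr1 P A A)) z = x"
      "cmp R Z (omap F (prd P A A)) (omap F A) (amap F (prd P A A) A (pr2 P A A)) z = y"
      by (rule product_element[of A A Z x y]) simp_all
    have "\<gamma> \<le>[R,Z] rei R Z (omap F (prd P A A)) z (fmap F (prd P A A) ?m)"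
      using le xy by (simp add: fmap_natural flip: image_rel_generic)
    from image_le[OF m this] show "\<gamma> \<le>[R,Z] rei R Z (omap F A) y (fmap F A \<alpha>)"
      by (simp add: fmap_natural xy)
  qed simp_all
qed

text \<open>
  As \<open>F\<close> preserves finite meets, it turns the product relation into a componentwise relation. This
  makes \<open>T F\<close> preserve products.
\<close>

lemma image_prod_rel:
  assumes [simp]: "A \<in> Ob P" "B \<in> Ob P" "\<rho> \<in> carrier (fib P (prd P A A))"
    "\<sigma> \<in> carrier (fib P (prd P B B))"
    "Z \<in> Ob R" "x \<in> Hom R Z (omap F (prd P A B))" "y \<in> Hom R Z (omap F (prd P A B))"
      "\<gamma> \<in> carrier (fib R Z)"
  shows "\<gamma> \<le>[R,Z] inst R Z (omap F (prd P A B)) (omap F (prd P A B))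
    (image_rel F (prd P A B) (prod_rel P A \<rho> B \<sigma>)) x y \<longleftrightarrow>
    \<gamma> \<le>[R,Z] inst R Z (omap F A) (omap F A) (image_rel F A \<rho>)
      (cmp R Z (omap F (prd P A B)) (omap F A) (amap F (prd P A B) A (pr1 P A B)) x)
      (cmp R Z (omap F (prd P A B)) (omap F A) (amap F (prd P A B) A (pr1 P A B)) y) \<and>
    \<gamma> \<le>[R,Z] inst R Z (omap F B) (omap F B) (image_rel F B \<sigma>)
      (cmp R Z (omap F (prd P A B)) (omap F B) (amap F (prd P A B) B (pr2 P A B)) x)
      (cmp R Z (omap F (prd P A B)) (omap F B) (amap F (prd P A B) B (pr2 P A B)) y)"
proof -
  let ?W = "prd P A B" and ?V = "prd P (prd P A B) (prd P A B)"
  obtain z where z [simp]: "z \<in> Hom R Z (omap F ?V)"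
    and xy: "cmp R Z (omap F ?V) (omap F ?W) (amap F ?V ?W (pr1 P ?W ?W)) z = x"
    "cmp R Z (omap F ?V) (omap F ?W) (amap F ?V ?W (pr2 P ?W ?W)) z = y"
    by (rule product_element[of ?W ?W Z x y]) simp_all
  have "inst R Z (omap F ?W) (omap F ?W) (image_rel F ?W (prod_rel P A \<rho> B \<sigma>)) x y =
    rei R Z (omap F ?V) z (fmap F ?V (prod_rel P A \<rho> B \<sigma>))"
    by (simp add: xy flip: image_rel_generic)
  then show ?thesis
    unfolding prod_rel_def Let_def by (simp add: xy flip: image_rel_amap)
qed

end

section \<open>The quotient completion of 1-cells and 2-cells\<close>

lemma quotient_map_simps [simp]:
  "dom_d (quotient_map e F) = quotient_doctrine e (dom_d F)"
  "cod_d (quotient_map e F) = quotient_doctrine e (cod_d F)"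
  "X \<in> Ob (quotient_doctrine e (dom_d F)) \<Longrightarrow>
    omap (quotient_map e F) X = e (omap F (under e X), image_rel F (under e X) (rel e X))"
  "\<lbrakk>X \<in> Ob (quotient_doctrine e (dom_d F)); Y \<in> Ob (quotient_doctrine e (dom_d F));
    f \<in> Hom (quotient_doctrine e (dom_d F)) X Y\<rbrakk> \<Longrightarrow>
    amap (quotient_map e F) X Y f = amap F (under e X) (under e Y) f"
  "\<lbrakk>X \<in> Ob (quotient_doctrine e (dom_d F)); \<alpha> \<in> descent (dom_d F) (under e X) (rel e X)\<rbrakk> \<Longrightarrow>
    fmap (quotient_map e F) X \<alpha> = fmap F (under e X) \<alpha>"
  by (simp_all add: quotient_map_def image_rel_def Let_def)

lemma quotient_trans_simps [simp]:
  "dom_m (quotient_trans e \<theta>) = quotient_map e (dom_m \<theta>)"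
  "cod_m (quotient_trans e \<theta>) = quotient_map e (cod_m \<theta>)"
  "X \<in> Ob (quotient_doctrine e (dom_d (dom_m \<theta>))) \<Longrightarrow>
    component (quotient_trans e \<theta>) X = component \<theta> (under e X)"
  by (simp_all add: quotient_trans_def)

lemma quotient_unit_simps [simp]:
  "dom_d (quotient_unit e P) = P" "cod_d (quotient_unit e P) = quotient_doctrine e P"
  "A \<in> Ob P \<Longrightarrow> omap (quotient_unit e P) A = e (A, delta P A)"
  "\<lbrakk>A \<in> Ob P; B \<in> Ob P; f \<in> Hom P A B\<rbrakk> \<Longrightarrow> amap (quotient_unit e P) A B f = f"
  "\<lbrakk>A \<in> Ob P; \<alpha> \<in> carrier (fib P A)\<rbrakk> \<Longrightarrow> fmap (quotient_unit e P) A \<alpha> = \<alpha>"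
  by (simp_all add: quotient_unit_def)

lemma quotient_mult_simps [simp]:
  "dom_d (quotient_mult e P) = quotient_doctrine e (quotient_doctrine e P)"
  "cod_d (quotient_mult e P) = quotient_doctrine e P"
  "X \<in> Ob (quotient_doctrine e (quotient_doctrine e P)) \<Longrightarrow>
    omap (quotient_mult e P) X = e (under e (under e X), rel e X)"
  "\<lbrakk>X \<in> Ob (quotient_doctrine e (quotient_doctrine e P)); Y \<in>
    Ob (quotient_doctrine e (quotient_doctrine e P));
    f \<in> Hom (quotient_doctrine e (quotient_doctrine e P)) X Y\<rbrakk> \<Longrightarrow> amap (quotient_mult e P) X Y f = f"
  "\<lbrakk>X \<in> Ob (quotient_doctrine e (quotient_doctrine e P));
    \<alpha> \<in> descent (quotient_doctrine e P) (under e X) (rel e X)\<rbrakk> \<Longrightarrow> fmap (quotient_mult e P) X \<alpha> = \<alpha>"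
  by (simp_all add: quotient_mult_def Let_def)

lemma (in elementary_doctrine) quotient_completionI: "inj e \<Longrightarrow> quotient_completion P e"
  by (intro quotient_completion.intro quotient_completion_axioms.intro elementary_doctrine_axioms)

locale quotient_hom = ed_hom P R F for P R :: "('o, 'm, 'p) doctrine"
  and F :: "('o, 'm, 'p) doctrine_map" +
  fixes e :: "'o \<times> 'p \<Rightarrow> 'o"
  assumes inj_e: "inj e"
begin

sublocale PQ: quotient_completion P e by (rule P.quotient_completionI[OF inj_e])
sublocale RQ: quotient_completion R e by (rule R.quotient_completionI[OF inj_e])

abbreviation "TF \<equiv> quotient_map e F"

lemma omap_TF_Ob [simp]: "X \<in> Ob PQ.Q \<Longrightarrow> e (omap F (under e X), image_rel F (under e X) (rel e X)) \<in>
  Ob RQ.Q"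
  by (intro RQ.e_Ob image_equiv_rel PQ.r_equiv) simp_all

lemma amap_TF_Hom:
  assumes X [simp]: "X \<in> Ob PQ.Q" and Y [simp]: "Y \<in> Ob PQ.Q" and f: "f \<in> Hom PQ.Q X Y"
  shows "amap F (under e X) (under e Y) f \<in> Hom RQ.Q
    (e (omap F (under e X), image_rel F (under e X) (rel e X)))
    (e (omap F (under e Y), image_rel F (under e Y) (rel e Y)))"
proof -
  note [simp] = PQ.Q_HomD[OF f]
  show ?thesis
    using image_rel_resp[of "under e X" "under e Y" f "rel e X" "rel e Y"] f[unfolded PQ.Q_Hom_iff]
    by (intro RQ.Q_HomI) (simp_all del: P.rei_prod_arrow)
qed

lemma quotient_map_hom: "quotient_map e F \<in> hom1 ED PQ.Q RQ.Q"
proof (rule ed_homI)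
  show "elementary_doctrine PQ.Q" "elementary_doctrine RQ.Q"
    by (rule PQ.Q.elementary_doctrine_axioms RQ.Q.elementary_doctrine_axioms)+
  show "omap TF \<in> Ob PQ.Q \<rightarrow>\<^sub>E Ob RQ.Q"
    using omap_TF_Ob by (auto simp: quotient_map_def image_rel_def Let_def)
  show "amap TF \<in> (\<Pi>\<^sub>E X \<in> Ob PQ.Q. \<Pi>\<^sub>E Y \<in> Ob PQ.Q. Hom PQ.Q X Y \<rightarrow>\<^sub>E Hom RQ.Q (omap TF X)
    (omap TF Y))"
    using amap_TF_Hom by (auto simp: quotient_map_def image_rel_def Let_def)
  show "fmap TF \<in> (\<Pi>\<^sub>E X \<in> Ob PQ.Q. carrier (fib PQ.Q X) \<rightarrow>\<^sub>E carrier (fib RQ.Q (omap TF X)))"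
    using image_descent by (auto simp: quotient_map_def image_rel_def Let_def)
  fix X assume X [simp]: "X \<in> Ob PQ.Q"
  have tf: "omap TF X = e (omap F (under e X), image_rel F (under e X) (rel e X))" by simp
  show "amap TF X X (idn PQ.Q X) = idn RQ.Q (omap TF X)"
    using PQ.Q.idn_Hom[OF X] by simp
  show "preserves_finite_meets (fib PQ.Q X) (fib RQ.Q (omap TF X)) (fmap TF X)"
  proof (rule preserves_finite_meets_cong[where h = "fmap F (under e X)"])
    show "preserves_finite_meets (fib PQ.Q X) (fib RQ.Q (omap TF X)) (fmap F (under e X))"
      unfolding PQ.Q_fib RQ.Q_fib tf RQ.U_e RQ.r_e
      by (rule preserves_finite_meets_restrict[OF fmap_meets P.fib R.fib PQ.descent_subset
        P.descent_Inf
            RQ.descent_subset R.descent_Inf image_descent]) simp_all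
  qed (simp_all add: PQ.Q.fib)
  show "fmap TF (prd PQ.Q X X) (delta PQ.Q X) =
    inst RQ.Q (omap TF (prd PQ.Q X X)) (omap TF X) (omap TF X) (delta RQ.Q (omap TF X))
      (amap TF (prd PQ.Q X X) X (pr1 PQ.Q X X)) (amap TF (prd PQ.Q X X) X (pr2 PQ.Q X X))"
  proof -
    have p: "pr1 PQ.Q X X \<in> Hom PQ.Q (prd PQ.Q X X) X" "pr2 PQ.Q X X \<in> Hom PQ.Q (prd PQ.Q X X) X"
      by (rule PQ.Q.pr1_Hom[OF X X] PQ.Q.pr2_Hom[OF X X])+
    have d: "rel e X \<in> descent P (prd P (under e X) (under e X))
      (prod_rel P (under e X) (rel e X) (under e X) (rel e X))"
      using PQ.Q.delta_closed[OF X] by simp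
    show ?thesis
      using amap_TF_Hom[OF PQ.Q_prd_Ob[OF X X] X p(1)] amap_TF_Hom[OF PQ.Q_prd_Ob[OF X X] X p(2)] p
        omap_TF_Ob[OF PQ.Q_prd_Ob[OF X X]] d
      by (simp add: image_rel_generic)
  qed
  fix Y assume Y [simp]: "Y \<in> Ob PQ.Q"
  show "amap TF X Z (cmp PQ.Q X Y Z g f) =
        cmp RQ.Q (omap TF X) (omap TF Y) (omap TF Z) (amap TF Y Z g) (amap TF X Y f)"
    if [simp]: "Z \<in> Ob PQ.Q" and f: "f \<in> Hom PQ.Q X Y" and g: "g \<in> Hom PQ.Q Y Z" for Z f g
    using PQ.Q.cmp_Hom[OF X Y _ f g] f g PQ.Q_HomD[OF f] PQ.Q_HomD[OF g] by simp
  show "fmap TF X (rei PQ.Q X Y f \<alpha>) = rei RQ.Q (omap TF X) (omap TF Y) (amap TF X Y f)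
    (fmap TF Y \<alpha>)"
    if f: "f \<in> Hom PQ.Q X Y" and \<alpha>: "\<alpha> \<in> carrier (fib PQ.Q Y)" for f \<alpha>
    using f \<alpha> PQ.Q.rei_closed[OF X Y f \<alpha>] PQ.Q_HomD[OF f] P.descent_closed[of \<alpha>]
      by (simp add: fmap_natural)
  show "is_product RQ.Q (omap TF X) (omap TF Y) (omap TF (prd PQ.Q X Y))
    (amap TF (prd PQ.Q X Y) X (pr1 PQ.Q X Y)) (amap TF (prd PQ.Q X Y) Y (pr2 PQ.Q X Y))"
  proof -
    let ?A = "under e X" and ?B = "under e Y"
    let ?W = "omap TF (prd PQ.Q X Y)"
    have p: "pr1 PQ.Q X Y \<in> Hom PQ.Q (prd PQ.Q X Y) X" "pr2 PQ.Q X Y \<in> Hom PQ.Q (prd PQ.Q X Y) Y"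
      by (rule PQ.Q.pr1_Hom[OF X Y] PQ.Q.pr2_Hom[OF X Y])+
    have ap: "amap TF (prd PQ.Q X Y) X (pr1 PQ.Q X Y) = amap F (prd P ?A ?B) ?A (pr1 P ?A ?B)"
      "amap TF (prd PQ.Q X Y) Y (pr2 PQ.Q X Y) = amap F (prd P ?A ?B) ?B (pr2 P ?A ?B)"
      using p by simp_all
    have W [simp]: "?W \<in> Ob RQ.Q" "under e ?W = omap F (prd P ?A ?B)"
      "rel e ?W = image_rel F (prd P ?A ?B) (prod_rel P ?A (rel e X) ?B (rel e Y))"
      using omap_TF_Ob[OF PQ.Q_prd_Ob[OF X Y]] by simp_all
    show ?thesis
      unfolding is_product_def
    proof (intro conjI ballI)
      show "?W \<in> Ob RQ.Q" by (rule W(1))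
      show "amap TF (prd PQ.Q X Y) X (pr1 PQ.Q X Y) \<in> Hom RQ.Q ?W (omap TF X)"
        "amap TF (prd PQ.Q X Y) Y (pr2 PQ.Q X Y) \<in> Hom RQ.Q ?W (omap TF Y)"
        using amap_TF_Hom[OF PQ.Q_prd_Ob[OF X Y] X p(1)] amap_TF_Hom[OF PQ.Q_prd_Ob[OF X Y] Y p(2)]
          p by simp_all
      fix Z f g assume Z: "Z \<in> Ob RQ.Q" and f: "f \<in> Hom RQ.Q Z (omap TF X)"
        and g: "g \<in> Hom RQ.Q Z (omap TF Y)"
      note [simp] = Z
      have [simp]: "f \<in> Hom R (under e Z) (omap F ?A)" "g \<in> Hom R (under e Z) (omap F ?B)"
        using RQ.Q_HomD[OF f] RQ.Q_HomD[OF g] by simp_all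
      obtain h where h [simp]: "h \<in> Hom R (under e Z) (omap F (prd P ?A ?B))"
        and ph: "cmp R (under e Z) (omap F (prd P ?A ?B)) (omap F ?A)
          (amap F (prd P ?A ?B) ?A (pr1 P ?A ?B)) h = f"
        "cmp R (under e Z) (omap F (prd P ?A ?B)) (omap F ?B)
          (amap F (prd P ?A ?B) ?B (pr2 P ?A ?B)) h = g"
        by (rule product_element[of ?A ?B "under e Z" f g]) simp_all
      \<comment> \<open>The mediating arrow respects the relations since they are compared componentwise on the
        product.\<close>
      have hQ: "h \<in> Hom RQ.Q Z ?W"
      proof (rule RQ.Q_HomI)
        show "h \<in> Hom R (under e Z) (under e ?W)" unfolding W by simp
        fix V u v \<gamma>
        assume V: "V \<in> Ob R" "u \<in> Hom R V (under e Z)" "v \<in> Hom R V (under e Z)"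
          "\<gamma> \<in> carrier (fib R V)"
          and le: "\<gamma> \<le>[R,V] inst R V (under e Z) (under e Z) (rel e Z) u v"
        note [simp] = V
        have "\<gamma> \<le>[R,V] inst R V (omap F ?A) (omap F ?A) (image_rel F ?A (rel e X))
            (cmp R V (under e Z) (omap F ?A) f u) (cmp R V (under e Z) (omap F ?A) f v)"
          using RQ.Q_Hom_resp[OF f _ _ V le] by simp
        moreover have "\<gamma> \<le>[R,V] inst R V (omap F ?B) (omap F ?B) (image_rel F ?B (rel e Y))
            (cmp R V (under e Z) (omap F ?B) g u) (cmp R V (under e Z) (omap F ?B) g v)"
          using RQ.Q_Hom_resp[OF g _ _ V le] by simp
        ultimately show "\<gamma> \<le>[R,V] inst R V (under e ?W) (under e ?W) (rel e ?W)
            (cmp R V (under e Z) (under e ?W) h u) (cmp R V (under e Z) (under e ?W) h v)"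
          unfolding W ph[symmetric] by (simp add: image_prod_rel)
      qed (rule Z W(1))+
      show "\<exists>!h. h \<in> Hom RQ.Q Z ?W \<and>
        cmp RQ.Q Z ?W (omap TF X) (amap TF (prd PQ.Q X Y) X (pr1 PQ.Q X Y)) h = f \<and>
        cmp RQ.Q Z ?W (omap TF Y) (amap TF (prd PQ.Q X Y) Y (pr2 PQ.Q X Y)) h = g"
      proof (rule ex1I[of _ h])
        show "h \<in> Hom RQ.Q Z ?W \<and>
          cmp RQ.Q Z ?W (omap TF X) (amap TF (prd PQ.Q X Y) X (pr1 PQ.Q X Y)) h = f \<and>
          cmp RQ.Q Z ?W (omap TF Y) (amap TF (prd PQ.Q X Y) Y (pr2 PQ.Q X Y)) h = g"
          unfolding ap using hQ ph by simp
        fix k assume k: "k \<in> Hom RQ.Q Z ?W \<and>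
          cmp RQ.Q Z ?W (omap TF X) (amap TF (prd PQ.Q X Y) X (pr1 PQ.Q X Y)) k = f \<and>
          cmp RQ.Q Z ?W (omap TF Y) (amap TF (prd PQ.Q X Y) Y (pr2 PQ.Q X Y)) k = g"
        have k1: "k \<in> Hom R (under e Z) (omap F (prd P ?A ?B))"
          using RQ.Q_HomD[of k Z ?W] k unfolding W by blast
        have k2: "cmp R (under e Z) (omap F (prd P ?A ?B)) (omap F ?A)
          (amap F (prd P ?A ?B) ?A (pr1 P ?A ?B)) k = f"
          "cmp R (under e Z) (omap F (prd P ?A ?B)) (omap F ?B)
            (amap F (prd P ?A ?B) ?B (pr2 P ?A ?B)) k = g"
          using k unfolding ap by simp_all
        show "k = h"
          by (rule is_product_unique[OF product_image[of ?A ?B], of "under e Z"])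
            (use k1 k2 ph in simp_all)
      qed
    qed
  qed
qed simp_all

end

text \<open>
  The inequality that makes \<open>\<theta>\<close> a 2-cell, at the predicate \<open>\<rho>\<close> over \<open>A \<times> A\<close>, says that \<open>\<theta>\<close>
  respects the transported relations: naturality at the projections identifies the component at
  \<open>A \<times> A\<close> with the component at \<open>A\<close> on both elements of the pair.
\<close>

lemma image_rel_trans:
  assumes "ed_cell P R F G \<theta>" and [simp]: "A \<in> Ob P" "\<rho> \<in> carrier (fib P (prd P A A))"
    "Z \<in> Ob R" "x \<in> Hom R Z (omap F A)" "y \<in> Hom R Z (omap F A)" "\<gamma> \<in> carrier (fib R Z)"
    and le: "\<gamma> \<le>[R,Z] inst R Z (omap F A) (omap F A) (image_rel F A \<rho>) x y"
  shows "\<gamma> \<le>[R,Z] inst R Z (omap G A) (omap G A) (image_rel G A \<rho>)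
    (cmp R Z (omap F A) (omap G A) (component \<theta> A) x)
      (cmp R Z (omap F A) (omap G A) (component \<theta> A) y)"
proof -
  interpret ed_cell P R F G \<theta> by (rule assms(1))
  let ?AA = "prd P A A"
  obtain z where z [simp]: "z \<in> Hom R Z (omap F ?AA)"
    and xy: "cmp R Z (omap F ?AA) (omap F A) (amap F ?AA A (pr1 P A A)) z = x"
    "cmp R Z (omap F ?AA) (omap F A) (amap F ?AA A (pr2 P A A)) z = y"
    by (rule F.product_element[of A A Z x y]) simp_all
  have "\<gamma> \<le>[R,Z] rei R Z (omap F ?AA) z (fmap F ?AA \<rho>)"
    using le xy by (simp flip: F.image_rel_generic)
  then have "\<gamma> \<le>[R,Z] rei R Z (omap F ?AA) z
      (rei R (omap F ?AA) (omap G ?AA) (component \<theta> ?AA) (fmap G ?AA \<rho>))"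
    by (rule F.R.le_rei_mono[OF _ fmap_le]) simp_all
  then have "\<gamma> \<le>[R,Z] inst R Z (omap G A) (omap G A) (image_rel G A \<rho>)
      (cmp R Z (omap F ?AA) (omap G A) (cmp R (omap F ?AA) (omap G ?AA) (omap G A)
        (amap G ?AA A (pr1 P A A)) (component \<theta> ?AA)) z)
      (cmp R Z (omap F ?AA) (omap G A) (cmp R (omap F ?AA) (omap G ?AA) (omap G A)
        (amap G ?AA A (pr2 P A A)) (component \<theta> ?AA)) z)"
    by (simp flip: G.image_rel_generic)
  then show ?thesis
    by (simp add: xy flip: natural)
qed

lemma quotient_trans_cell:
  assumes F: "F \<in> hom1 ED P R" and G: "G \<in> hom1 ED P R" and t: "\<theta> \<in> hom2 ED F G" and e: "inj e"
  shows "quotient_trans e \<theta> \<in> hom2 ED (quotient_map e F) (quotient_map e G)"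
proof -
  interpret t: ed_cell P R F G \<theta> by (rule hom2D[OF F G t])
  interpret F: quotient_hom P R F e by standard (rule e)
  interpret G: quotient_hom P R G e by standard (rule e)
  have c: "component \<theta> (under e X) \<in> Hom F.RQ.Q (omap (quotient_map e F) X)
    (omap (quotient_map e G) X)"
    if X [simp]: "X \<in> Ob F.PQ.Q" for X
    by (rule F.RQ.Q_HomI)
      (use image_rel_trans[OF t.ed_cell_axioms, of "under e X" "rel e X"] G.omap_TF_Ob[OF X]
        in simp_all)
  show ?thesis
  proof (rule ed_cellI[OF F.quotient_map_hom G.quotient_map_hom])
    show "component (quotient_trans e \<theta>) \<in> (\<Pi>\<^sub>E X \<in>
      Ob F.PQ.Q. Hom F.RQ.Q (omap (quotient_map e F) X) (omap (quotient_map e G) X))"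
      using c by (simp add: quotient_trans_def)
    fix X assume X [simp]: "X \<in> Ob F.PQ.Q"
    show "cmp F.RQ.Q (omap (quotient_map e F) X) (omap (quotient_map e F) Y)
      (omap (quotient_map e G) Y)
        (component (quotient_trans e \<theta>) Y) (amap (quotient_map e F) X Y f) =
      cmp F.RQ.Q (omap (quotient_map e F) X) (omap (quotient_map e G) X) (omap (quotient_map e G) Y)
        (amap (quotient_map e G) X Y f) (component (quotient_trans e \<theta>) X)"
      if [simp]: "Y \<in> Ob F.PQ.Q" and f: "f \<in> Hom F.PQ.Q X Y" for Y f
      using f F.PQ.Q_HomD[OF f] by (simp add: t.natural)
    show "fmap (quotient_map e F) X \<alpha> \<le>[F.RQ.Q,omap (quotient_map e F) X]
      rei F.RQ.Q (omap (quotient_map e F) X) (omap (quotient_map e G) X)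
        (component (quotient_trans e \<theta>) X)
        (fmap (quotient_map e G) X \<alpha>)" if "\<alpha> \<in> carrier (fib F.PQ.Q X)" for \<alpha>
      using that t.F.P.descent_closed[of \<alpha>] by (simp add: t.fmap_le)
  qed simp_all
qed

section \<open>Unit and multiplication\<close>

context quotient_completion
begin

text \<open>
  Products are preserved because equality on \<open>A \<times> B\<close> is componentwise equality.
\<close>

lemma quotient_unit_hom: "quotient_unit e P \<in> hom1 ED P Q"
proof (rule ed_homI)
  let ?u = "quotient_unit e P"
  show "elementary_doctrine P" "elementary_doctrine Q"
    by (rule elementary_doctrine_axioms Q.elementary_doctrine_axioms)+
  show "omap ?u \<in> Ob P \<rightarrow>\<^sub>E Ob Q"
    by (auto simp: quotient_unit_def)
  show "amap ?u \<in> (\<Pi>\<^sub>E A \<in> Ob P. \<Pi>\<^sub>E B \<in> Ob P.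
      Hom P A B \<rightarrow>\<^sub>E Hom Q (omap ?u A) (omap ?u B))"
    using disc_Hom by (auto simp: quotient_unit_def)
  show "fmap ?u \<in> (\<Pi>\<^sub>E A \<in> Ob P. carrier (fib P A) \<rightarrow>\<^sub>E carrier (fib Q (omap ?u A)))"
    by (auto simp: quotient_unit_def descent_delta)
  fix A assume A [simp]: "A \<in> Ob P"
  show "preserves_finite_meets (fib P A) (fib Q (omap ?u A)) (fmap ?u A)"
  proof (rule preserves_finite_meets_cong[OF _ _ fib[OF A]])
    have "fib Q (e (A, delta P A)) = fib P A" by (simp add: Q_fib descent_delta)
    then show "preserves_finite_meets (fib P A) (fib Q (omap ?u A)) (\<lambda>x. x)"
      using preserves_finite_meets_id by simp
  qed simp
  show prod: "is_product Q (omap ?u A) (omap ?u B) (omap ?u (prd P A B))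
        (amap ?u (prd P A B) A (pr1 P A B)) (amap ?u (prd P A B) B (pr2 P A B))"
    if [simp]: "B \<in> Ob P" for B
  proof -
    have "prd Q (e (A, delta P A)) (e (B, delta P B)) = e (prd P A B, delta P (prd P A B))"
      by (rule Q_eqI) (simp_all add: delta_prd)
    then show ?thesis using Q.prd[of "e (A, delta P A)" "e (B, delta P B)"] by simp
  qed
  show "fmap ?u (prd P A A) (delta P A) =
      inst Q (omap ?u (prd P A A)) (omap ?u A) (omap ?u A)
        (delta Q (omap ?u A))
        (amap ?u (prd P A A) A (pr1 P A A)) (amap ?u (prd P A A) A (pr2 P A A))"
    by (simp add: disc_Hom)
qed simp_all

end

text \<open>
  A locale of its own: interpreting \<open>quotient_completion\<close> for \<open>Q\<close> within \<open>quotient_completion\<close>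
  itself would iterate the completion without end.
\<close>

locale iterated_quotient_completion = quotient_completion P e
  for P :: "('o, 'm, 'p) doctrine" and e :: "'o \<times> 'p \<Rightarrow> 'o"
begin

sublocale QQ: quotient_completion Q e by (rule Q.quotient_completionI[OF inj_e])

lemma mult_Ob [simp]:
  assumes X: "X \<in> Ob QQ.Q"
  shows "e (U (U X), r X) \<in> Ob Q"
  using QQ.r_equiv[OF X] Q_equiv_rel_iff[OF QQ.U_Ob[OF X]] X by simp

lemma mult_r_closed [simp]: "X \<in> Ob QQ.Q \<Longrightarrow> r X \<in> carrier (fib P (prd P (U (U X)) (U (U X))))"
  using r_closed[OF mult_Ob] by simp

lemma QQ_descent: "X \<in> Ob QQ.Q \<Longrightarrow> descent Q (U X) (r X) = descent P (U (U X)) (r X)"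
  by (rule Q_descent[OF QQ.U_Ob QQ.r_equiv])

lemma QQ_fib: "X \<in> Ob QQ.Q \<Longrightarrow> fib QQ.Q X = fib Q (e (U (U X), r X))"
  by (simp add: QQ.Q_fib Q_fib QQ_descent)

lemma mult_Hom:
  assumes X [simp]: "X \<in> Ob QQ.Q" and Y [simp]: "Y \<in> Ob QQ.Q" and f: "f \<in> Hom QQ.Q X Y"
  shows "f \<in> Hom Q (e (U (U X), r X)) (e (U (U Y), r Y))"
proof (rule Q_HomI)
  note fQ = QQ.Q_HomD[OF f]
  note [simp] = Q_HomD[OF fQ]
  show "f \<in> Hom P (U (e (U (U X), r X))) (U (e (U (U Y), r Y)))" by simp
  fix Z u v \<gamma>
  assume Z [simp]: "Z \<in> Ob P" and u: "u \<in> Hom P Z (U (e (U (U X), r X)))"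
    and v: "v \<in> Hom P Z (U (e (U (U X), r X)))"
    and \<gamma> [simp]: "\<gamma> \<in> carrier (fib P Z)"
    and le: "\<gamma> \<le>[P,Z] inst P Z (U (e (U (U X), r X))) (U (e (U (U X), r X))) (r (e (U (U X), r X)))
      u v"
  let ?Z = "e (Z, delta P Z)"
  have [simp]: "u \<in> Hom P Z (U (U X))" "v \<in> Hom P Z (U (U X))" using u v by simp_all
  have uv [simp]: "u \<in> Hom Q ?Z (U X)" "v \<in> Hom Q ?Z (U X)" by (simp_all add: disc_Hom)
  have fuv [simp]: "cmp P Z (U (U X)) (U (U Y)) f u \<in> Hom Q ?Z (U Y)"
    "cmp P Z (U (U X)) (U (U Y)) f v \<in> Hom Q ?Z (U Y)"
    by (simp_all add: disc_Hom)
  show "\<gamma> \<le>[P,Z] inst P Z (U (e (U (U Y), r Y))) (U (e (U (U Y), r Y))) (r (e (U (U Y), r Y)))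
    (cmp P Z (U (e (U (U X), r X))) (U (e (U (U Y), r Y))) f u)
      (cmp P Z (U (e (U (U X), r X))) (U (e (U (U Y), r Y))) f v)"
    using QQ.Q_Hom_resp[OF f X Y _ uv, of \<gamma>] le by (simp add: descent_delta)
qed (rule mult_Ob[OF X] mult_Ob[OF Y])+

lemma Q_meet:
  assumes X: "X \<in> Ob Q" and xy: "x \<in> descent P (U X) (r X)" "y \<in> descent P (U X) (r X)"
  shows "x \<sqinter>\<^bsub>fib Q X\<^esub> y = x \<sqinter>\<^bsub>fib P (U X)\<^esub> y"
  unfolding meet_def Q_fib
  by (rule inf_semilattice.subset_finite_meets(2)[OF fib descent_subset descent_Inf])
    (use X xy in simp_all)

text \<open>
  Reindexing and meets of descent data are those of \<open>P\<close>. As a consequence the multiplication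
  strictly preserves the chosen products.
\<close>

lemma Q_prod_rel:
  assumes X [simp]: "X \<in> Ob Q" and Y [simp]: "Y \<in> Ob Q"
    and s: "\<sigma> \<in> carrier (fib Q (prd Q X X))" and t: "\<tau> \<in> carrier (fib Q (prd Q Y Y))"
  shows "prod_rel Q X \<sigma> Y \<tau> = prod_rel P (U X) \<sigma> (U Y) \<tau>"
proof -
  let ?W = "prd Q X Y"
  have W: "?W \<in> Ob Q" "prd Q ?W ?W \<in> Ob Q" by simp_all
  note c = Q.inst_closed[OF W(2) X X _ _ s] Q.inst_closed[OF W(2) Y Y _ _ t]
  have h: "cmp Q (prd Q ?W ?W) ?W X (pr1 Q X Y) (pr1 Q ?W ?W) \<in> Hom Q (prd Q ?W ?W) X"
    "cmp Q (prd Q ?W ?W) ?W X (pr1 Q X Y) (pr2 Q ?W ?W) \<in> Hom Q (prd Q ?W ?W) X"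
    "cmp Q (prd Q ?W ?W) ?W Y (pr2 Q X Y) (pr1 Q ?W ?W) \<in> Hom Q (prd Q ?W ?W) Y"
    "cmp Q (prd Q ?W ?W) ?W Y (pr2 Q X Y) (pr2 Q ?W ?W) \<in> Hom Q (prd Q ?W ?W) Y"
    by (intro Q.cmp_Hom Q.pr1_Hom Q.pr2_Hom W X Y)+
  have st: "\<sigma> \<in> carrier (fib P (prd P (U X) (U X)))" "\<tau> \<in> carrier (fib P (prd P (U Y) (U Y)))"
    using s t descent_closed by simp_all
  have "prod_rel Q X \<sigma> Y \<tau> =
    inst Q (prd Q ?W ?W) X X \<sigma> (cmp Q (prd Q ?W ?W) ?W X (pr1 Q X Y) (pr1 Q ?W ?W))
      (cmp Q (prd Q ?W ?W) ?W X (pr1 Q X Y) (pr2 Q ?W ?W))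
    \<sqinter>\<^bsub>fib Q (prd Q ?W ?W)\<^esub>
    inst Q (prd Q ?W ?W) Y Y \<tau> (cmp Q (prd Q ?W ?W) ?W Y (pr2 Q X Y) (pr1 Q ?W ?W))
      (cmp Q (prd Q ?W ?W) ?W Y (pr2 Q X Y) (pr2 Q ?W ?W))"
    unfolding prod_rel_def Let_def
    by (simp only: Q.rei_prod_arrow[OF W(1,1) X X Q.pr1_Hom[OF X Y] Q.pr1_Hom[OF X Y] s]
        Q.rei_prod_arrow[OF W(1,1) Y Y Q.pr2_Hom[OF X Y] Q.pr2_Hom[OF X Y] t])
  also have "\<dots> = prod_rel P (U X) \<sigma> (U Y) \<tau>"
    using Q_meet[OF W(2)] c(1)[OF h(1,2)] c(2)[OF h(3,4)]
    unfolding Q_inst[OF W(2) X X h(1,2)] Q_inst[OF W(2) Y Y h(3,4)] prod_rel_def Let_def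
    by (simp add: st)
  finally show ?thesis .
qed

lemma quotient_mult_hom: "quotient_mult e P \<in> hom1 ED QQ.Q Q"
proof (rule ed_homI)
  let ?m = "quotient_mult e P"
  show "elementary_doctrine QQ.Q" "elementary_doctrine Q"
    by (rule QQ.Q.elementary_doctrine_axioms Q.elementary_doctrine_axioms)+
  show "omap ?m \<in> Ob QQ.Q \<rightarrow>\<^sub>E Ob Q"
    by (auto simp: quotient_mult_def Let_def)
  show "amap ?m \<in> (\<Pi>\<^sub>E X \<in> Ob QQ.Q. \<Pi>\<^sub>E Y \<in> Ob QQ.Q. Hom QQ.Q X Y \<rightarrow>\<^sub>E Hom Q (omap ?m X)
    (omap ?m Y))"
    using mult_Hom by (auto simp: quotient_mult_def Let_def)
  show "fmap ?m \<in> (\<Pi>\<^sub>E X \<in> Ob QQ.Q. carrier (fib QQ.Q X) \<rightarrow>\<^sub>E carrier (fib Q (omap ?m X)))"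
    by (auto simp: quotient_mult_def Let_def QQ_descent)
  fix X assume X [simp]: "X \<in> Ob QQ.Q"
  have m: "omap ?m X = e (U (U X), r X)" by simp
  show "amap ?m X X (idn QQ.Q X) = idn Q (omap ?m X)" using QQ.Q.idn_Hom[OF X] by simp
  show "preserves_finite_meets (fib QQ.Q X) (fib Q (omap ?m X)) (fmap ?m X)"
    using preserves_finite_meets_cong[OF preserves_finite_meets_id _ QQ.Q.fib[OF X]]
      by (simp add: QQ_fib QQ_descent)
  have pr: "prd Q (e (U (U X), r X)) (e (U (U Y), r Y)) = omap ?m (prd QQ.Q X Y)"
    if [simp]: "Y \<in> Ob QQ.Q" for Y
    by (rule Q_eqI) (use mult_Ob[OF QQ.Q_prd_Ob[OF X \<open>Y \<in> Ob QQ.Q\<close>]] QQ.r_closed[OF X]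
      QQ.r_closed[of Y] in \<open>simp_all add: Q_prod_rel\<close>)
  show "is_product Q (omap ?m X) (omap ?m Y) (omap ?m (prd QQ.Q X Y))
    (amap ?m (prd QQ.Q X Y) X (pr1 QQ.Q X Y)) (amap ?m (prd QQ.Q X Y) Y (pr2 QQ.Q X Y))"
    if Y [simp]: "Y \<in> Ob QQ.Q" for Y
    using Q.prd[OF mult_Ob[OF X] mult_Ob[OF Y]] QQ.Q.pr1_Hom[OF X Y] QQ.Q.pr2_Hom[OF X Y]
      unfolding pr[OF Y]
    by simp
  show "fmap ?m (prd QQ.Q X X) (delta QQ.Q X) =
    inst Q (omap ?m (prd QQ.Q X X)) (omap ?m X) (omap ?m X) (delta Q (omap ?m X))
      (amap ?m (prd QQ.Q X X) X (pr1 QQ.Q X X)) (amap ?m (prd QQ.Q X X) X (pr2 QQ.Q X X))"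
    using QQ.Q.delta_closed[OF X] QQ.Q.pr1_Hom[OF X X] QQ.Q.pr2_Hom[OF X X]
      mult_Hom[OF QQ.Q_prd_Ob[OF X X] X QQ.Q.pr1_Hom[OF X X]]
        mult_Hom[OF QQ.Q_prd_Ob[OF X X] X QQ.Q.pr2_Hom[OF X X]]
      mult_Ob[OF QQ.Q_prd_Ob[OF X X]] by simp
  fix Y f assume Y [simp]: "Y \<in> Ob QQ.Q" and f: "f \<in> Hom QQ.Q X Y"
  show "amap ?m X Z (cmp QQ.Q X Y Z g f) =
      cmp Q (omap ?m X) (omap ?m Y) (omap ?m Z) (amap ?m Y Z g) (amap ?m X Y f)"
    if "Z \<in> Ob QQ.Q" "g \<in> Hom QQ.Q Y Z" for Z g
    using QQ.Q.cmp_Hom[OF X Y that(1) f that(2)] f that by simp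
  show "fmap ?m X (rei QQ.Q X Y f \<alpha>) = rei Q (omap ?m X) (omap ?m Y) (amap ?m X Y f) (fmap ?m Y \<alpha>)"
    if \<alpha>: "\<alpha> \<in> carrier (fib QQ.Q Y)" for \<alpha>
    using QQ.Q.rei_closed[OF X Y f \<alpha>] f \<alpha> by simp
qed simp_all

end

section \<open>Naturality and the laws of the 2-monad\<close>

lemma (in ed_hom) image_rel_mono:
  assumes [simp]: "A \<in> Ob P" "\<rho> \<in> carrier (fib P (prd P A A))" "\<tau> \<in> carrier (fib P (prd P A A))"
    and le: "\<rho> \<le>[P,prd P A A] \<tau>"
  shows "image_rel F A \<rho> \<le>[R,prd R (omap F A) (omap F A)] image_rel F A \<tau>"
proof (subst R.le_prd_iff; (intro ballI impI)?)
  fix Z x y \<gamma>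
  assume [simp]: "Z \<in> Ob R" "x \<in> Hom R Z (omap F A)" "y \<in> Hom R Z (omap F A)"
    "\<gamma> \<in> carrier (fib R Z)"
    and l: "\<gamma> \<le>[R,Z] inst R Z (omap F A) (omap F A) (image_rel F A \<rho>) x y"
  show "\<gamma> \<le>[R,Z] inst R Z (omap F A) (omap F A) (image_rel F A \<tau>) x y"
    using image_rel_resp[of A A "idn P A" \<rho> \<tau> Z x y \<gamma>] l le by simp
qed simp_all

text \<open>
  The image of \<open>\<tau>\<close> under \<open>F\<close> contains the image of the relation that \<open>X\<close> carries, so it is an
  equivalence relation on the quotient \<open>T F X\<close>, and its generic value is \<open>F \<tau>\<close>. By uniqueness it
  is the image of \<open>\<tau>\<close> under \<open>T F\<close>. On objects, this is the naturality of \<open>\<mu>\<close>.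
\<close>

lemma (in quotient_hom) image_rel_quotient_map:
  assumes X [simp]: "X \<in> Ob PQ.Q" and \<tau>: "equiv_rel PQ.Q X \<tau>"
  shows "image_rel TF X \<tau> = image_rel F (under e X) \<tau>"
proof -
  interpret TF: ed_hom PQ.Q RQ.Q TF by (rule hom1D[OF quotient_map_hom])
  let ?A = "under e X"
  have TX: "omap TF X \<in> Ob RQ.Q" by (rule TF.omap_Ob[OF X])
  have \<tau>': "equiv_rel P ?A \<tau>" "rel e X \<le>[P,prd P ?A ?A] \<tau>" using \<tau> PQ.Q_equiv_rel_iff by simp_all
  note [simp] = P.equiv_rel_closed[OF \<tau>'(1)]
  have p: "pr1 PQ.Q X X \<in> Hom PQ.Q (prd PQ.Q X X) X" "pr2 PQ.Q X X \<in> Hom PQ.Q (prd PQ.Q X X) X"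
    by (rule PQ.Q.pr1_Hom[OF X X] PQ.Q.pr2_Hom[OF X X])+
  show ?thesis
  proof (rule TF.image_rel_eqI[OF X PQ.Q.equiv_rel_closed[OF \<tau>]])
    have "equiv_rel RQ.Q (omap TF X) (image_rel F ?A \<tau>)"
      unfolding RQ.Q_equiv_rel_iff[OF TX] using image_equiv_rel[OF _ \<tau>'(1)]
        image_rel_mono[OF _ _ _ \<tau>'(2)] by simp
    then show "image_rel F ?A \<tau> \<in> carrier (fib RQ.Q (prd RQ.Q (omap TF X) (omap TF X)))"
      by (rule RQ.Q.equiv_rel_closed)
    show "inst RQ.Q (omap TF (prd PQ.Q X X)) (omap TF X) (omap TF X) (image_rel F ?A \<tau>)
        (amap TF (prd PQ.Q X X) X (pr1 PQ.Q X X)) (amap TF (prd PQ.Q X X) X (pr2 PQ.Q X X)) =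
      fmap TF (prd PQ.Q X X) \<tau>"
      using RQ.Q_inst[OF TF.omap_Ob[OF PQ.Q_prd_Ob[OF X X]] TX TX TF.amap_Hom[OF _ X p(1)]
        TF.amap_Hom[OF _ X p(2)]]
        PQ.Q.equiv_rel_closed[OF \<tau>] p by (simp add: image_rel_generic)
  qed
qed

lemma image_rel_id:
  assumes P: "elementary_doctrine P" and "A \<in> Ob P" "\<rho> \<in> carrier (fib P (prd P A A))"
  shows "image_rel (id_map P) A \<rho> = \<rho>"
proof -
  interpret ed_hom P P "id_map P" by (rule hom1D[OF id_map_hom[OF P]])
  show ?thesis by (rule image_rel_eqI) (use assms in simp_all)
qed

lemma image_rel_comp:
  assumes F: "F \<in> hom1 ED P R" and G: "G \<in> hom1 ED R S"
    and [simp]: "A \<in> Ob P" "\<rho> \<in> carrier (fib P (prd P A A))"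
  shows "image_rel (comp_map G F) A \<rho> = image_rel G (omap F A) (image_rel F A \<rho>)"
proof -
  interpret F: ed_hom P R F by (rule hom1D[OF F])
  interpret G: ed_hom R S G by (rule hom1D[OF G])
  interpret GF: ed_hom P S "comp_map G F" by (rule hom1D[OF comp_map_hom[OF F G]])
  show ?thesis
    by (rule GF.image_rel_eqI) (simp_all add: G.image_rel_amap F.image_rel_generic)
qed

lemma (in ed_hom) image_rel_delta: "A \<in> Ob P \<Longrightarrow> image_rel F A (delta P A) = delta R (omap F A)"
  by (rule image_rel_eqI) (simp_all add: fmap_delta)

lemma (in quotient_completion) image_rel_unit:
  assumes [simp]: "A \<in> Ob P" "\<rho> \<in> carrier (fib P (prd P A A))"
  shows "image_rel (quotient_unit e P) A \<rho> = \<rho>"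
proof -
  interpret u: ed_hom P Q "quotient_unit e P" by (rule hom1D[OF quotient_unit_hom])
  show ?thesis
    by (rule u.image_rel_eqI) (simp_all add: delta_prd descent_delta disc_Hom)
qed

lemma (in iterated_quotient_completion) image_rel_mult:
  assumes X [simp]: "X \<in> Ob QQ.Q" and \<tau>: "equiv_rel QQ.Q X \<tau>"
  shows "image_rel (quotient_mult e P) X \<tau> = \<tau>"
proof -
  let ?m = "quotient_mult e P"
  interpret m: ed_hom QQ.Q Q ?m by (rule hom1D[OF quotient_mult_hom])
  have p: "pr1 QQ.Q X X \<in> Hom QQ.Q (prd QQ.Q X X) X" "pr2 QQ.Q X X \<in> Hom QQ.Q (prd QQ.Q X X) X"
    by (rule QQ.Q.pr1_Hom[OF X X] QQ.Q.pr2_Hom[OF X X])+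
  have mX: "omap ?m X \<in> Ob Q" by (rule m.omap_Ob[OF X])
  have eq: "equiv_rel Q (U X) \<tau>" "r X \<le>[Q,prd Q (U X) (U X)] \<tau>"
    using \<tau> unfolding QQ.Q_equiv_rel_iff[OF X] by blast+
  have eqP: "equiv_rel P (U (U X)) \<tau>" using eq(1) Q_equiv_rel_iff[OF QQ.U_Ob[OF X]] by blast
  note [simp] = equiv_rel_closed[OF eqP]
  show ?thesis
  proof (rule m.image_rel_eqI[OF X QQ.Q.equiv_rel_closed[OF \<tau>]])
    have "equiv_rel Q (omap ?m X) \<tau>" unfolding Q_equiv_rel_iff[OF mX] using eqP eq(2) by simp
    then show "\<tau> \<in> carrier (fib Q (prd Q (omap ?m X) (omap ?m X)))" by (rule Q.equiv_rel_closed)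
    show "inst Q (omap ?m (prd QQ.Q X X)) (omap ?m X) (omap ?m X) \<tau>
        (amap ?m (prd QQ.Q X X) X (pr1 QQ.Q X X)) (amap ?m (prd QQ.Q X X) X (pr2 QQ.Q X X)) =
          fmap ?m (prd QQ.Q X X) \<tau>"
      using Q_inst[OF m.omap_Ob[OF QQ.Q_prd_Ob[OF X X]] mX mX m.amap_Hom[OF _ X p(1)]
        m.amap_Hom[OF _ X p(2)]]
        QQ.Q.equiv_rel_closed[OF \<tau>] p by simp
  qed
qed

lemma Tq_simps [simp]:
  "T0 (Tq e) = quotient_doctrine e" "T1 (Tq e) = quotient_map e" "T2 (Tq e) = quotient_trans e"
  "unit (Tq e) = quotient_unit e" "mult (Tq e) = quotient_mult e"
  by (simp_all add: Tq_def)

context iterated_quotient_completion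
begin

lemma map_unit_hom: "quotient_map e (quotient_unit e P) \<in> hom1 ED Q QQ.Q"
proof -
  interpret u: quotient_hom P Q "quotient_unit e P" e
    by (intro quotient_hom.intro hom1D quotient_unit_hom quotient_hom_axioms.intro inj_e)
  show ?thesis by (rule u.quotient_map_hom)
qed

lemma omap_map_unit: "X \<in> Ob Q \<Longrightarrow> omap (quotient_map e (quotient_unit e P)) X =
  e (e (U X, delta P (U X)), r X)"
  by (simp add: image_rel_unit)

lemma map_unit_Ob: "X \<in> Ob Q \<Longrightarrow> e (e (U X, delta P (U X)), r X) \<in> Ob QQ.Q"
  using ed_hom.omap_Ob[OF hom1D[OF map_unit_hom]] by (simp add: image_rel_unit)

end

lemma (in elementary_doctrine) iterated_quotient_completionI:
  "inj e \<Longrightarrow> iterated_quotient_completion P e"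
  by (intro iterated_quotient_completion.intro quotient_completionI)

lemma quotient_homI: "\<lbrakk>F \<in> hom1 ED P R; inj e\<rbrakk> \<Longrightarrow> quotient_hom P R F e"
  by (intro quotient_hom.intro hom1D quotient_hom_axioms.intro)

lemma quotient_map_id:
  assumes P: "elementary_doctrine P" and e: "inj e"
  shows "quotient_map e (id_map P) = id_map (quotient_doctrine e P)"
proof -
  interpret F: quotient_hom P P "id_map P" e by (rule quotient_homI[OF id_map_hom[OF P] e])
  show ?thesis
    using F.quotient_map_hom id_map_hom[OF F.PQ.Q.elementary_doctrine_axioms]
      F.PQ.Q_HomD F.P.descent_closed
    by (auto intro!: ed_hom_eqI simp: image_rel_id[OF P])
qed

lemma quotient_map_comp:
  assumes F: "F \<in> hom1 ED P R" and G: "G \<in> hom1 ED R S" and e: "inj e"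
  shows "quotient_map e (comp_map G F) = comp_map (quotient_map e G) (quotient_map e F)"
    (is "?L = ?R")
proof -
  interpret F: quotient_hom P R F e by (rule quotient_homI[OF F e])
  interpret G: quotient_hom R S G e by (rule quotient_homI[OF G e])
  interpret GF: quotient_hom P S "comp_map G F" e by (rule quotient_homI[OF comp_map_hom[OF F G] e])
  interpret TF: ed_hom F.PQ.Q F.RQ.Q "quotient_map e F" by (rule hom1D[OF F.quotient_map_hom])
  show ?thesis
  proof (rule ed_hom_eqI[OF GF.quotient_map_hom comp_map_hom[OF F.quotient_map_hom
    G.quotient_map_hom]])
    fix X assume X [simp]: "X \<in> Ob F.PQ.Q"
    note [simp] = TF.omap_Ob[OF X, simplified]
    show "omap ?L X = omap ?R X"
      by (simp add: image_rel_comp[OF F G])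
    show "amap ?L X Y f = amap ?R X Y f"
      if Y [simp]: "Y \<in> Ob F.PQ.Q" and f: "f \<in> Hom F.PQ.Q X Y" for Y f
      using f F.PQ.Q_HomD[OF f] TF.omap_Ob[OF Y] TF.amap_Hom[OF X Y f] by simp
    show "fmap ?L X \<alpha> = fmap ?R X \<alpha>"
      if a: "\<alpha> \<in> carrier (fib F.PQ.Q X)" for \<alpha>
      using a F.P.descent_closed[of \<alpha>] TF.fmap_closed[OF X a] by simp
  qed
qed

lemma quotient_unit_natural:
  assumes F: "F \<in> hom1 ED P R" and e: "inj e"
  shows "comp_map (quotient_unit e R) F = comp_map (quotient_map e F) (quotient_unit e P)"
    (is "?L = ?R")
proof -
  interpret F: quotient_hom P R F e by (rule quotient_homI[OF F e])
  show ?thesis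
  proof (rule ed_hom_eqI[OF comp_map_hom[OF F F.RQ.quotient_unit_hom]
    comp_map_hom[OF F.PQ.quotient_unit_hom F.quotient_map_hom]])
    fix A assume A [simp]: "A \<in> Ob P"
    show "omap ?L A = omap ?R A"
      by (simp add: F.image_rel_delta)
    show "amap ?L A B f = amap ?R A B f"
      if [simp]: "B \<in> Ob P" "f \<in> Hom P A B" for B f
      by (simp add: F.PQ.disc_Hom)
    show "fmap ?L A \<alpha> = fmap ?R A \<alpha>"
      if [simp]: "\<alpha> \<in> carrier (fib P A)" for \<alpha>
      by (simp add: F.P.descent_delta)
  qed
qed

lemma quotient_mult_natural:
  assumes F: "F \<in> hom1 ED P R" and e: "inj e"
  shows "comp_map (quotient_mult e R) (quotient_map e (quotient_map e F)) =
    comp_map (quotient_map e F) (quotient_mult e P)" (is "?L = ?R")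
proof -
  interpret F: quotient_hom P R F e by (rule quotient_homI[OF F e])
  interpret TF: quotient_hom F.PQ.Q F.RQ.Q "quotient_map e F" e
    by (rule quotient_homI[OF F.quotient_map_hom e])
  interpret P2: iterated_quotient_completion P e by (rule F.P.iterated_quotient_completionI[OF e])
  interpret R2: iterated_quotient_completion R e by (rule F.R.iterated_quotient_completionI[OF e])
  note TTF = TF.quotient_map_hom
  interpret TTF: ed_hom TF.PQ.Q TF.RQ.Q "quotient_map e (quotient_map e F)" by (rule hom1D[OF TTF])
  interpret mP: ed_hom TF.PQ.Q F.PQ.Q "quotient_mult e P" by (rule hom1D[OF P2.quotient_mult_hom])
  show ?thesis
  proof (rule ed_hom_eqI[OF comp_map_hom[OF TTF R2.quotient_mult_hom]
    comp_map_hom[OF P2.quotient_mult_hom F.quotient_map_hom]])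
    fix X assume X [simp]: "X \<in> Ob TF.PQ.Q"
    show "omap ?L X = omap ?R X"
      using TTF.omap_Ob[OF X] by (simp add: TF.PQ.r_equiv F.image_rel_quotient_map)
    show "amap ?L X Y f = amap ?R X Y f"
      if Y [simp]: "Y \<in> Ob TF.PQ.Q" and f: "f \<in> Hom TF.PQ.Q X Y" for Y f
      using f TF.PQ.Q_HomD[OF f] TTF.omap_Ob[OF X] TTF.omap_Ob[OF Y] TTF.amap_Hom[OF X Y f]
        mP.amap_Hom[OF X Y f] by simp
    show "fmap ?L X \<alpha> = fmap ?R X \<alpha>"
      if a: "\<alpha> \<in> carrier (fib TF.PQ.Q X)" for \<alpha>
      using a TTF.omap_Ob[OF X] TTF.fmap_closed[OF X a] mP.fmap_closed[OF X a]
        F.PQ.Q.descent_closed[of \<alpha>] by simp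
  qed
qed

context iterated_quotient_completion
begin

lemma quotient_mult_assoc:
  "comp_map (quotient_mult e P) (quotient_map e (quotient_mult e P)) =
    comp_map (quotient_mult e P) (quotient_mult e Q)" (is "?L = ?R")
proof -
  interpret Q2: iterated_quotient_completion Q e by (rule Q.iterated_quotient_completionI[OF inj_e])
  note m = quotient_mult_hom and mQ = Q2.quotient_mult_hom
  interpret Tm: quotient_hom QQ.Q Q "quotient_mult e P" e by (rule quotient_homI[OF m inj_e])
  interpret TmH: ed_hom Q2.QQ.Q QQ.Q "quotient_map e (quotient_mult e P)"
    by (rule hom1D[OF Tm.quotient_map_hom])
  interpret mQ: ed_hom Q2.QQ.Q QQ.Q "quotient_mult e Q" by (rule hom1D[OF mQ])
  show ?thesis
  proof (rule ed_hom_eqI[OF comp_map_hom[OF Tm.quotient_map_hom m] comp_map_hom[OF mQ m]])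
    fix X assume X [simp]: "X \<in> Ob Q2.QQ.Q"
    note oX = TmH.omap_Ob[OF X] mQ.omap_Ob[OF X]
    show "omap ?L X = omap ?R X"
      using oX by (simp add: image_rel_mult Q2.QQ.r_equiv)
    show "amap ?L X Y f = amap ?R X Y f"
      if Y [simp]: "Y \<in> Ob Q2.QQ.Q" and f: "f \<in> Hom Q2.QQ.Q X Y" for Y f
      using oX TmH.omap_Ob[OF Y] mQ.omap_Ob[OF Y] TmH.amap_Hom[OF X Y f] mQ.amap_Hom[OF X Y f]
        f Q2.QQ.Q_HomD[OF f] by simp
    show "fmap ?L X \<alpha> =
      fmap ?R X \<alpha>"
      if a: "\<alpha> \<in> carrier (fib Q2.QQ.Q X)" for \<alpha>
      using oX a TmH.fmap_closed[OF X a] mQ.fmap_closed[OF X a] QQ.Q.descent_closed[of \<alpha>] by simp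
  qed
qed

lemma quotient_mult_unit_left: "comp_map (quotient_mult e P) (quotient_unit e Q) = id_map Q"
  (is "?L = ?R")
proof -
  interpret u: ed_hom Q QQ.Q "quotient_unit e Q" by (rule hom1D[OF QQ.quotient_unit_hom])
  show ?thesis
  proof (rule ed_hom_eqI[OF comp_map_hom[OF QQ.quotient_unit_hom quotient_mult_hom]
    id_map_hom[OF Q.elementary_doctrine_axioms]])
    fix X assume X [simp]: "X \<in> Ob Q"
    show "omap ?L X = omap ?R X"
      using u.omap_Ob[OF X] by simp
    show "amap ?L X Y f = amap ?R X Y f"
      if Y: "Y \<in> Ob Q" and f: "f \<in> Hom Q X Y" for Y f
      using u.omap_Ob[OF X] u.omap_Ob[OF Y] u.amap_Hom[OF X Y f] Y f by simp
    show "fmap ?L X \<alpha> = fmap ?R X \<alpha>"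
      if a: "\<alpha> \<in> carrier (fib Q X)" for \<alpha>
      using u.omap_Ob[OF X] u.fmap_closed[OF X a] a by simp
  qed
qed

lemma quotient_mult_unit_right: "comp_map (quotient_mult e P) (quotient_map e (quotient_unit e P))
  = id_map Q" (is "?L = ?R")
proof -
  let ?Tu = "quotient_map e (quotient_unit e P)"
  interpret Tu: ed_hom Q QQ.Q ?Tu by (rule hom1D[OF map_unit_hom])
  show ?thesis
  proof (rule ed_hom_eqI[OF comp_map_hom[OF map_unit_hom quotient_mult_hom]
    id_map_hom[OF Q.elementary_doctrine_axioms]])
    fix X assume X [simp]: "X \<in> Ob Q"
    show "omap (comp_map (quotient_mult e P) ?Tu) X = omap ?R X"
      using Tu.omap_Ob[OF X] by (simp add: image_rel_unit)
    show "amap (comp_map (quotient_mult e P) ?Tu) X Y f = amap ?R X Y f"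
      if Y: "Y \<in> Ob Q" and f: "f \<in> Hom Q X Y" for Y f
      using Tu.omap_Ob[OF X] Tu.omap_Ob[OF Y] Tu.amap_Hom[OF X Y f] Y f Q_HomD[OF f] by simp
    show "fmap (comp_map (quotient_mult e P) ?Tu) X \<alpha> = fmap ?R X \<alpha>"
      if a: "\<alpha> \<in> carrier (fib Q X)" for \<alpha>
      using Tu.omap_Ob[OF X] Tu.fmap_closed[OF X a] a descent_closed[of \<alpha>] by simp
  qed
qed

end

lemma quotient_trans_id:
  assumes F: "F \<in> hom1 ED P R" and e: "inj e"
  shows "quotient_trans e (id_trans F) = id_trans (quotient_map e F)"
proof -
  interpret F: quotient_hom P R F e by (rule quotient_homI[OF F e])
  show ?thesis
    by (rule ed_cell_eqI[OF quotient_trans_cell[OF F F id_trans_cell[OF F] e]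
          id_trans_cell[OF F.quotient_map_hom] F.quotient_map_hom]) simp
qed

lemma quotient_trans_vcomp:
  assumes F: "F \<in> hom1 ED P R" and G: "G \<in> hom1 ED P R" and H: "H \<in> hom1 ED P R"
    and t: "\<theta> \<in> hom2 ED F G" and p: "\<phi> \<in> hom2 ED G H" and e: "inj e"
  shows "quotient_trans e (vcomp_trans \<phi> \<theta>) = vcomp_trans (quotient_trans e \<phi>) (quotient_trans e \<theta>)"
proof -
  interpret t: ed_cell P R F G \<theta> by (rule hom2D[OF F G t])
  interpret p: ed_cell P R G H \<phi> by (rule hom2D[OF G H p])
  interpret F: quotient_hom P R F e by (rule quotient_homI[OF F e])
  interpret G: quotient_hom P R G e by (rule quotient_homI[OF G e])
  interpret H: quotient_hom P R H e by (rule quotient_homI[OF H e])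
  show ?thesis
    by (rule ed_cell_eqI[OF quotient_trans_cell[OF F H vcomp_trans_cell[OF F G H t p] e]
          vcomp_trans_cell[OF F.quotient_map_hom G.quotient_map_hom H.quotient_map_hom
            quotient_trans_cell[OF F G t e] quotient_trans_cell[OF G H p e]] F.quotient_map_hom])
              simp
qed

lemma quotient_trans_hcomp:
  assumes F: "F \<in> hom1 ED P R" and F': "F' \<in> hom1 ED P R" and G: "G \<in> hom1 ED R S"
    and G': "G' \<in> hom1 ED R S"
    and t: "\<theta> \<in> hom2 ED F F'" and p: "\<phi> \<in> hom2 ED G G'" and e: "inj e"
  shows "quotient_trans e (hcomp_trans \<phi> \<theta>) = hcomp_trans (quotient_trans e \<phi>)
    (quotient_trans e \<theta>)" (is "?L = ?R")
proof (rule ed_cell_eqI[OF quotient_trans_cell[OF comp_map_hom[OF F G] comp_map_hom[OF F' G']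
  hcomp_trans_cell[OF F F' G G' t p] e]])
  interpret t: ed_cell P R F F' \<theta> by (rule hom2D[OF F F' t])
  interpret p: ed_cell R S G G' \<phi> by (rule hom2D[OF G G' p])
  interpret F: quotient_hom P R F e by (rule quotient_homI[OF F e])
  interpret F': quotient_hom P R F' e by (rule quotient_homI[OF F' e])
  interpret G: quotient_hom R S G e by (rule quotient_homI[OF G e])
  interpret G': quotient_hom R S G' e by (rule quotient_homI[OF G' e])
  note TF = F.quotient_map_hom and TF' = F'.quotient_map_hom and TG = G.quotient_map_hom
    and TG' = G'.quotient_map_hom
  note Tt = quotient_trans_cell[OF F F' t e]
  interpret Tt: ed_cell F.PQ.Q F.RQ.Q "quotient_map e F" "quotient_map e F'" "quotient_trans e \<theta>"
    by (rule hom2D[OF TF TF' Tt])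
  show "?R \<in>
      hom2 ED (quotient_map e (comp_map G F)) (quotient_map e (comp_map G' F'))"
    using hcomp_trans_cell[OF TF TF' TG TG' Tt quotient_trans_cell[OF G G' p e]]
    unfolding quotient_map_comp[OF F G e] quotient_map_comp[OF F' G' e] .
  show "quotient_map e (comp_map G F) \<in> hom1 ED F.PQ.Q G.RQ.Q"
    unfolding quotient_map_comp[OF F G e] by (rule comp_map_hom[OF TF TG])
  fix X assume X [simp]: "X \<in> Ob F.PQ.Q"
  show "component ?L X = component ?R X"
    using Tt.F.omap_Ob[OF X] Tt.G.omap_Ob[OF X] Tt.component_Hom[OF X] by simp
qed

lemma quotient_unit_natural_trans:
  assumes F: "F \<in> hom1 ED P R" and F': "F' \<in> hom1 ED P R" and t: "\<theta> \<in> hom2 ED F F'" and e: "inj e"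
  shows "hcomp_trans (id_trans (quotient_unit e R)) \<theta> =
    hcomp_trans (quotient_trans e \<theta>) (id_trans (quotient_unit e P))" (is "?L = ?R")
proof -
  interpret t: ed_cell P R F F' \<theta> by (rule hom2D[OF F F' t])
  interpret F: quotient_hom P R F e by (rule quotient_homI[OF F e])
  interpret F': quotient_hom P R F' e by (rule quotient_homI[OF F' e])
  note uP = F.PQ.quotient_unit_hom and uR = F.RQ.quotient_unit_hom
  show ?thesis
  proof (rule ed_cell_eqI[OF hcomp_trans_cell[OF F F' uR uR t id_trans_cell[OF uR]]
    _ comp_map_hom[OF F uR]])
    show "?R \<in>
      hom2 ED (comp_map (quotient_unit e R) F) (comp_map (quotient_unit e R) F')"
      using hcomp_trans_cell[OF uP uP F.quotient_map_hom F'.quotient_map_hom id_trans_cell[OF uP]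
        quotient_trans_cell[OF F F' t e]]
      unfolding quotient_unit_natural[OF F e] quotient_unit_natural[OF F' e] .
    fix A assume A [simp]: "A \<in> Ob P"
    have i: "idn P A \<in> Hom F.PQ.Q (e (A, delta P A)) (e (A, delta P A))"
      by (simp add: F.PQ.disc_Hom)
    show "component ?L A = component ?R A"
      using i F.RQ.disc_Hom[of "omap F A"] by simp
  qed
qed

lemma quotient_mult_natural_trans:
  assumes F: "F \<in> hom1 ED P R" and F': "F' \<in> hom1 ED P R" and t: "\<theta> \<in> hom2 ED F F'" and e: "inj e"
  shows "hcomp_trans (id_trans (quotient_mult e R)) (quotient_trans e (quotient_trans e \<theta>)) =
    hcomp_trans (quotient_trans e \<theta>) (id_trans (quotient_mult e P))" (is "?L = ?R")
proof -
  interpret t: ed_cell P R F F' \<theta> by (rule hom2D[OF F F' t])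
  interpret F: quotient_hom P R F e by (rule quotient_homI[OF F e])
  interpret F': quotient_hom P R F' e by (rule quotient_homI[OF F' e])
  note TF = F.quotient_map_hom and TF' = F'.quotient_map_hom
    and Tt = quotient_trans_cell[OF F F' t e]
  interpret P2: iterated_quotient_completion P e by (rule t.F.P.iterated_quotient_completionI[OF e])
  interpret R2: iterated_quotient_completion R e by (rule t.F.R.iterated_quotient_completionI[OF e])
  note mP = P2.quotient_mult_hom and mR = R2.quotient_mult_hom
  interpret TF: quotient_hom F.PQ.Q F.RQ.Q "quotient_map e F" e by (rule quotient_homI[OF TF e])
  interpret TF': quotient_hom F.PQ.Q F.RQ.Q "quotient_map e F'" e by (rule quotient_homI[OF TF' e])
  note TTF = TF.quotient_map_hom and TTF' = TF'.quotient_map_hom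
    and TTt = quotient_trans_cell[OF TF TF' Tt e]
  interpret TTt: ed_cell P2.QQ.Q R2.QQ.Q "quotient_map e (quotient_map e F)"
    "quotient_map e (quotient_map e F')"
    "quotient_trans e (quotient_trans e \<theta>)"
    by (rule hom2D[OF TTF TTF' TTt])
  interpret mP: ed_hom P2.QQ.Q F.PQ.Q "quotient_mult e P" by (rule hom1D[OF mP])
  show ?thesis
  proof (rule ed_cell_eqI[OF hcomp_trans_cell[OF TTF TTF' mR mR TTt id_trans_cell[OF mR]]
    _ comp_map_hom[OF TTF mR]])
    show "?R \<in>
      hom2 ED (comp_map (quotient_mult e R) (quotient_map e (quotient_map e F)))
        (comp_map (quotient_mult e R) (quotient_map e (quotient_map e F')))"
      using hcomp_trans_cell[OF mP mP TF TF' id_trans_cell[OF mP] Tt]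
      unfolding quotient_mult_natural[OF F e] quotient_mult_natural[OF F' e] .
    fix X assume X [simp]: "X \<in> Ob P2.QQ.Q"
    show "component ?L X = component ?R X"
      using TTt.F.omap_Ob[OF X] TTt.G.omap_Ob[OF X] TTt.component_Hom[OF X]
        mP.omap_Ob[OF X] F.PQ.Q.idn_Hom[OF mP.omap_Ob[OF X]] by simp
  qed
qed

theorem two_monad_Tq:
  fixes e :: "'o \<times> 'p \<Rightarrow> 'o"
  assumes e: "inj e"
  shows "two_monad (ED :: (('o, 'm, 'p) doctrine, ('o, 'm, 'p) doctrine_map, ('o, 'm, 'p)
    doctrine_trans) two_category) (Tq e)"
proof (intro two_monad.intro two_category_ED two_monad_axioms.intro)
  let ?K = "ED :: (('o, 'm, 'p) doctrine, ('o, 'm, 'p) doctrine_map, ('o, 'm, 'p) doctrine_trans)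
    two_category"
  let ?T = "Tq e :: (('o, 'm, 'p) doctrine, ('o, 'm, 'p) doctrine_map, ('o, 'm, 'p) doctrine_trans)
    two_monad"
  {
    fix P assume "P \<in> cell0 ?K"
    then have P: "elementary_doctrine P" by simp
    interpret P: elementary_doctrine P by (rule P)
    interpret iterated_quotient_completion P e by (rule P.iterated_quotient_completionI[OF e])
    show "T0 ?T P \<in> cell0 ?K" using Q.elementary_doctrine_axioms by simp
    show "T1 ?T (one1 ?K P) = one1 ?K (T0 ?T P)" using quotient_map_id[OF P e] by simp
    show "unit ?T P \<in> hom1 ?K P (T0 ?T P)" using quotient_unit_hom by simp
    show "mult ?T P \<in> hom1 ?K (T0 ?T (T0 ?T P)) (T0 ?T P)" using quotient_mult_hom by simp
    show "mult ?T P \<odot>\<^bsub>?K\<^esub> T1 ?T (mult ?T P) = mult ?T P \<odot>\<^bsub>?K\<^esub> mult ?T (T0 ?T P)"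
      using quotient_mult_assoc by simp
    show "mult ?T P \<odot>\<^bsub>?K\<^esub> unit ?T (T0 ?T P) = one1 ?K (T0 ?T P)" using quotient_mult_unit_left
      by simp
    show "mult ?T P \<odot>\<^bsub>?K\<^esub> T1 ?T (unit ?T P) = one1 ?K (T0 ?T P)" using quotient_mult_unit_right
      by simp
  next
    fix F P R assume F: "F \<in> hom1 ?K P R"
    show "T1 ?T F \<in> hom1 ?K (T0 ?T P) (T0 ?T R)"
      using quotient_hom.quotient_map_hom[OF quotient_homI[OF F e]] by simp
    show "unit ?T R \<odot>\<^bsub>?K\<^esub> F = T1 ?T F \<odot>\<^bsub>?K\<^esub> unit ?T P" using quotient_unit_natural[OF F e] by simp
    show "mult ?T R \<odot>\<^bsub>?K\<^esub> T1 ?T (T1 ?T F) = T1 ?T F \<odot>\<^bsub>?K\<^esub> mult ?T P"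
      using quotient_mult_natural[OF F e] by simp
    show "T1 ?T (G \<odot>\<^bsub>?K\<^esub> F) = T1 ?T G \<odot>\<^bsub>?K\<^esub> T1 ?T F" if "G \<in> hom1 ?K R S" for G S
      using quotient_map_comp[OF F that e] by simp
  next
    fix F assume "F \<in> cell1 ?K"
    then obtain P R where F: "F \<in> hom1 ?K P R" unfolding hom1_def by simp
    show "T2 ?T (one2 ?K F) = one2 ?K (T1 ?T F)" using quotient_trans_id[OF F e] by simp
  next
    fix F G \<theta> assume t: "\<theta> \<in> hom2 ?K F G"
    then obtain P R where F: "F \<in> hom1 ?K P R" and G: "G \<in> hom1 ?K P R" using hom2_hom1 by blast
    show "T2 ?T \<theta> \<in> hom2 ?K (T1 ?T F) (T1 ?T G)" using quotient_trans_cell[OF F G t e] by simp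
    fix H \<phi> assume p: "\<phi> \<in> hom2 ?K G H"
    have H: "H \<in> hom1 ?K P R" using hom2_hom1(2)[OF p] G unfolding hom1_def by simp
    show "T2 ?T (\<phi> \<bullet>\<^bsub>?K\<^esub> \<theta>) = T2 ?T \<phi> \<bullet>\<^bsub>?K\<^esub> T2 ?T \<theta>" using quotient_trans_vcomp[OF F G H t p e]
      by simp
  next
    fix F F' P R \<theta>
    assume F: "F \<in> hom1 ?K P R" and F': "F' \<in> hom1 ?K P R" and t: "\<theta> \<in> hom2 ?K F F'"
    show "one2 ?K (unit ?T R) \<star>\<^bsub>?K\<^esub> \<theta> = T2 ?T \<theta> \<star>\<^bsub>?K\<^esub> one2 ?K (unit ?T P)"
      using quotient_unit_natural_trans[OF F F' t e] by simp
    show "one2 ?K (mult ?T R) \<star>\<^bsub>?K\<^esub> T2 ?T (T2 ?T \<theta>) = T2 ?T \<theta> \<star>\<^bsub>?K\<^esub> one2 ?K (mult ?T P)"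
      using quotient_mult_natural_trans[OF F F' t e] by simp
    show "T2 ?T (\<phi> \<star>\<^bsub>?K\<^esub> \<theta>) = T2 ?T \<phi> \<star>\<^bsub>?K\<^esub> T2 ?T \<theta>"
      if "G \<in> hom1 ?K R S" "G' \<in> hom1 ?K R S" "\<phi> \<in> hom2 ?K G G'" for G G' S \<phi>
      using quotient_trans_hcomp[OF F F' that(1,2) t that(3) e] by simp
  }
qed

section \<open>The comparison of the two units\<close>

text \<open>
  The 2-cell \<open>\<Lambda> : T \<eta> \<Rightarrow> \<eta> T\<close> that consists of the identities \<open>((A, \<delta>), \<rho>) \<rightarrow> ((A, \<rho>), \<rho>)\<close>.
\<close>

definition quotient_unit_comparison ::
  "('o \<times> 'p \<Rightarrow> 'o) \<Rightarrow> ('o, 'm, 'p) doctrine \<Rightarrow> ('o, 'm, 'p) doctrine_trans" where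
  "quotient_unit_comparison e P = \<lparr>dom_m = quotient_map e (quotient_unit e P),
    cod_m = quotient_unit e (quotient_doctrine e P),
    component = (\<lambda>X \<in> Ob (quotient_doctrine e P). idn P (under e X))\<rparr>"

lemma quotient_unit_comparison_simps [simp]:
  "dom_m (quotient_unit_comparison e P) = quotient_map e (quotient_unit e P)"
  "cod_m (quotient_unit_comparison e P) = quotient_unit e (quotient_doctrine e P)"
  "X \<in> Ob (quotient_doctrine e P) \<Longrightarrow> component (quotient_unit_comparison e P) X = idn P (under e X)"
  by (simp_all add: quotient_unit_comparison_def)

context iterated_quotient_completion
begin

text \<open>
  The identity of \<open>A\<close> is an arrow \<open>(A, \<delta>) \<rightarrow> (A, \<rho>)\<close>, and over it both objects carry the same
  relation \<open>\<rho>\<close>.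
\<close>

lemma unit_comparison_cell:
  "quotient_unit_comparison e P \<in> hom2 ED (quotient_map e (quotient_unit e P)) (quotient_unit e Q)"
proof (rule ed_cellI[OF map_unit_hom QQ.quotient_unit_hom])
  let ?Tu = "quotient_map e (quotient_unit e P)" and ?uT = "quotient_unit e Q"
  have c: "idn P (U X) \<in> Hom QQ.Q (omap ?Tu X) (omap ?uT X)" if X [simp]: "X \<in> Ob Q" for X
    unfolding omap_map_unit[OF X]
  proof (rule QQ.Q_HomI[OF map_unit_Ob[OF X]])
    let ?D = "e (U X, delta P (U X))"
    show "omap ?uT X \<in> Ob QQ.Q" using QQ.disc_Ob[OF X] by simp
    show "idn P (U X) \<in> Hom Q (U (e (?D, r X))) (U (omap ?uT X))" by (simp add: disc_Hom)
    fix Z u v \<gamma>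
    assume Z [simp]: "Z \<in> Ob Q" and u: "u \<in> Hom Q Z (U (e (?D, r X)))"
      and v: "v \<in> Hom Q Z (U (e (?D, r X)))"
      and le: "\<gamma> \<le>[Q,Z] inst Q Z (U (e (?D, r X))) (U (e (?D, r X))) (r (e (?D, r X))) u v"
    have uD: "u \<in> Hom Q Z ?D" "v \<in> Hom Q Z ?D" using u v by simp_all
    have [simp]: "u \<in> Hom P (U Z) (U X)" "v \<in> Hom P (U Z) (U X)" using uD Q_HomD by fastforce+
    have "idn P (U X) \<in> Hom Q ?D X" by (simp add: disc_Hom)
    from Q.cmp_Hom[OF Z disc_Ob X uD(1) this] Q.cmp_Hom[OF Z disc_Ob X uD(2) this]
    have "u \<in> Hom Q Z X" "v \<in> Hom Q Z X" by simp_all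
    then show "\<gamma> \<le>[Q,Z] inst Q Z (U (omap ?uT X)) (U (omap ?uT X)) (r (omap ?uT X))
      (cmp Q Z (U (e (?D, r X))) (U (omap ?uT X)) (idn P (U X)) u)
        (cmp Q Z (U (e (?D, r X))) (U (omap ?uT X)) (idn P (U X)) v)"
      using le uD by simp
  qed
  show "component (quotient_unit_comparison e P) \<in> (\<Pi>\<^sub>E X \<in>
    Ob Q. Hom QQ.Q (omap ?Tu X) (omap ?uT X))"
    using c by (simp add: quotient_unit_comparison_def)
  fix X assume X [simp]: "X \<in> Ob Q"
  show "cmp QQ.Q (omap ?Tu X) (omap ?Tu Y) (omap ?uT Y)
    (component (quotient_unit_comparison e P) Y) (amap ?Tu X Y f) =
    cmp QQ.Q (omap ?Tu X) (omap ?uT X) (omap ?uT Y) (amap ?uT X Y f)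
      (component (quotient_unit_comparison e P) X)"
    if "Y \<in> Ob Q" "f \<in> Hom Q X Y" for Y f
    using that Q_HomD[of f X Y] by simp
  show "fmap ?Tu X \<alpha> \<le>[QQ.Q,omap ?Tu X]
    rei QQ.Q (omap ?Tu X) (omap ?uT X) (component (quotient_unit_comparison e P) X) (fmap ?uT X \<alpha>)"
    if "\<alpha> \<in> carrier (fib Q X)" for \<alpha>
    using that descent_closed[of \<alpha>] by simp
qed simp_all

text \<open>
  The multiplication sends \<open>((A, \<delta>), \<rho>)\<close> and \<open>((A, \<rho>), \<rho>)\<close> both to \<open>(A, \<rho>)\<close>, so the two 1-cells
  become equal and \<open>\<Lambda>\<close> becomes an identity. Restricted to the objects \<open>(A, \<delta>)\<close>, the two 1-cells
  are equal as well.
\<close>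

lemma quotient_mult_unit_comparison:
  "hcomp_trans (id_trans (quotient_mult e P)) (quotient_unit_comparison e P) = id_trans (id_map Q)"
    (is "?L = ?R")
proof (rule ed_cell_eqI)
  let ?Tu = "quotient_map e (quotient_unit e P)" and ?uT = "quotient_unit e Q"
  note i = id_map_hom[OF Q.elementary_doctrine_axioms]
  interpret L: ed_cell Q QQ.Q ?Tu ?uT "quotient_unit_comparison e P"
    by (rule hom2D[OF map_unit_hom QQ.quotient_unit_hom unit_comparison_cell])
  interpret m: ed_hom QQ.Q Q "quotient_mult e P" by (rule hom1D[OF quotient_mult_hom])
  show "?L \<in> hom2 ED (id_map Q) (id_map Q)"
    using hcomp_trans_cell[OF map_unit_hom QQ.quotient_unit_hom quotient_mult_hom quotient_mult_hom
        unit_comparison_cell id_trans_cell[OF quotient_mult_hom]]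
    by (simp add: quotient_mult_unit_left quotient_mult_unit_right)
  show "?R \<in> hom2 ED (id_map Q) (id_map Q)" by (rule id_trans_cell[OF i])
  show "id_map Q \<in> hom1 ED Q Q" by (rule i)
  fix X assume X [simp]: "X \<in> Ob Q"
  show "component ?L X = component ?R X"
    using L.F.omap_Ob[OF X] L.G.omap_Ob[OF X] L.component_Hom[OF X] by (simp add: image_rel_unit)
qed

lemma unit_comparison_unit:
  "hcomp_trans (quotient_unit_comparison e P) (id_trans (quotient_unit e P)) =
    id_trans (comp_map (quotient_unit e Q) (quotient_unit e P))" (is "?L = ?R")
proof (rule ed_cell_eqI)
  let ?Tu = "quotient_map e (quotient_unit e P)" and ?uT = "quotient_unit e Q"
  interpret Tu: ed_hom Q QQ.Q ?Tu by (rule hom1D[OF map_unit_hom])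
  note uu = comp_map_hom[OF quotient_unit_hom QQ.quotient_unit_hom]
  show "?L \<in>
      hom2 ED (comp_map ?uT (quotient_unit e P)) (comp_map ?uT (quotient_unit e P))"
    using hcomp_trans_cell[OF quotient_unit_hom quotient_unit_hom map_unit_hom QQ.quotient_unit_hom
        id_trans_cell[OF quotient_unit_hom] unit_comparison_cell]
    by (simp add: quotient_unit_natural[OF quotient_unit_hom inj_e])
  show "id_trans (comp_map ?uT (quotient_unit e P)) \<in>
    hom2 ED (comp_map ?uT (quotient_unit e P)) (comp_map ?uT (quotient_unit e P))"
    by (rule id_trans_cell[OF uu])
  show "comp_map ?uT (quotient_unit e P) \<in> hom1 ED P QQ.Q" by (rule uu)
  fix A assume A [simp]: "A \<in> Ob P"
  have i: "idn P A \<in> Hom Q (e (A, delta P A)) (e (A, delta P A))" by (simp add: disc_Hom)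
  show "component ?L A = component (id_trans (comp_map ?uT (quotient_unit e P))) A"
    using i by (simp add: image_rel_unit)
qed

end

theorem theorem6p17:
  fixes e :: "'o \<times> 'p \<Rightarrow> 'o"
  assumes "inj e"
  shows "lax_idempotent_two_monad
    (ED :: (('o, 'm, 'p) doctrine, ('o, 'm, 'p) doctrine_map, ('o, 'm, 'p) doctrine_trans)
      two_category)
    (Tq e)"
proof -
  let ?K = "ED :: (('o, 'm, 'p) doctrine, ('o, 'm, 'p) doctrine_map, ('o, 'm, 'p) doctrine_trans)
    two_category"
  interpret two_monad ?K "Tq e" by (rule two_monad_Tq[OF assms])
  interpret unit_comparison ?K "Tq e" "quotient_unit_comparison e"
  proof
    fix P assume "P \<in> cell0 ?K"
    then interpret P: elementary_doctrine P by simp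
    interpret iterated_quotient_completion P e by (rule P.iterated_quotient_completionI[OF assms])
    show "quotient_unit_comparison e P \<in> hom2 ?K (T1 (Tq e) (unit (Tq e) P))
      (unit (Tq e) (T0 (Tq e) P))"
      using unit_comparison_cell by simp
    show "one2 ?K (mult (Tq e) P) \<star>\<^bsub>?K\<^esub> quotient_unit_comparison e P =
      one2 ?K (one1 ?K (T0 (Tq e) P))"
      using quotient_mult_unit_comparison by simp
    show "quotient_unit_comparison e P \<star>\<^bsub>?K\<^esub> one2 ?K (unit (Tq e) P) =
        one2 ?K (unit (Tq e) (T0 (Tq e) P) \<odot>\<^bsub>?K\<^esub> unit (Tq e) P)"
      using unit_comparison_unit by simp
  qed
  show ?thesis by (rule lax_idempotent_two_monad)
qed

end
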